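(* (A finite length property.) Let $f,g$ satisfy Assumption A, let $\tau\in(0,2)$, and let $\{(\bm{x}^k,\lambda^k)\}$ be the sequence generated by the algorithm (PRADMM) of the context, which is assumed to be bounded. If $\Psi$ satisfies the Riemannian Kurdyka--Łojasiewicz property at every point of $\Omega^*$, and $\beta>\max\{\beta',\beta''\}$, then: (i) The sequence $\{(\bm{x}^k,\lambda^k)\}$ has finite length, that is, $$\sum_{k=1}^{+\infty}\Big(\|\bm{x}^{k+1}-\bm{x}^k\|+\|\lambda^{k+1}-\lambda^k\|\Big)<+\infty.$$ (ii) The sequence $\{(\bm{x}^k,\lambda^k)\}$ converges to a stationary point of $\mathcal{L}_\beta$.
   Context: Setting. Let $n\ge1$, $n_1=n_2=4n$, $n_3=n_4=3n$. $\mathcal{M}\subseteq\mathbb{R}^{n_1}$ is a smooth Riemannian submanifold embedded in Euclidean space (in the motivating pose graph problem, $\mathcal{M}$ is the Cartesian product of $n$ unit spheres of $\mathbb{R}^4$). Put $\mathcal{X}_1=\mathcal{M}$ and $\mathcal{X}_i=\mathbb{R}^{n_i}$ for $i=2,3,4$. Write $\bm{x}=(x_1,x_2,x_3,x_4)$, $x_i\in\mathbb{R}^{n_i}$; $\bm{x}_{-i}$ is $\bm{x}$ with block $i$ removed. The problem is $$\min f(x_1,x_2,x_3,x_4)+g(x_1,x_2)\quad\text{s.t.}\quad \sum_{i=1}^4A_ix_i=0,\ x_1\in\mathcal{M},$$ where the $A_i$ are the matrices with $7n$ rows such that $\sum_{i=1}^4A_ix_i=(x_1-x_2,\;x_3-x_4)\in\mathbb{R}^{4n}\times\mathbb{R}^{3n}$.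 The augmented Lagrangian is $$\mathcal{L}_\beta(\bm{x},\lambda)=f(\bm{x})+g(x_1,x_2)-\Big\langle\lambda,\sum_{i}A_ix_i\Big\rangle+\frac{\beta}{2}\Big\|\sum_{i}A_ix_i\Big\|^2,\quad\lambda\in\mathbb{R}^{7n}.$$ For symmetric $M$, $\|x\|_M^2:=\langle x,Mx\rangle$. Algorithm (PRADMM). Given $\beta>0$, $\tau\in(0,2)$, positive definite diagonal matrices $H_1,\dots,H_4$ (block diagonal, each vertex block being a positive multiple of the identity), and a starting point, for $k=0,1,2,\dots$: for $i=1,2,3,4$ successively, $$x_i^{k+1}\in\arg\min_{x_i\in\mathcal{X}_i}\ \mathcal{L}_\beta(x_1^{k+1},\dots,x_{i-1}^{k+1},x_i,x_{i+1}^k,\dots,x_4^k,\lambda^k)+\tfrac12\|x_i-x_i^k\|_{H_i}^2,$$ then $\lambda^{k+1}=\lambda^k-\tau\beta\sum_{i=1}^4A_ix_i^{k+1}$. Assumption A. (i) $f,g$ are proper, lower semicontinuous and bounded below on the feasible region: $f^*=\inf_{x_i\in\mathcal{X}_i}f>-\infty$, $g^*=\inf_{x_i\in\mathcal{X}_i}g>-\infty$. (ii) $\nabla f$ is Lipschitz continuous on bounded subsets of $\mathbb{R}^{n_1}\times\cdots\times\mathbb{R}^{n_4}$ with constant $L_f>0$: $\|\nabla f(\bm{x})-\nabla f(\bm{y})\|\le L_f\|\bm{x}-\bm{y}\|$; similarly $\nabla g$ is Lipschitz on bounded subsets of $\mathbb{R}^{n_1}\times\mathbb{R}^{n_2}$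 with constant $L_g>0$. (iii) For fixed $\bm{x}_{-i}$, the partial gradient $\nabla_if(\cdot,\bm{x}_{-i})$ is globally Lipschitz on $\mathbb{R}^{n_i}$ with a constant $L_{f,i}(\bm{x}_{-i})>0$ ($i=1,\dots,4$); similarly $\nabla_1g(\cdot,x_2)$, $\nabla_2g(x_1,\cdot)$ are globally Lipschitz with constants $L_{g,1}(x_2)>0$, $L_{g,2}(x_1)>0$. (iv) When $\bm{x}_{-i}$ ranges over a bounded subset, these constants have uniform upper bounds: $\sup L_{f,i}(\bm{x}_{-i})\le L_{f,i}$, $\sup L_{g,i}\le L_{g,i}$. (v) $f$ and $g$ are block multi-convex: for each block $i$ with the others fixed, $f(y_i,\bm{x}_{-i})\ge f(x_i,\bm{x}_{-i})+\langle\nabla_if(x_i,\bm{x}_{-i}),y_i-x_i\rangle$ for all $x_i,y_i\in\mathbb{R}^{n_i}$, and likewise for $g$. Convention on constants. $L_f,L_g,L_{f,i},L_{g,i}$ are the constants in (ii), (iv) for a fixed bounded set $B_R=\{\bm{x}:\|x_i\|\le R,\ i=1,\dots,4\}$ containing all $\bm{x}^k$. Constants. $\alpha_1=\frac{|1-\tau|}{1-|1-\tau|}$, $\alpha_2=\frac{\tau}{(1-|1-\tau|)^2}$; $\underline\kappa_i,\overline\kappa_i>0$ are the smallest and largest eigenvalues of $H_i$; $$\beta'=\max\Big\{2(L_f+L_{g,2}),\ \tfrac{2\alpha_2}{\underline\kappa_1}(7L_f^2+4L_g^2),\ \tfrac{\alpha_2}{\underline\kappa_2}(7L_f^2+4L_g^2)+\tfrac{(4\alpha_2+2)\overline\kappa_2^2}{\underline\kappa_2},\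 \tfrac{3\alpha_2+2}{\underline\kappa_3}L_f^2,\ \tfrac{3\alpha_2+2}{\underline\kappa_4}L_f^2+\tfrac{(3\alpha_2+1)\overline\kappa_4^2}{\underline\kappa_4}\Big\},$$ $$\beta''=\max\Big\{\tfrac{2\alpha_2}{\underline\kappa_1}(7L_f^2+4L_g^2),\ \tfrac{\alpha_2}{\underline\kappa_2}(7L_f^2+4L_g^2+8\overline\kappa_2^2),\ \tfrac{7\alpha_2L_f^2}{\underline\kappa_3},\ \tfrac{\alpha_2}{\underline\kappa_4}(7L_f^2+6\overline\kappa_4^2)\Big\}.$$ Lyapunov function. Let $$M_1=\tfrac12H_1-\tfrac{\alpha_2}{\beta}(7L_f^2+4L_g^2)I,\qquad M_2=H_2-\tfrac{\alpha_2}{\beta}(7L_f^2I+4L_g^2I+4H_2^\top H_2),$$ $$M_3=H_3-\tfrac{3\alpha_2}{\beta}L_f^2I,\qquad M_4=H_4-\tfrac{\alpha_2}{\beta}(3L_f^2I+3H_4^\top H_4),$$ and, for $\bm{x},\bm{y}\in\mathcal{M}\times\mathbb{R}^{n_2}\times\mathbb{R}^{n_3}\times\mathbb{R}^{n_4}$ and $\lambda,\mu\in\mathbb{R}^{7n}$, $$\Psi(\bm{x},\bm{y},\lambda,\mu)=\mathcal{L}_\beta(\bm{x},\lambda)+\frac{\alpha_1}{\tau\beta}\|\lambda-\mu\|^2+\sum_{i=1}^4\|x_i-y_i\|_{M_i}^2 .$$ $\Omega^*$ is the set of all limit points of the sequence $z^k=(\bm{x}^k,\bm{x}^{k-1},\lambda^k,\lambda^{k-1})$,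 $k\ge1$. Riemannian Kurdyka--Łojasiewicz property. A continuous function $\sigma:\mathcal{N}\to\mathbb{R}$ on a Riemannian manifold $\mathcal{N}$ has it at $\bar u$ if there are $\eta\in(0,+\infty]$, a neighborhood $U\subset\mathcal{N}$ of $\bar u$ and a continuous concave $\varphi:[0,\eta)\to\mathbb{R}_+$ with $\varphi(0)=0$, $\varphi$ of class $C^1$ on $(0,\eta)$, $\varphi'>0$ on $(0,\eta)$, such that $\varphi'(\sigma(u)-\sigma(\bar u))\operatorname{dist}(0,\hat\partial\sigma(u))\ge1$ for all $u\in U$ with $\sigma(\bar u)<\sigma(u)<\sigma(\bar u)+\eta$. Here $\hat\partial$ is the Riemannian generalized subdifferential and $\operatorname{dist}(0,\hat\partial\sigma(u))=\inf\{\|v\|_u:v\in\hat\partial\sigma(u)\}$; for the continuously differentiable function $\Psi$ this equals $\|\operatorname{grad}\Psi(u)\|$, where $\operatorname{grad}$ is the Riemannian gradient (orthogonal projection of the Euclidean gradient onto the tangent space). Stationary point. $(\hat{\bm{x}},\hat\lambda)$ with $\hat x_1\in\mathcal{M}$ is a stationary point of $\mathcal{L}_\beta$ if $\sum_iA_i\hat x_i=0$, $\operatorname{Proj}_{T_{\hat x_1}\mathcal{M}}\big(\nabla_1f(\hat{\bm{x}})+\nabla_1g(\hat x_1,\hat x_2)-A_1^\top\hat\lambda\big)=0$, $\nabla_2f(\hat{\bm{x}})+\nabla_2g(\hat x_1,\hat x_2)-A_2^\top\hat\lambda=0$, $\nabla_3f(\hat{\bm{x}})-A_3^\top\hat\lambda=0$,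 $\nabla_4f(\hat{\bm{x}})-A_4^\top\hat\lambda=0$, where $\operatorname{Proj}$ is orthogonal projection onto the tangent space. *)

theory Defs
  imports "HOL-Analysis.Analysis"
begin

section \<open>Euclidean calculus\<close>

definition grad :: "('a::real_inner \<Rightarrow> real) \<Rightarrow> 'a \<Rightarrow> 'a" where
  "grad f x = (THE D. GDERIV f x :> D)"

definition orth_proj :: "'a::real_inner set \<Rightarrow> 'a \<Rightarrow> 'a" where
  "orth_proj T x = (THE y. y \<in> T \<and> (\<forall>t\<in>T. (x - y) \<bullet> t = 0))"

definition lower_semicontinuous :: "('a::topological_space \<Rightarrow> real) \<Rightarrow> bool" where
  "lower_semicontinuous f \<longleftrightarrow> (\<forall>x. ereal (f x) \<le> Liminf (at x) (\<lambda>y. ereal (f y)))"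

text \<open>Class $C^k$ on an open set, by iterating directional derivatives. For a finite-dimensional
  domain this is the usual notion; it keeps the type of the iterated derivative fixed.\<close>

primrec Ck_on :: "nat \<Rightarrow> 'a::real_normed_vector set \<Rightarrow> ('a \<Rightarrow> 'b::real_normed_vector) \<Rightarrow> bool" where
  "Ck_on 0 S f \<longleftrightarrow> continuous_on S f"
| "Ck_on (Suc k) S f \<longleftrightarrow>
     (\<forall>x\<in>S. f differentiable (at x)) \<and>
     (\<forall>v. Ck_on k S (\<lambda>x. frechet_derivative f (at x) v))"

definition smooth_on :: "'a::real_normed_vector set \<Rightarrow> ('a \<Rightarrow> 'b::real_normed_vector) \<Rightarrow> bool" where
  "smooth_on S f \<longleftrightarrow> (\<forall>k. Ck_on k S f)"

section \<open>Embedded submanifolds of a Euclidean space\<close>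

text \<open>A slice chart is a diffeomorphism \<open>\<phi>\<close> (with inverse \<open>\<psi>\<close>) from the open set \<open>U\<close> of the ambient
  space onto an open set that flattens \<open>N\<close> to the linear subspace \<open>S\<close>; its restriction to
  \<open>U \<inter> N\<close> is a coordinate chart of \<open>N\<close> with values in \<open>S\<close>.\<close>

definition slice_chart ::
  "'a::euclidean_space set \<Rightarrow> 'a set \<Rightarrow> 'a set \<Rightarrow> ('a \<Rightarrow> 'a) \<Rightarrow> ('a \<Rightarrow> 'a) \<Rightarrow> bool" where
  "slice_chart N S U \<phi> \<psi> \<longleftrightarrow>
     subspace S \<and> open U \<and> open (\<phi> ` U) \<and> smooth_on U \<phi> \<and> smooth_on (\<phi> ` U) \<psi> \<and>
     (\<forall>x\<in>U. \<psi> (\<phi> x) = x) \<and> \<phi> ` (U \<inter> N) = \<phi> ` U \<inter> S"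

text \<open>The subspace \<open>S\<close> is the same at all points, so that \<open>N\<close> has the constant dimension \<open>dim S\<close>.
  The metric is the one induced by the ambient inner product.\<close>

definition embedded_submanifold :: "'a::euclidean_space set \<Rightarrow> bool" where
  "embedded_submanifold N \<longleftrightarrow> (\<exists>S. \<forall>p\<in>N. \<exists>U \<phi> \<psi>. p \<in> U \<and> slice_chart N S U \<phi> \<psi>)"

definition tangent_space :: "'a::euclidean_space set \<Rightarrow> 'a \<Rightarrow> 'a set" where
  "tangent_space N p =
     {v. \<exists>(\<gamma>::real \<Rightarrow> 'a) e. e > 0 \<and> smooth_on {-e<..<e} \<gamma> \<and> \<gamma> ` {-e<..<e} \<subseteq> N \<and>
         \<gamma> 0 = p \<and> (\<gamma> has_vector_derivative v) (at 0)}"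

text \<open>The Riemannian generalized (Clarke) directional derivative at \<open>u\<close> in the direction \<open>v\<close>,
  read in a chart around \<open>u\<close>:
  the limsup as \<open>y \<rightarrow> u\<close> in \<open>N\<close> (the point \<open>y = u\<close> included) and \<open>t \<down> 0\<close>.
  For locally Lipschitz \<open>\<sigma>\<close> the chart does not matter.\<close>

definition clarke_dderiv ::
  "'a::euclidean_space set \<Rightarrow> ('a \<Rightarrow> real) \<Rightarrow> ('a \<Rightarrow> 'a) \<Rightarrow> ('a \<Rightarrow> 'a) \<Rightarrow> 'a \<Rightarrow> 'a \<Rightarrow> ereal" where
  "clarke_dderiv N \<sigma> \<phi> \<psi> u v =
     Limsup (inf (nhds u) (principal N) \<times>\<^sub>F at_right 0)
       (\<lambda>(y, t::real). ereal ((\<sigma> (\<psi> (\<phi> y + t *\<^sub>R frechet_derivative \<phi> (at u) v)) - \<sigma> (\<psi> (\<phi> y))) / t))"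

definition riem_subdiff :: "'a::euclidean_space set \<Rightarrow> ('a \<Rightarrow> real) \<Rightarrow> 'a \<Rightarrow> 'a set" where
  "riem_subdiff N \<sigma> u =
     {\<xi> \<in> tangent_space N u.
        \<forall>S U \<phi> \<psi>. slice_chart N S U \<phi> \<psi> \<and> u \<in> U \<longrightarrow>
          (\<forall>v\<in>tangent_space N u. ereal (\<xi> \<bullet> v) \<le> clarke_dderiv N \<sigma> \<phi> \<psi> u v)}"

text \<open>The distance from \<open>0\<close> to the subdifferential is taken in \<open>ereal\<close>, so that it is infinite if the
  subdifferential is empty. The function \<open>\<sigma>\<close> only matters on \<open>N\<close>, and the property includes
  that \<open>u\<close> is a point of \<open>N\<close>.\<close>

definition riem_KL :: "'a::euclidean_space set \<Rightarrow> ('a \<Rightarrow> real) \<Rightarrow> 'a \<Rightarrow> bool" where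
  "riem_KL N \<sigma> u \<longleftrightarrow> u \<in> N \<and>
     (\<exists>(\<eta>::ereal) W (\<phi>::real \<Rightarrow> real) \<phi>'.
        0 < \<eta> \<and> openin (top_of_set N) W \<and> u \<in> W \<and>
        continuous_on {t. 0 \<le> t \<and> ereal t < \<eta>} \<phi> \<and>
        concave_on {t. 0 \<le> t \<and> ereal t < \<eta>} \<phi> \<and>
        (\<forall>t. 0 \<le> t \<and> ereal t < \<eta> \<longrightarrow> 0 \<le> \<phi> t) \<and> \<phi> 0 = 0 \<and>
        (\<forall>t. 0 < t \<and> ereal t < \<eta> \<longrightarrow> (\<phi> has_real_derivative \<phi>' t) (at t)) \<and>
        continuous_on {t. 0 < t \<and> ereal t < \<eta>} \<phi>' \<and>
        (\<forall>t. 0 < t \<and> ereal t < \<eta> \<longrightarrow> 0 < \<phi>' t) \<and>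
        (\<forall>w\<in>W. \<sigma> u < \<sigma> w \<and> ereal (\<sigma> w) < ereal (\<sigma> u) + \<eta> \<longrightarrow>
           1 \<le> ereal (\<phi>' (\<sigma> w - \<sigma> u)) * (INF \<xi>\<in>riem_subdiff N \<sigma> w. ereal (norm \<xi>))))"

section \<open>The problem\<close>

text \<open>With \<open>n = CARD('n)\<close>, the spaces of dimension \<open>4 n\<close> and \<open>3 n\<close> are written as \<open>n\<close> vertex blocks of
  size 4 and 3; the norms are the Euclidean ones.\<close>

type_synonym 'n blk4 = "real^4^'n"
type_synonym 'n blk3 = "real^3^'n"
type_synonym 'n vars = "'n blk4 \<times> 'n blk4 \<times> 'n blk3 \<times> 'n blk3"
type_synonym 'n mult = "'n blk4 \<times> 'n blk3"

definition A1 :: "'n::finite blk4 \<Rightarrow> 'n mult" where "A1 x = (x, 0)"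
definition A2 :: "'n::finite blk4 \<Rightarrow> 'n mult" where "A2 x = (- x, 0)"
definition A3 :: "'n::finite blk3 \<Rightarrow> 'n mult" where "A3 x = (0, x)"
definition A4 :: "'n::finite blk3 \<Rightarrow> 'n mult" where "A4 x = (0, - x)"

fun lincon :: "'n::finite vars \<Rightarrow> 'n mult" where
  "lincon (x1, x2, x3, x4) = A1 x1 + A2 x2 + A3 x3 + A4 x4"

fun aug_lagr ::
  "('n::finite vars \<Rightarrow> real) \<Rightarrow> ('n blk4 \<times> 'n blk4 \<Rightarrow> real) \<Rightarrow> real \<Rightarrow> 'n vars \<Rightarrow> 'n mult \<Rightarrow> real"
  where
  "aug_lagr f g \<beta> (x1, x2, x3, x4) l =
     f (x1, x2, x3, x4) + g (x1, x2) - l \<bullet> lincon (x1, x2, x3, x4)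
     + \<beta> / 2 * (norm (lincon (x1, x2, x3, x4)))\<^sup>2"

definition qform :: "('a::real_inner \<Rightarrow> 'a) \<Rightarrow> 'a \<Rightarrow> real" where
  "qform M x = x \<bullet> M x"

definition pos_block_diag :: "('a::real_normed_vector^'n \<Rightarrow> 'a^'n) \<Rightarrow> bool" where
  "pos_block_diag H \<longleftrightarrow> (\<exists>h. (\<forall>v. 0 < h v) \<and> H = (\<lambda>x. \<chi> v. h v *\<^sub>R (x $ v)))"

definition eigvals :: "('a::real_vector \<Rightarrow> 'a) \<Rightarrow> real set" where
  "eigvals H = {c. \<exists>v. v \<noteq> 0 \<and> H v = c *\<^sub>R v}"

definition kappa_min :: "('a::real_vector \<Rightarrow> 'a) \<Rightarrow> real" where
  "kappa_min H = Min (eigvals H)"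

definition kappa_max :: "('a::real_vector \<Rightarrow> 'a) \<Rightarrow> real" where
  "kappa_max H = Max (eigvals H)"

section \<open>Assumptions on the objective\<close>

fun pgrad1 :: "('a::real_inner \<times> 'b \<times> 'c \<times> 'd \<Rightarrow> real) \<Rightarrow> 'a \<times> 'b \<times> 'c \<times> 'd \<Rightarrow> 'a" where
  "pgrad1 f (x1, x2, x3, x4) = grad (\<lambda>y. f (y, x2, x3, x4)) x1"

fun pgrad2 :: "('a \<times> 'b::real_inner \<times> 'c \<times> 'd \<Rightarrow> real) \<Rightarrow> 'a \<times> 'b \<times> 'c \<times> 'd \<Rightarrow> 'b" where
  "pgrad2 f (x1, x2, x3, x4) = grad (\<lambda>y. f (x1, y, x3, x4)) x2"

fun pgrad3 :: "('a \<times> 'b \<times> 'c::real_inner \<times> 'd \<Rightarrow> real) \<Rightarrow> 'a \<times> 'b \<times> 'c \<times> 'd \<Rightarrow> 'c" where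
  "pgrad3 f (x1, x2, x3, x4) = grad (\<lambda>y. f (x1, x2, y, x4)) x3"

fun pgrad4 :: "('a \<times> 'b \<times> 'c \<times> 'd::real_inner \<Rightarrow> real) \<Rightarrow> 'a \<times> 'b \<times> 'c \<times> 'd \<Rightarrow> 'd" where
  "pgrad4 f (x1, x2, x3, x4) = grad (\<lambda>y. f (x1, x2, x3, y)) x4"

fun gpgrad1 :: "('a::real_inner \<times> 'b \<Rightarrow> real) \<Rightarrow> 'a \<times> 'b \<Rightarrow> 'a" where
  "gpgrad1 g (x1, x2) = grad (\<lambda>y. g (y, x2)) x1"

fun gpgrad2 :: "('a \<times> 'b::real_inner \<Rightarrow> real) \<Rightarrow> 'a \<times> 'b \<Rightarrow> 'b" where
  "gpgrad2 g (x1, x2) = grad (\<lambda>y. g (x1, y)) x2"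

definition lipschitz_on_bounded :: "('a::metric_space \<Rightarrow> 'b::metric_space) \<Rightarrow> bool" where
  "lipschitz_on_bounded G \<longleftrightarrow> (\<forall>B. bounded B \<longrightarrow> (\<exists>L>0. L-lipschitz_on B G))"

text \<open>The functions \<open>lf1, \<dots>, lf4, lg1, lg2\<close> are the Lipschitz constants of the partial gradients, as
  functions of the remaining blocks. Properness of \<open>f\<close> and \<open>g\<close> is their being real-valued.\<close>

definition assumption_A ::
  "'n::finite blk4 set \<Rightarrow> ('n vars \<Rightarrow> real) \<Rightarrow> ('n blk4 \<times> 'n blk4 \<Rightarrow> real) \<Rightarrow>
   ('n blk4 \<times> 'n blk3 \<times> 'n blk3 \<Rightarrow> real) \<Rightarrow> ('n blk4 \<times> 'n blk3 \<times> 'n blk3 \<Rightarrow> real) \<Rightarrow>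
   ('n blk4 \<times> 'n blk4 \<times> 'n blk3 \<Rightarrow> real) \<Rightarrow> ('n blk4 \<times> 'n blk4 \<times> 'n blk3 \<Rightarrow> real) \<Rightarrow>
   ('n blk4 \<Rightarrow> real) \<Rightarrow> ('n blk4 \<Rightarrow> real) \<Rightarrow> bool" where
  "assumption_A M f g lf1 lf2 lf3 lf4 lg1 lg2 \<longleftrightarrow>
     lower_semicontinuous f \<and> lower_semicontinuous g \<and>
     bdd_below (f ` (M \<times> UNIV)) \<and> bdd_below (g ` (M \<times> UNIV)) \<and>
     (\<forall>x. f differentiable (at x)) \<and> (\<forall>x. g differentiable (at x)) \<and>
     lipschitz_on_bounded (grad f) \<and> lipschitz_on_bounded (grad g) \<and>
     (\<forall>x2 x3 x4. 0 < lf1 (x2, x3, x4) \<and>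
        (lf1 (x2, x3, x4))-lipschitz_on UNIV (\<lambda>y. pgrad1 f (y, x2, x3, x4))) \<and>
     (\<forall>x1 x3 x4. 0 < lf2 (x1, x3, x4) \<and>
        (lf2 (x1, x3, x4))-lipschitz_on UNIV (\<lambda>y. pgrad2 f (x1, y, x3, x4))) \<and>
     (\<forall>x1 x2 x4. 0 < lf3 (x1, x2, x4) \<and>
        (lf3 (x1, x2, x4))-lipschitz_on UNIV (\<lambda>y. pgrad3 f (x1, x2, y, x4))) \<and>
     (\<forall>x1 x2 x3. 0 < lf4 (x1, x2, x3) \<and>
        (lf4 (x1, x2, x3))-lipschitz_on UNIV (\<lambda>y. pgrad4 f (x1, x2, x3, y))) \<and>
     (\<forall>x2. 0 < lg1 x2 \<and> (lg1 x2)-lipschitz_on UNIV (\<lambda>y. gpgrad1 g (y, x2))) \<and>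
     (\<forall>x1. 0 < lg2 x1 \<and> (lg2 x1)-lipschitz_on UNIV (\<lambda>y. gpgrad2 g (x1, y))) \<and>
     (\<forall>B. bounded B \<longrightarrow> bdd_above (lf1 ` B)) \<and> (\<forall>B. bounded B \<longrightarrow> bdd_above (lf2 ` B)) \<and>
     (\<forall>B. bounded B \<longrightarrow> bdd_above (lf3 ` B)) \<and> (\<forall>B. bounded B \<longrightarrow> bdd_above (lf4 ` B)) \<and>
     (\<forall>B. bounded B \<longrightarrow> bdd_above (lg1 ` B)) \<and> (\<forall>B. bounded B \<longrightarrow> bdd_above (lg2 ` B)) \<and>
     (\<forall>x1 x2 x3 x4 y. f (y, x2, x3, x4) \<ge>
        f (x1, x2, x3, x4) + pgrad1 f (x1, x2, x3, x4) \<bullet> (y - x1)) \<and>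
     (\<forall>x1 x2 x3 x4 y. f (x1, y, x3, x4) \<ge>
        f (x1, x2, x3, x4) + pgrad2 f (x1, x2, x3, x4) \<bullet> (y - x2)) \<and>
     (\<forall>x1 x2 x3 x4 y. f (x1, x2, y, x4) \<ge>
        f (x1, x2, x3, x4) + pgrad3 f (x1, x2, x3, x4) \<bullet> (y - x3)) \<and>
     (\<forall>x1 x2 x3 x4 y. f (x1, x2, x3, y) \<ge>
        f (x1, x2, x3, x4) + pgrad4 f (x1, x2, x3, x4) \<bullet> (y - x4)) \<and>
     (\<forall>x1 x2 y. g (y, x2) \<ge> g (x1, x2) + gpgrad1 g (x1, x2) \<bullet> (y - x1)) \<and>
     (\<forall>x1 x2 y. g (x1, y) \<ge> g (x1, x2) + gpgrad2 g (x1, x2) \<bullet> (y - x2))"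

definition blk_ball :: "real \<Rightarrow> 'n::finite vars set" where
  "blk_ball R = cball 0 R \<times> cball 0 R \<times> cball 0 R \<times> cball 0 R"

text \<open>\<open>Lf\<close> and \<open>Lg\<close> are Lipschitz constants on bounded sets given by \<open>R\<close>, and \<open>Lg2\<close> is an upper
  bound of \<open>lg2\<close> there; no bound of \<open>lf1, \<dots>, lf4, lg1\<close> enters the thresholds for the penalty
  parameter.\<close>

definition ball_constants ::
  "real \<Rightarrow> ('n::finite vars \<Rightarrow> real) \<Rightarrow> ('n blk4 \<times> 'n blk4 \<Rightarrow> real) \<Rightarrow> ('n blk4 \<Rightarrow> real) \<Rightarrow>
   real \<Rightarrow> real \<Rightarrow> real \<Rightarrow> bool" where
  "ball_constants R f g lg2 Lf Lg Lg2 \<longleftrightarrow>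
     0 < Lf \<and> Lf-lipschitz_on (blk_ball R) (grad f) \<and>
     0 < Lg \<and> Lg-lipschitz_on (cball 0 R \<times> cball 0 R) (grad g) \<and>
     (\<forall>x1\<in>cball 0 R. lg2 x1 \<le> Lg2)"

section \<open>The algorithm\<close>

definition pradmm ::
  "'n::finite blk4 set \<Rightarrow> ('n vars \<Rightarrow> real) \<Rightarrow> ('n blk4 \<times> 'n blk4 \<Rightarrow> real) \<Rightarrow> real \<Rightarrow> real \<Rightarrow>
   ('n blk4 \<Rightarrow> 'n blk4) \<Rightarrow> ('n blk4 \<Rightarrow> 'n blk4) \<Rightarrow> ('n blk3 \<Rightarrow> 'n blk3) \<Rightarrow> ('n blk3 \<Rightarrow> 'n blk3) \<Rightarrow>
   (nat \<Rightarrow> 'n vars) \<Rightarrow> (nat \<Rightarrow> 'n mult) \<Rightarrow> bool" where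
  "pradmm M f g \<beta> \<tau> H1 H2 H3 H4 x l \<longleftrightarrow>
     (\<forall>k x1 x2 x3 x4 y1 y2 y3 y4.
        x k = (x1, x2, x3, x4) \<and> x (Suc k) = (y1, y2, y3, y4) \<longrightarrow>
        is_arg_min (\<lambda>y. aug_lagr f g \<beta> (y, x2, x3, x4) (l k) + 1/2 * qform H1 (y - x1))
          (\<lambda>y. y \<in> M) y1 \<and>
        is_arg_min (\<lambda>y. aug_lagr f g \<beta> (y1, y, x3, x4) (l k) + 1/2 * qform H2 (y - x2))
          (\<lambda>y. True) y2 \<and>
        is_arg_min (\<lambda>y. aug_lagr f g \<beta> (y1, y2, y, x4) (l k) + 1/2 * qform H3 (y - x3))
          (\<lambda>y. True) y3 \<and>
        is_arg_min (\<lambda>y. aug_lagr f g \<beta> (y1, y2, y3, y) (l k) + 1/2 * qform H4 (y - x4))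
          (\<lambda>y. True) y4 \<and>
        l (Suc k) = l k - (\<tau> * \<beta>) *\<^sub>R lincon (y1, y2, y3, y4))"

section \<open>Constants, Lyapunov function, limit points and stationarity\<close>

definition alpha1 :: "real \<Rightarrow> real" where
  "alpha1 \<tau> = \<bar>1 - \<tau>\<bar> / (1 - \<bar>1 - \<tau>\<bar>)"

definition alpha2 :: "real \<Rightarrow> real" where
  "alpha2 \<tau> = \<tau> / (1 - \<bar>1 - \<tau>\<bar>)\<^sup>2"

definition beta1 ::
  "real \<Rightarrow> real \<Rightarrow> real \<Rightarrow> real \<Rightarrow>
   ('n::finite blk4 \<Rightarrow> 'n blk4) \<Rightarrow> ('n blk4 \<Rightarrow> 'n blk4) \<Rightarrow> ('n blk3 \<Rightarrow> 'n blk3) \<Rightarrow> ('n blk3 \<Rightarrow> 'n blk3) \<Rightarrow>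
   real" where
  "beta1 \<tau> Lf Lg Lg2 H1 H2 H3 H4 = Max
     {2 * (Lf + Lg2),
      2 * alpha2 \<tau> / kappa_min H1 * (7 * Lf\<^sup>2 + 4 * Lg\<^sup>2),
      alpha2 \<tau> / kappa_min H2 * (7 * Lf\<^sup>2 + 4 * Lg\<^sup>2)
        + (4 * alpha2 \<tau> + 2) * (kappa_max H2)\<^sup>2 / kappa_min H2,
      (3 * alpha2 \<tau> + 2) / kappa_min H3 * Lf\<^sup>2,
      (3 * alpha2 \<tau> + 2) / kappa_min H4 * Lf\<^sup>2
        + (3 * alpha2 \<tau> + 1) * (kappa_max H4)\<^sup>2 / kappa_min H4}"

definition beta2 ::
  "real \<Rightarrow> real \<Rightarrow> real \<Rightarrow>
   ('n::finite blk4 \<Rightarrow> 'n blk4) \<Rightarrow> ('n blk4 \<Rightarrow> 'n blk4) \<Rightarrow> ('n blk3 \<Rightarrow> 'n blk3) \<Rightarrow> ('n blk3 \<Rightarrow> 'n blk3) \<Rightarrow>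
   real" where
  "beta2 \<tau> Lf Lg H1 H2 H3 H4 = Max
     {2 * alpha2 \<tau> / kappa_min H1 * (7 * Lf\<^sup>2 + 4 * Lg\<^sup>2),
      alpha2 \<tau> / kappa_min H2 * (7 * Lf\<^sup>2 + 4 * Lg\<^sup>2 + 8 * (kappa_max H2)\<^sup>2),
      7 * alpha2 \<tau> * Lf\<^sup>2 / kappa_min H3,
      alpha2 \<tau> / kappa_min H4 * (7 * Lf\<^sup>2 + 6 * (kappa_max H4)\<^sup>2)}"

definition M1 :: "real \<Rightarrow> real \<Rightarrow> real \<Rightarrow> real \<Rightarrow> ('a::euclidean_space \<Rightarrow> 'a) \<Rightarrow> 'a \<Rightarrow> 'a" where
  "M1 \<beta> \<tau> Lf Lg H v =
     (1/2) *\<^sub>R H v - (alpha2 \<tau> / \<beta> * (7 * Lf\<^sup>2 + 4 * Lg\<^sup>2)) *\<^sub>R v"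

definition M2 :: "real \<Rightarrow> real \<Rightarrow> real \<Rightarrow> real \<Rightarrow> ('a::euclidean_space \<Rightarrow> 'a) \<Rightarrow> 'a \<Rightarrow> 'a" where
  "M2 \<beta> \<tau> Lf Lg H v =
     H v - (alpha2 \<tau> / \<beta>) *\<^sub>R ((7 * Lf\<^sup>2) *\<^sub>R v + (4 * Lg\<^sup>2) *\<^sub>R v + 4 *\<^sub>R adjoint H (H v))"

definition M3 :: "real \<Rightarrow> real \<Rightarrow> real \<Rightarrow> ('a::euclidean_space \<Rightarrow> 'a) \<Rightarrow> 'a \<Rightarrow> 'a" where
  "M3 \<beta> \<tau> Lf H v = H v - (3 * alpha2 \<tau> / \<beta> * Lf\<^sup>2) *\<^sub>R v"

definition M4 :: "real \<Rightarrow> real \<Rightarrow> real \<Rightarrow> ('a::euclidean_space \<Rightarrow> 'a) \<Rightarrow> 'a \<Rightarrow> 'a" where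
  "M4 \<beta> \<tau> Lf H v = H v - (alpha2 \<tau> / \<beta>) *\<^sub>R ((3 * Lf\<^sup>2) *\<^sub>R v + 3 *\<^sub>R adjoint H (H v))"

type_synonym 'n lyap_pt = "'n vars \<times> 'n vars \<times> 'n mult \<times> 'n mult"

fun lyap ::
  "('n::finite vars \<Rightarrow> real) \<Rightarrow> ('n blk4 \<times> 'n blk4 \<Rightarrow> real) \<Rightarrow> real \<Rightarrow> real \<Rightarrow> real \<Rightarrow> real \<Rightarrow>
   ('n blk4 \<Rightarrow> 'n blk4) \<Rightarrow> ('n blk4 \<Rightarrow> 'n blk4) \<Rightarrow> ('n blk3 \<Rightarrow> 'n blk3) \<Rightarrow> ('n blk3 \<Rightarrow> 'n blk3) \<Rightarrow>
   'n lyap_pt \<Rightarrow> real" where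
  "lyap f g \<beta> \<tau> Lf Lg H1 H2 H3 H4 ((x1, x2, x3, x4), (y1, y2, y3, y4), l, m) =
     aug_lagr f g \<beta> (x1, x2, x3, x4) l + alpha1 \<tau> / (\<tau> * \<beta>) * (norm (l - m))\<^sup>2
     + qform (M1 \<beta> \<tau> Lf Lg H1) (x1 - y1) + qform (M2 \<beta> \<tau> Lf Lg H2) (x2 - y2)
     + qform (M3 \<beta> \<tau> Lf H3) (x3 - y3) + qform (M4 \<beta> \<tau> Lf H4) (x4 - y4)"

definition lyap_space :: "'n::finite blk4 set \<Rightarrow> 'n lyap_pt set" where
  "lyap_space M = (M \<times> UNIV) \<times> (M \<times> UNIV) \<times> UNIV"

definition limit_points :: "(nat \<Rightarrow> 'a::topological_space) \<Rightarrow> 'a set" where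
  "limit_points z = {u. \<exists>r::nat \<Rightarrow> nat. strict_mono r \<and> (z \<circ> r) \<longlonglongrightarrow> u}"

text \<open>The index is shifted by one: the terms are $z^{k+1}$ for $k \ge 0$.\<close>

definition Omega_star :: "(nat \<Rightarrow> 'n::finite vars) \<Rightarrow> (nat \<Rightarrow> 'n mult) \<Rightarrow> 'n lyap_pt set" where
  "Omega_star x l = limit_points (\<lambda>k. (x (Suc k), x k, l (Suc k), l k))"

fun stationary_point ::
  "'n::finite blk4 set \<Rightarrow> ('n vars \<Rightarrow> real) \<Rightarrow> ('n blk4 \<times> 'n blk4 \<Rightarrow> real) \<Rightarrow> 'n vars \<Rightarrow> 'n mult \<Rightarrow> bool"
  where
  "stationary_point M f g (x1, x2, x3, x4) l \<longleftrightarrow>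
     x1 \<in> M \<and> lincon (x1, x2, x3, x4) = 0 \<and>
     orth_proj (tangent_space M x1)
       (pgrad1 f (x1, x2, x3, x4) + gpgrad1 g (x1, x2) - adjoint A1 l) = 0 \<and>
     pgrad2 f (x1, x2, x3, x4) + gpgrad2 g (x1, x2) - adjoint A2 l = 0 \<and>
     pgrad3 f (x1, x2, x3, x4) - adjoint A3 l = 0 \<and>
     pgrad4 f (x1, x2, x3, x4) - adjoint A4 l = 0"

end

theory Submission
  imports Defs
begin

text \<open>Along the iteration the Lyapunov function drops by at least a multiple of
  $\|x^{k+1} - x^k\|^2$: block 1 descends by minimality, the other blocks by convexity and the
  optimality condition, and the ascent in the multiplier is controlled because, by the optimality
  conditions of blocks 2 and 4, the multiplier is a relaxation of a Lipschitz function of the iterates.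
  The optimality condition of block 1 says that a certain vector is normal to the manifold; subtracting
  it from the gradient shows that the Riemannian gradient of the Lyapunov function is bounded by the
  increments $a_k$ of $x$ and $b_k$ of the multiplier. Since $b$ does not enter the descent, the usual
  Kurdyka--Lojasiewicz argument is closed by the linear recursion
  $b_{k+1} \le |1 - \tau| b_k + C (a_{k+1} + a_k)$. In the limit, normality survives because tangent vectors
  extend continuously.\<close>

section \<open>Maps of class $C^k$\<close>

text \<open>Since \<open>M\<close> is not convex, block 1 gains only half of its proximal form by
  minimality, whereas convexity gives blocks 2 to 4 the full form; hence the factor 1/2 in
  \<open>M1\<close> alone. The obstacle is that the multiplier step raises the augmented Lagrangian
  by an amount that depends on the increments of two consecutive sweeps. The quadratic terms of
  \<Psi> act as a store: each operator is the gain of its block minus exactly the share of the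
  ascent caused by the newer sweep, and what was stored in the older sweep has to pay for the rest.
  The entries of \<open>beta2\<close> say that it can. For \<tau> \<noteq> 1 the multiplier moreover
  remembers its past with factor |1 - \<tau>|; \<open>alpha1\<close> is the weight for which this
  memory telescopes, at the price \<open>alpha2\<close>. It telescopes with nothing left over, which
  is why no multiplier increment appears in the descent estimate.\<close>

lemma has_derivative_frechet:
  "f differentiable (at x) \<Longrightarrow> (f has_derivative frechet_derivative f (at x)) (at x)"
  by (simp add: frechet_derivative_works)

text \<open>A derivative at a point sees only a neighbourhood, so on an open set agreement passes to
  all derivatives. The closure lemmas below use this to exchange \<open>frechet_derivative\<close>
  of a compound map for its explicit formula, to which the induction hypothesis applies.\<close>

lemma Ck_on_cong:
  assumes "open S" "\<And>x. x \<in> S \<Longrightarrow> f x = g x" "Ck_on k S f"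
  shows "Ck_on k S g"
  using assms(2,3)
proof (induction k arbitrary: f g)
  case 0
  then show ?case by (metis Ck_on.simps(1) continuous_on_cong)
next
  case (Suc k)
  have der: "(g has_derivative frechet_derivative f (at x)) (at x)" if "x \<in> S" for x
    using Suc.prems that has_derivative_frechet
    by (metis Ck_on.simps(2) assms(1) has_derivative_transform_within_open)
  have "frechet_derivative f (at x) = frechet_derivative g (at x)" if "x \<in> S" for x
    using der[OF that] frechet_derivative_at by blast
  then have "Ck_on k S (\<lambda>x. frechet_derivative g (at x) v)" for v
    using Suc.IH[of "\<lambda>x. frechet_derivative f (at x) v"] Suc.prems(2) by simp
  then show ?case
    using der by (auto simp: differentiable_def)
qed

lemma Ck_on_subset: "Ck_on k S f \<Longrightarrow> T \<subseteq> S \<Longrightarrow> Ck_on k T f"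
  by (induction k arbitrary: f) (auto intro: continuous_on_subset)

lemma Ck_on_bounded_linear:
  assumes "bounded_linear L" "open S" "Ck_on k S f"
  shows "Ck_on k S (\<lambda>x. L (f x))"
  using assms(3)
proof (induction k arbitrary: f)
  case 0
  then show ?case
    using assms(1) by (simp add: bounded_linear.continuous_on)
next
  case (Suc k)
  have der: "((\<lambda>x. L (f x)) has_derivative (\<lambda>v. L (frechet_derivative f (at x) v))) (at x)"
    if "x \<in> S" for x
    using Suc.prems that by (auto intro: bounded_linear.has_derivative[OF assms(1)] has_derivative_frechet)
  have "Ck_on k S (\<lambda>x. frechet_derivative (\<lambda>x. L (f x)) (at x) v)" for v
  proof (rule Ck_on_cong[OF assms(2)])
    show "Ck_on k S (\<lambda>x. L (frechet_derivative f (at x) v))"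
      using Suc by auto
  next
    fix x assume "x \<in> S"
    show "L (frechet_derivative f (at x) v) = frechet_derivative (\<lambda>x. L (f x)) (at x) v"
      using frechet_derivative_at[OF der[OF \<open>x \<in> S\<close>]] by metis
  qed
  then show ?case
    using der by (auto simp: differentiable_def)
qed

lemma Ck_on_Pair:
  assumes "open S" "Ck_on k S f" "Ck_on k S g"
  shows "Ck_on k S (\<lambda>x. (f x, g x))"
  using assms(2,3)
proof (induction k arbitrary: f g)
  case 0
  then show ?case by (simp add: continuous_on_Pair)
next
  case (Suc k)
  have der: "((\<lambda>x. (f x, g x)) has_derivative
      (\<lambda>v. (frechet_derivative f (at x) v, frechet_derivative g (at x) v))) (at x)"
    if "x \<in> S" for x
    by (rule has_derivative_Pair; rule has_derivative_frechet; use Suc.prems that in simp)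
  have "Ck_on k S (\<lambda>x. frechet_derivative (\<lambda>x. (f x, g x)) (at x) v)" for v
  proof (rule Ck_on_cong[OF assms(1)])
    show "Ck_on k S (\<lambda>x. (frechet_derivative f (at x) v, frechet_derivative g (at x) v))"
      using Suc by auto
  next
    fix x assume "x \<in> S"
    show "(frechet_derivative f (at x) v, frechet_derivative g (at x) v) =
        frechet_derivative (\<lambda>x. (f x, g x)) (at x) v"
      using frechet_derivative_at[OF der[OF \<open>x \<in> S\<close>]] by metis
  qed
  then show ?case
    using der by (auto simp: differentiable_def)
qed

lemma Ck_on_const: "Ck_on k S (\<lambda>x. c)"
  by (induction k arbitrary: c) auto

lemma has_derivative_affine:
  "((\<lambda>t::real. a + t *\<^sub>R b) has_derivative (\<lambda>h. h *\<^sub>R b)) (at t)"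
  by (auto intro!: derivative_eq_intros)

lemma Ck_on_affine: "Ck_on k S (\<lambda>t::real. a + t *\<^sub>R b)"
proof (cases k)
  case 0
  then show ?thesis by (auto intro!: continuous_intros)
next
  case (Suc j)
  have "frechet_derivative (\<lambda>t::real. a + t *\<^sub>R b) (at t) = (\<lambda>h. h *\<^sub>R b)" for t
    using frechet_derivative_at[OF has_derivative_affine] by metis
  moreover have "(\<lambda>t::real. a + t *\<^sub>R b) differentiable at t" for t
    using has_derivative_affine unfolding differentiable_def by blast
  ultimately show ?thesis
    by (simp add: Suc Ck_on_const)
qed

text \<open>With an affine inner map the derivative has the same shape again, a directional
  derivative of \<open>f\<close> composed with the same affine map, so the induction closes without
  products. No general chain rule of higher order is required, since curves in a manifold are built
  from straight lines in a chart.\<close>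

lemma Ck_on_compose_affine:
  assumes "open S" "(\<lambda>t::real. a + t *\<^sub>R b) ` S \<subseteq> T" "Ck_on k T f"
  shows "Ck_on k S (\<lambda>t. f (a + t *\<^sub>R b))"
  using assms(3)
proof (induction k arbitrary: f)
  case 0
  then show ?case
    using assms(2)
    by (auto intro!: continuous_on_compose2[of T f] continuous_intros)
next
  case (Suc k)
  have der: "((\<lambda>t. f (a + t *\<^sub>R b)) has_derivative
      (\<lambda>h. frechet_derivative f (at (a + t *\<^sub>R b)) (h *\<^sub>R b))) (at t)" if "t \<in> S" for t
    by (rule has_derivative_compose[OF has_derivative_affine])
       (use Suc.prems that assms(2) in \<open>auto intro: has_derivative_frechet\<close>)
  have "Ck_on k S (\<lambda>t. frechet_derivative (\<lambda>t. f (a + t *\<^sub>R b)) (at t) h)" for h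
  proof (rule Ck_on_cong[OF assms(1)])
    show "Ck_on k S (\<lambda>t. frechet_derivative f (at (a + t *\<^sub>R b)) (h *\<^sub>R b))"
      using Suc.IH[of "\<lambda>x. frechet_derivative f (at x) (h *\<^sub>R b)"] Suc.prems by simp
  next
    fix t assume "t \<in> S"
    show "frechet_derivative f (at (a + t *\<^sub>R b)) (h *\<^sub>R b) =
        frechet_derivative (\<lambda>t. f (a + t *\<^sub>R b)) (at t) h"
      using frechet_derivative_at[OF der[OF \<open>t \<in> S\<close>]] by metis
  qed
  then show ?case
    using der by (auto simp: differentiable_def)
qed

lemma smooth_on_differentiable: "smooth_on S f \<Longrightarrow> x \<in> S \<Longrightarrow> f differentiable (at x)"
  unfolding smooth_on_def by (metis Ck_on.simps(2))

lemma smooth_on_continuous_derivative: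
  "smooth_on S f \<Longrightarrow> continuous_on S (\<lambda>x. frechet_derivative f (at x) v)"
  unfolding smooth_on_def by (metis Ck_on.simps)

section \<open>Tangent spaces of embedded submanifolds\<close>

lemma tangent_spaceI:
  assumes "0 < e" "smooth_on {-e<..<e} \<gamma>" "\<gamma> ` {-e<..<e} \<subseteq> N" "\<gamma> 0 = p"
    "(\<gamma> has_vector_derivative v) (at (0::real))"
  shows "v \<in> tangent_space N p"
  using assms unfolding tangent_space_def by blast

lemma tangent_spaceE:
  assumes "v \<in> tangent_space N p"
  obtains \<gamma> e where "0 < (e::real)" "smooth_on {-e<..<e} \<gamma>" "\<gamma> ` {-e<..<e} \<subseteq> N" "\<gamma> 0 = p"
    "(\<gamma> has_vector_derivative v) (at 0)"
  using assms unfolding tangent_space_def by blast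

lemma tangent_space_UNIV: "tangent_space UNIV p = UNIV"
proof -
  have "v \<in> tangent_space UNIV p" for v
    by (rule tangent_spaceI[of 1 "\<lambda>t. p + t *\<^sub>R v"])
       (auto simp: smooth_on_def Ck_on_affine has_vector_derivative_def intro: has_derivative_affine)
  then show ?thesis by blast
qed

text \<open>Projecting a curve gives one inclusion; for the other, two curves are paired on the
  smaller of their parameter intervals. This reduces the tangent spaces of
  \<open>lyap_space M\<close> to those of \<open>M\<close>.\<close>

lemma tangent_space_Times:
  "tangent_space (A \<times> B) (a, b) = tangent_space A a \<times> tangent_space B b"
proof (intro set_eqI iffI)
  fix w assume "w \<in> tangent_space (A \<times> B) (a, b)"
  then obtain \<gamma> e where e: "0 < (e::real)" and \<gamma>: "smooth_on {-e<..<e} \<gamma>"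
    "\<gamma> ` {-e<..<e} \<subseteq> A \<times> B" "\<gamma> 0 = (a, b)" "(\<gamma> has_vector_derivative w) (at 0)"
    by (rule tangent_spaceE)
  have "fst w \<in> tangent_space A a"
  proof (rule tangent_spaceI[OF e])
    show "smooth_on {-e<..<e} (\<lambda>t. fst (\<gamma> t))"
      using \<gamma>(1) Ck_on_bounded_linear[OF bounded_linear_fst, of "{-e<..<e}" _ \<gamma>]
      by (simp add: smooth_on_def)
    show "((\<lambda>t. fst (\<gamma> t)) has_vector_derivative fst w) (at 0)"
      using bounded_linear.has_vector_derivative[OF bounded_linear_fst \<gamma>(4)] .
    show "(\<lambda>t. fst (\<gamma> t)) ` {-e<..<e} \<subseteq> A"
      using \<gamma>(2) unfolding image_subset_iff by (simp add: mem_Times_iff)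
  qed (simp add: \<gamma>(3))
  moreover have "snd w \<in> tangent_space B b"
  proof (rule tangent_spaceI[OF e])
    show "smooth_on {-e<..<e} (\<lambda>t. snd (\<gamma> t))"
      using \<gamma>(1) Ck_on_bounded_linear[OF bounded_linear_snd, of "{-e<..<e}" _ \<gamma>]
      by (simp add: smooth_on_def)
    show "((\<lambda>t. snd (\<gamma> t)) has_vector_derivative snd w) (at 0)"
      using bounded_linear.has_vector_derivative[OF bounded_linear_snd \<gamma>(4)] .
    show "(\<lambda>t. snd (\<gamma> t)) ` {-e<..<e} \<subseteq> B"
      using \<gamma>(2) unfolding image_subset_iff by (simp add: mem_Times_iff)
  qed (simp add: \<gamma>(3))
  ultimately show "w \<in> tangent_space A a \<times> tangent_space B b"
    by (simp add: mem_Times_iff)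
next
  fix w assume "w \<in> tangent_space A a \<times> tangent_space B b"
  then obtain v u where w: "w = (v, u)" "v \<in> tangent_space A a" "u \<in> tangent_space B b"
    by auto
  obtain \<gamma> e where e: "0 < (e::real)" and \<gamma>: "smooth_on {-e<..<e} \<gamma>"
    "\<gamma> ` {-e<..<e} \<subseteq> A" "\<gamma> 0 = a" "(\<gamma> has_vector_derivative v) (at 0)"
    using w(2) by (rule tangent_spaceE)
  obtain \<delta> d where d: "0 < (d::real)" and \<delta>: "smooth_on {-d<..<d} \<delta>"
    "\<delta> ` {-d<..<d} \<subseteq> B" "\<delta> 0 = b" "(\<delta> has_vector_derivative u) (at 0)"
    using w(3) by (rule tangent_spaceE)
  let ?m = "min e d"
  show "w \<in> tangent_space (A \<times> B) (a, b)"
    unfolding w(1)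
  proof (rule tangent_spaceI[of ?m "\<lambda>t. (\<gamma> t, \<delta> t)"])
    show "smooth_on {-?m<..<?m} (\<lambda>t. (\<gamma> t, \<delta> t))"
      unfolding smooth_on_def
    proof
      fix k
      have "Ck_on k {-?m<..<?m} \<gamma>"
        by (rule Ck_on_subset[of k "{-e<..<e}"]) (use \<gamma>(1) in \<open>auto simp: smooth_on_def\<close>)
      moreover have "Ck_on k {-?m<..<?m} \<delta>"
        by (rule Ck_on_subset[of k "{-d<..<d}"]) (use \<delta>(1) in \<open>auto simp: smooth_on_def\<close>)
      ultimately show "Ck_on k {-?m<..<?m} (\<lambda>t. (\<gamma> t, \<delta> t))"
        by (rule Ck_on_Pair[rotated]) simp
    qed
    show "(\<lambda>t. (\<gamma> t, \<delta> t)) ` {-?m<..<?m} \<subseteq> A \<times> B"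
    proof clarify
      fix t assume "t \<in> {-?m<..<?m}"
      then have "t \<in> {-e<..<e}" "t \<in> {-d<..<d}" by auto
      then show "\<gamma> t \<in> A \<and> \<delta> t \<in> B" using \<gamma>(2) \<delta>(2) by blast
    qed
    show "((\<lambda>t. (\<gamma> t, \<delta> t)) has_vector_derivative (v, u)) (at 0)"
      by (rule has_vector_derivative_Pair[OF \<gamma>(4) \<delta>(4)])
  qed (simp_all add: e d \<gamma>(3) \<delta>(3))
qed

lemma slice_chart_derivative:
  assumes "slice_chart N S U \<phi> \<psi>" "u \<in> U"
  shows "(\<phi> has_derivative frechet_derivative \<phi> (at u)) (at u)"
    and "(\<psi> has_derivative frechet_derivative \<psi> (at (\<phi> u))) (at (\<phi> u))"
    and "frechet_derivative \<psi> (at (\<phi> u)) (frechet_derivative \<phi> (at u) v) = v"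
proof -
  have U: "open U" "\<And>x. x \<in> U \<Longrightarrow> \<psi> (\<phi> x) = x"
    and sm: "smooth_on U \<phi>" "smooth_on (\<phi> ` U) \<psi>"
    using assms(1) unfolding slice_chart_def by auto
  show \<phi>: "(\<phi> has_derivative frechet_derivative \<phi> (at u)) (at u)"
    using sm assms(2) by (auto intro: has_derivative_frechet smooth_on_differentiable)
  show \<psi>: "(\<psi> has_derivative frechet_derivative \<psi> (at (\<phi> u))) (at (\<phi> u))"
    using sm assms(2) by (auto intro: has_derivative_frechet smooth_on_differentiable)
  have "((\<lambda>x. \<psi> (\<phi> x)) has_derivative
      (\<lambda>v. frechet_derivative \<psi> (at (\<phi> u)) (frechet_derivative \<phi> (at u) v))) (at u)"
    by (rule has_derivative_compose[OF \<phi> \<psi>])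
  moreover have "((\<lambda>x. \<psi> (\<phi> x)) has_derivative (\<lambda>v. v)) (at u)"
    by (rule has_derivative_transform_within_open[OF has_derivative_ident U(1) assms(2)])
       (simp add: U(2))
  ultimately have "(\<lambda>v. frechet_derivative \<psi> (at (\<phi> u)) (frechet_derivative \<phi> (at u) v)) = (\<lambda>v. v)"
    by (rule has_derivative_unique)
  then show "frechet_derivative \<psi> (at (\<phi> u)) (frechet_derivative \<phi> (at u) v) = v"
    by metis
qed

text \<open>The definition by curves hides that tangent vectors form a linear space; the description
  in a chart shows it. For a curve in \<open>N\<close>, the difference quotients of its chart image
  lie in \<open>S\<close>, and a subspace is closed; conversely \<open>\<psi>\<close> carries a
  straight line in \<open>S\<close> to a smooth curve in \<open>N\<close>.\<close>

lemma tangent_space_slice_chart: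
  assumes ch: "slice_chart N S U \<phi> \<psi>" and u: "u \<in> U" "u \<in> N"
  shows "tangent_space N u = frechet_derivative \<psi> (at (\<phi> u)) ` S"
proof -
  have S: "subspace S" and U: "open U" "open (\<phi> ` U)" "\<And>x. x \<in> U \<Longrightarrow> \<psi> (\<phi> x) = x"
    and sm: "smooth_on U \<phi>" "smooth_on (\<phi> ` U) \<psi>" and im: "\<phi> ` (U \<inter> N) = \<phi> ` U \<inter> S"
    using ch unfolding slice_chart_def by auto
  note D = slice_chart_derivative[OF ch u(1)]
  have \<phi>u: "\<phi> u \<in> S" using im u by blast
  show ?thesis
  proof (intro set_eqI iffI)
    fix v assume "v \<in> tangent_space N u"
    then obtain \<gamma> e where e: "0 < (e::real)" and \<gamma>: "smooth_on {-e<..<e} \<gamma>"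
      "\<gamma> ` {-e<..<e} \<subseteq> N" "\<gamma> 0 = u" "(\<gamma> has_vector_derivative v) (at 0)"
      by (rule tangent_spaceE)
    have "((\<lambda>t. \<phi> (\<gamma> t)) has_derivative (\<lambda>h. frechet_derivative \<phi> (at u) (h *\<^sub>R v))) (at 0)"
      by (rule has_derivative_compose) (use \<gamma> D(1) in \<open>auto simp: has_vector_derivative_def\<close>)
    moreover have "linear (frechet_derivative \<phi> (at u))"
      using D(1) has_derivative_linear by blast
    ultimately have "((\<lambda>t. \<phi> (\<gamma> t)) has_vector_derivative frechet_derivative \<phi> (at u) v) (at 0)"
      by (simp add: has_vector_derivative_def linear_cmul)
    \<comment> \<open>The remainder in the definition of the derivative is rewritten as the distance
      of the difference quotient from its limit, because it is the quotient that visibly lies in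
      \<open>S\<close>.\<close>
    then have "((\<lambda>t. norm (\<phi> (\<gamma> t) - \<phi> (\<gamma> 0) - t *\<^sub>R frechet_derivative \<phi> (at u) v) / \<bar>t\<bar>) \<longlongrightarrow> 0) (at 0)"
      by (simp add: has_vector_derivative_def has_derivative_iff_norm)
    moreover have "norm (\<phi> (\<gamma> t) - \<phi> (\<gamma> 0) - t *\<^sub>R frechet_derivative \<phi> (at u) v) / \<bar>t\<bar> =
        norm ((\<phi> (\<gamma> t) - \<phi> (\<gamma> 0)) /\<^sub>R t - frechet_derivative \<phi> (at u) v)" if "t \<noteq> 0" for t
    proof -
      have "(\<phi> (\<gamma> t) - \<phi> (\<gamma> 0)) /\<^sub>R t - frechet_derivative \<phi> (at u) v =
          (\<phi> (\<gamma> t) - \<phi> (\<gamma> 0) - t *\<^sub>R frechet_derivative \<phi> (at u) v) /\<^sub>R t"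
        using that by (simp add: scaleR_diff_right)
      then show ?thesis by (simp add: divide_inverse_commute)
    qed
    ultimately have "((\<lambda>t. norm ((\<phi> (\<gamma> t) - \<phi> (\<gamma> 0)) /\<^sub>R t - frechet_derivative \<phi> (at u) v)) \<longlongrightarrow> 0) (at 0)"
      by (subst (asm) Lim_cong_within[OF refl refl refl]) auto
    then have lim: "((\<lambda>t. (\<phi> (\<gamma> t) - \<phi> (\<gamma> 0)) /\<^sub>R t) \<longlongrightarrow> frechet_derivative \<phi> (at u) v) (at 0)"
      by (simp add: tendsto_norm_zero_iff LIM_zero_iff)
    have "continuous (at 0) \<gamma>"
      using \<gamma>(4) has_vector_derivative_continuous by blast
    then have "\<forall>\<^sub>F t in at 0. \<gamma> t \<in> U"
      using U(1) u(1) \<gamma>(3) by (simp add: continuous_at topological_tendstoD)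
    moreover have "\<forall>\<^sub>F t in at (0::real). t \<in> {-e<..<e}"
      using e by (intro eventually_at_in_open') auto
    ultimately have "\<forall>\<^sub>F t in at 0. (\<phi> (\<gamma> t) - \<phi> (\<gamma> 0)) /\<^sub>R t \<in> S"
    proof eventually_elim
      case (elim t)
      then have "\<phi> (\<gamma> t) \<in> S" using im \<gamma>(2) by blast
      then show ?case using \<phi>u \<gamma>(3) S by (auto intro: subspace_mul subspace_diff)
    qed
    then have "frechet_derivative \<phi> (at u) v \<in> S"
      by (rule Lim_in_closed_set[OF closed_subspace[OF S] _ _ lim]) simp
    then show "v \<in> frechet_derivative \<psi> (at (\<phi> u)) ` S"
      using D(3)[of v] by (metis image_eqI)
  next
    fix v assume "v \<in> frechet_derivative \<psi> (at (\<phi> u)) ` S"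
    then obtain s where s: "s \<in> S" "v = frechet_derivative \<psi> (at (\<phi> u)) s" by blast
    \<comment> \<open>The filter is \<open>nhds 0\<close> rather than \<open>at 0\<close>, so that
      the interval obtained contains the parameter 0 itself.\<close>
    have "((\<lambda>t::real. \<phi> u + t *\<^sub>R s) \<longlongrightarrow> \<phi> u + 0 *\<^sub>R s) (nhds 0)"
      by (intro tendsto_intros) (simp add: filterlim_ident)
    then have "\<forall>\<^sub>F t in nhds (0::real). \<phi> u + t *\<^sub>R s \<in> \<phi> ` U"
      using U(2) u(1) by (intro topological_tendstoD) auto
    then obtain e where e: "0 < e" "\<And>t::real. dist t 0 < e \<Longrightarrow> \<phi> u + t *\<^sub>R s \<in> \<phi> ` U"
      unfolding eventually_nhds_metric by blast
    show "v \<in> tangent_space N u"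
    proof (rule tangent_spaceI[OF e(1)])
      show "smooth_on {-e<..<e} (\<lambda>t. \<psi> (\<phi> u + t *\<^sub>R s))"
        using sm(2) e(2) unfolding smooth_on_def
        by (auto intro!: Ck_on_compose_affine[where T = "\<phi> ` U"])
      show "(\<lambda>t. \<psi> (\<phi> u + t *\<^sub>R s)) ` {-e<..<e} \<subseteq> N"
      proof clarify
        fix t assume "t \<in> {-e<..<e}"
        then have "\<phi> u + t *\<^sub>R s \<in> \<phi> ` U" by (intro e(2)) auto
        moreover have "\<phi> u + t *\<^sub>R s \<in> S"
          using S \<phi>u s by (auto intro: subspace_add subspace_mul)
        ultimately have "\<phi> u + t *\<^sub>R s \<in> \<phi> ` (U \<inter> N)" using im by blast
        then show "\<psi> (\<phi> u + t *\<^sub>R s) \<in> N" using U(3) by auto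
      qed
      have "((\<lambda>t. \<psi> (\<phi> u + t *\<^sub>R s)) has_derivative
          (\<lambda>h. frechet_derivative \<psi> (at (\<phi> u)) (h *\<^sub>R s))) (at 0)"
        by (rule has_derivative_compose[OF has_derivative_affine]) (use D(2) in simp)
      moreover have "linear (frechet_derivative \<psi> (at (\<phi> u)))"
        using D(2) has_derivative_linear by blast
      ultimately show "((\<lambda>t. \<psi> (\<phi> u + t *\<^sub>R s)) has_vector_derivative v) (at 0)"
        by (simp add: has_vector_derivative_def linear_cmul s(2))
    qed (use U(3) u in auto)
  qed
qed

lemma subspace_tangent_space:
  assumes "embedded_submanifold N" "u \<in> N"
  shows "subspace (tangent_space N u)"
proof -
  obtain S U \<phi> \<psi> where ch: "slice_chart N S U \<phi> \<psi>" and u: "u \<in> U"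
    using assms unfolding embedded_submanifold_def by blast
  have "linear (frechet_derivative \<psi> (at (\<phi> u)))"
    using slice_chart_derivative(2)[OF ch u] has_derivative_linear by blast
  moreover have "subspace S" using ch by (simp add: slice_chart_def)
  ultimately show ?thesis
    using tangent_space_slice_chart[OF ch u assms(2)] by (simp add: linear_subspace_image)
qed

text \<open>The normal bundle is closed: a tangent vector at the limit extends to a continuous field of
  tangent vectors, namely the image of a fixed vector of the model space under the derivative of
  the inverse chart.\<close>

lemma normal_limit:
  assumes "embedded_submanifold N" "u \<in> N" "\<And>k::nat. y k \<in> N" "y \<longlonglongrightarrow> u" "w \<longlonglongrightarrow> n"
    and nrm: "\<And>k v. v \<in> tangent_space N (y k) \<Longrightarrow> w k \<bullet> v = 0"
    and v: "v \<in> tangent_space N u"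
  shows "n \<bullet> v = 0"
proof -
  obtain S U \<phi> \<psi> where ch: "slice_chart N S U \<phi> \<psi>" and u: "u \<in> U"
    using assms unfolding embedded_submanifold_def by blast
  have U: "open U" "open (\<phi> ` U)" and sm: "smooth_on (\<phi> ` U) \<psi>"
    using ch unfolding slice_chart_def by auto
  obtain s where s: "s \<in> S" "v = frechet_derivative \<psi> (at (\<phi> u)) s"
    using v tangent_space_slice_chart[OF ch u assms(2)] by blast
  have "isCont (\<lambda>q. frechet_derivative \<psi> (at q) s) (\<phi> u)"
    using smooth_on_continuous_derivative[OF sm] U(2) u
    by (simp add: continuous_on_eq_continuous_at)
  moreover have "isCont \<phi> u"
    using slice_chart_derivative(1)[OF ch u] has_derivative_continuous by blast
  ultimately have "isCont (\<lambda>q. frechet_derivative \<psi> (at (\<phi> q)) s) u"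
    using isCont_o2 by blast
  then have "(\<lambda>k. frechet_derivative \<psi> (at (\<phi> (y k))) s) \<longlonglongrightarrow> v"
    unfolding s(2) using assms(4) by (rule isCont_tendsto_compose)
  then have "(\<lambda>k. w k \<bullet> frechet_derivative \<psi> (at (\<phi> (y k))) s) \<longlonglongrightarrow> n \<bullet> v"
    by (intro tendsto_inner assms(5))
  moreover have "\<forall>\<^sub>F k in sequentially. y k \<in> U"
    using assms(4) U(1) u by (rule topological_tendstoD)
  then have "\<forall>\<^sub>F k in sequentially. w k \<bullet> frechet_derivative \<psi> (at (\<phi> (y k))) s = 0"
  proof eventually_elim
    case (elim k)
    then show ?case
      using tangent_space_slice_chart[OF ch elim assms(3)] s(1) by (intro nrm) blast
  qed
  then have "(\<lambda>k. w k \<bullet> frechet_derivative \<psi> (at (\<phi> (y k))) s) \<longlonglongrightarrow> 0"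
    by (rule tendsto_eventually)
  ultimately show ?thesis
    by (rule LIMSEQ_unique)
qed

text \<open>Zero is an interior minimum of \<open>h\<close> along every curve through
  \<open>p\<close> in \<open>N\<close>, so the derivative along the curve vanishes there. With
  \<open>N = UNIV\<close> this also yields the optimality conditions of the unconstrained
  blocks.\<close>

lemma minimizer_normal:
  assumes "is_arg_min h (\<lambda>y. y \<in> N) p" "(h has_derivative (\<lambda>v. n \<bullet> v)) (at p)"
    "v \<in> tangent_space N p"
  shows "n \<bullet> v = 0"
proof -
  obtain \<gamma> e where e: "0 < (e::real)" and \<gamma>: "smooth_on {-e<..<e} \<gamma>"
    "\<gamma> ` {-e<..<e} \<subseteq> N" "\<gamma> 0 = p" "(\<gamma> has_vector_derivative v) (at 0)"
    using assms(3) by (rule tangent_spaceE)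
  have "((\<lambda>t. h (\<gamma> t)) has_derivative (\<lambda>t. n \<bullet> (t *\<^sub>R v))) (at 0)"
    using \<gamma>(3,4) assms(2)
    by (intro has_derivative_compose[of \<gamma> _ 0 UNIV h]) (simp_all add: has_vector_derivative_def)
  then have "((\<lambda>t. h (\<gamma> t)) has_derivative (\<lambda>t. (n \<bullet> v) * t)) (at 0)"
    by (simp add: mult.commute)
  then have "((\<lambda>t. h (\<gamma> t)) has_field_derivative n \<bullet> v) (at 0)"
    by (simp add: has_field_derivative_def)
  moreover have "h (\<gamma> 0) \<le> h (\<gamma> t)" if "\<bar>0 - t\<bar> < e" for t
  proof -
    have "t \<in> {-e<..<e}" using that by auto
    then have "\<gamma> t \<in> N" using \<gamma>(2) by blast
    then show ?thesis using assms(1) \<gamma>(3) by (auto simp: is_arg_min_linorder)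
  qed
  ultimately show ?thesis using e by (intro DERIV_local_min[of "\<lambda>t. h (\<gamma> t)" _ 0 e]) auto
qed

lemma orthogonal_projection:
  fixes T :: "'a::euclidean_space set"
  assumes "subspace T"
  obtains p where "p \<in> T" "\<And>v. v \<in> T \<Longrightarrow> (w - p) \<bullet> v = 0" "norm p \<le> norm w"
proof -
  obtain p q where pq: "p \<in> span T" "\<And>v. v \<in> span T \<Longrightarrow> orthogonal q v" "w = p + q"
    by (rule orthogonal_subspace_decomp_exists[of T w]) blast
  have sp: "span T = T" using assms by (simp add: span_eq_iff)
  have "q \<bullet> p = 0" using pq by (simp add: orthogonal_def)
  then have "w \<bullet> w = p \<bullet> p + q \<bullet> q"
    by (simp add: pq(3) inner_simps inner_commute)
  then have "norm p \<le> norm w" by (simp add: norm_le)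
  then show ?thesis using that[of p] pq sp by (simp add: orthogonal_def)
qed

lemma orth_proj_eq_0:
  assumes "subspace T" "\<And>v. v \<in> T \<Longrightarrow> w \<bullet> v = 0"
  shows "orth_proj T w = 0"
  unfolding orth_proj_def
proof (rule the_equality)
  show "0 \<in> T \<and> (\<forall>t\<in>T. (w - 0) \<bullet> t = 0)"
    using assms by (simp add: subspace_0)
  fix y assume y: "y \<in> T \<and> (\<forall>t\<in>T. (w - y) \<bullet> t = 0)"
  then have "(w - y) \<bullet> y = 0" "w \<bullet> y = 0" using assms(2) by auto
  then show "y = 0" by (simp add: inner_diff_left)
qed

section \<open>The Riemannian subdifferential and the Kurdyka--Lojasiewicz property\<close>

text \<open>For the lower bound on the Clarke derivative the difference quotients at \<open>y = u\<close> suffice.\<close>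

lemma riem_subdiff_differentiable:
  assumes der: "(\<sigma> has_derivative (\<lambda>h. G \<bullet> h)) (at u)" and "u \<in> N"
    and \<xi>: "\<xi> \<in> tangent_space N u" "\<And>v. v \<in> tangent_space N u \<Longrightarrow> \<xi> \<bullet> v = G \<bullet> v"
  shows "\<xi> \<in> riem_subdiff N \<sigma> u"
proof -
  have "ereal (\<xi> \<bullet> v) \<le> clarke_dderiv N \<sigma> \<phi> \<psi> u v"
    if ch: "slice_chart N S U \<phi> \<psi>" "u \<in> U" and v: "v \<in> tangent_space N u" for S U \<phi> \<psi> v
  proof -
    let ?w = "frechet_derivative \<phi> (at u) v"
    let ?q = "\<lambda>(y, t::real). ereal ((\<sigma> (\<psi> (\<phi> y + t *\<^sub>R ?w)) - \<sigma> (\<psi> (\<phi> y))) / t)"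
    note D = slice_chart_derivative[OF ch]
    have \<psi>u: "\<psi> (\<phi> u) = u" using ch by (simp add: slice_chart_def)
    have lin: "linear (frechet_derivative \<psi> (at (\<phi> u)))"
      using D(2) has_derivative_linear by blast
    have "((\<lambda>t. \<psi> (\<phi> u + t *\<^sub>R ?w)) has_derivative
        (\<lambda>h. frechet_derivative \<psi> (at (\<phi> u)) (h *\<^sub>R ?w))) (at 0)"
      by (rule has_derivative_compose[OF has_derivative_affine]) (use D(2) in simp)
    then have "((\<lambda>t. \<psi> (\<phi> u + t *\<^sub>R ?w)) has_derivative (\<lambda>h. h *\<^sub>R v)) (at 0)"
      by (simp add: linear_cmul[OF lin] D(3))
    then have "((\<lambda>t. \<sigma> (\<psi> (\<phi> u + t *\<^sub>R ?w))) has_derivative (\<lambda>h. G \<bullet> (h *\<^sub>R v))) (at 0)"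
      by (rule has_derivative_compose) (use der \<psi>u in simp)
    then have "((\<lambda>t. \<sigma> (\<psi> (\<phi> u + t *\<^sub>R ?w))) has_field_derivative G \<bullet> v) (at 0)"
      by (simp add: has_field_derivative_def mult_commute_abs)
    then have "((\<lambda>t. (\<sigma> (\<psi> (\<phi> u + t *\<^sub>R ?w)) - \<sigma> (\<psi> (\<phi> u))) / t) \<longlongrightarrow> G \<bullet> v) (at 0)"
      by (simp add: has_field_derivative_iff)
    then have "((\<lambda>t. (\<sigma> (\<psi> (\<phi> u + t *\<^sub>R ?w)) - \<sigma> (\<psi> (\<phi> u))) / t) \<longlongrightarrow> G \<bullet> v) (at_right 0)"
      by (rule tendsto_mono[rotated]) (simp add: at_le)
    then have lim: "((\<lambda>t. ?q (u, t)) \<longlongrightarrow> ereal (\<xi> \<bullet> v)) (at_right 0)"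
      by (simp add: \<xi>(2)[OF v])
    have "filterlim (\<lambda>t. u) (inf (nhds u) (principal N)) (at_right (0::real))"
      by (simp add: filterlim_inf filterlim_principal assms(2))
    then have "filterlim (\<lambda>t. (u, t)) (inf (nhds u) (principal N) \<times>\<^sub>F at_right 0) (at_right (0::real))"
      by (intro filterlim_Pair filterlim_ident)
    then have le: "filtermap (\<lambda>t. (u, t)) (at_right (0::real)) \<le> inf (nhds u) (principal N) \<times>\<^sub>F at_right 0"
      by (simp add: filterlim_def)
    have "ereal (\<xi> \<bullet> v) = Limsup (at_right 0) (\<lambda>t. ?q (u, t))"
      by (rule lim_imp_Limsup[OF _ lim, symmetric]) simp
    also have "\<dots> \<le> Limsup (filtermap (\<lambda>t. (u, t)) (at_right 0)) ?q"
      by (rule Limsup_filtermap_ge)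
    also have "\<dots> \<le> clarke_dderiv N \<sigma> \<phi> \<psi> u v"
      unfolding clarke_dderiv_def Limsup_def using le
      by (intro INF_superset_mono) (auto simp: le_filter_def)
    finally show ?thesis .
  qed
  then show ?thesis using \<xi>(1) unfolding riem_subdiff_def by blast
qed

text \<open>\<open>E\<close> may be any vector with the same tangential part as the gradient. Its
  orthogonal projection is the Riemannian gradient, which is a subgradient and no longer than
  \<open>E\<close>; so normal components can be removed before norms are estimated.\<close>

lemma riem_subdiff_dist_le:
  fixes N :: "'a::euclidean_space set"
  assumes der: "(\<sigma> has_derivative (\<lambda>h. G \<bullet> h)) (at u)" and "u \<in> N"
    and "subspace (tangent_space N u)"
    and E: "\<And>v. v \<in> tangent_space N u \<Longrightarrow> E \<bullet> v = G \<bullet> v"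
  shows "(INF \<xi>\<in>riem_subdiff N \<sigma> u. ereal (norm \<xi>)) \<le> ereal (norm E)"
proof -
  obtain p where p: "p \<in> tangent_space N u" "\<And>v. v \<in> tangent_space N u \<Longrightarrow> (E - p) \<bullet> v = 0"
    "norm p \<le> norm E"
    using orthogonal_projection[OF assms(3), of E] by blast
  have "p \<in> riem_subdiff N \<sigma> u"
    by (rule riem_subdiff_differentiable[OF der assms(2) p(1)])
       (use p(2) E in \<open>simp add: inner_diff_left\<close>)
  then have "(INF \<xi>\<in>riem_subdiff N \<sigma> u. ereal (norm \<xi>)) \<le> ereal (norm p)"
    by (rule INF_lower)
  also have "\<dots> \<le> ereal (norm E)" using p(3) by simp
  finally show ?thesis .
qed

section \<open>Summability from a coupled recursion\<close>

lemma four_mult_le_sum_squared: "4 * p * q \<le> (p + q)\<^sup>2" for p q :: real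
  using zero_le_power2[of "p - q"] by (simp add: power2_eq_square algebra_simps)

text \<open>Young's inequality turns the product into a small multiple of \<open>a k + b k\<close>
  plus a telescoping term; the recursion for \<open>b\<close> bounds the sum of \<open>b\<close> by
  that of \<open>a\<close>, and for small \<open>\<epsilon>\<close> the sum of \<open>a\<close> is
  absorbed on the left.\<close>

lemma summable_of_KL_recursion:
  fixes a b D :: "nat \<Rightarrow> real"
  assumes nn: "\<And>k. 0 \<le> a k" "\<And>k. 0 \<le> b k" "\<And>k. 0 \<le> D k"
    and dec: "\<And>k. D (Suc k) \<le> D k"
    and const: "0 \<le> \<rho>" "\<rho> < 1" "0 \<le> C" "0 \<le> K"
    and b: "\<And>k. b (Suc k) \<le> \<rho> * b k + C * (a (Suc k) + a k)"
    and a: "\<And>k. (a k)\<^sup>2 \<le> K * (a k + b k) * (D k - D (Suc k))"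
  shows "summable a" "summable b"
proof -
  \<comment> \<open>Chosen so that, once the bound for the sum of \<open>b\<close> is inserted, the
    sum of \<open>a\<close> reappears on the right with factor exactly 1/2.\<close>
  define \<epsilon> where "\<epsilon> = (1 - \<rho>) / (2 * (1 - \<rho> + 2 * C))"
  have \<epsilon>: "0 < \<epsilon>" using const by (simp add: \<epsilon>_def)
  define A where "A n = (\<Sum>k<n. a k)" for n
  define B where "B n = (\<Sum>k<n. b k)" for n
  have A0: "0 \<le> A n" for n by (simp add: A_def nn sum_nonneg)
  have young: "a k \<le> \<epsilon> * (a k + b k) + K / (4 * \<epsilon>) * (D k - D (Suc k))" for k
  proof (rule power2_le_imp_le)
    let ?p = "\<epsilon> * (a k + b k)" and ?q = "K / (4 * \<epsilon>) * (D k - D (Suc k))"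
    have "4 * ?p * ?q = K * (a k + b k) * (D k - D (Suc k))" using \<epsilon> by simp
    then have "(a k)\<^sup>2 \<le> 4 * ?p * ?q" using a[of k] by simp
    also have "\<dots> \<le> (?p + ?q)\<^sup>2"
      by (rule four_mult_le_sum_squared)
    finally show "(a k)\<^sup>2 \<le> (?p + ?q)\<^sup>2" .
    show "0 \<le> ?p + ?q" using \<epsilon> nn const dec[of k] by (intro add_nonneg_nonneg mult_nonneg_nonneg) auto
  qed
  have A: "A n \<le> \<epsilon> * (A n + B n) + K / (4 * \<epsilon>) * D 0" for n
  proof -
    have "A n \<le> (\<Sum>k<n. \<epsilon> * (a k + b k) + K / (4 * \<epsilon>) * (D k - D (Suc k)))"
      unfolding A_def by (rule sum_mono[OF young])
    also have "\<dots> = \<epsilon> * (A n + B n) + K / (4 * \<epsilon>) * (\<Sum>k<n. D k - D (Suc k))"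
      by (simp only: A_def B_def sum.distrib sum_distrib_left distrib_left)
    also have "(\<Sum>k<n. D k - D (Suc k)) = D 0 - D n" by (rule sum_lessThan_telescope')
    also have "K / (4 * \<epsilon>) * (D 0 - D n) \<le> K / (4 * \<epsilon>) * D 0"
      using \<epsilon> const nn by (intro mult_left_mono) auto
    finally show ?thesis by simp
  qed
  \<comment> \<open>The recursion says nothing about \<open>b 0\<close>, which is split off; the
    shifted and the unshifted sum of \<open>a\<close> are both at most \<open>A (Suc n)\<close>,
    hence the factor 2.\<close>
  have B: "B (Suc n) \<le> b 0 + \<rho> * B (Suc n) + 2 * C * A (Suc n)" for n
  proof -
    have "B (Suc n) = b 0 + (\<Sum>k<n. b (Suc k))"
      unfolding B_def by (rule sum.lessThan_Suc_shift)
    also have "(\<Sum>k<n. b (Suc k)) \<le> (\<Sum>k<n. \<rho> * b k + C * (a (Suc k) + a k))"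
      by (rule sum_mono[OF b])
    also have "\<dots> = \<rho> * B n + C * ((\<Sum>k<n. a (Suc k)) + A n)"
      by (simp only: A_def B_def sum.distrib sum_distrib_left distrib_left)
    also have "\<dots> \<le> \<rho> * B (Suc n) + C * (A (Suc n) + A (Suc n))"
    proof -
      have "A (Suc n) = a 0 + (\<Sum>k<n. a (Suc k))"
        unfolding A_def by (rule sum.lessThan_Suc_shift)
      moreover have "A n \<le> A (Suc n)" "B n \<le> B (Suc n)"
        using nn by (auto simp: A_def B_def)
      ultimately show ?thesis
        using const nn(1)[of 0] by (intro add_mono mult_left_mono) auto
    qed
    finally show ?thesis by simp
  qed
  have B': "B (Suc n) \<le> (b 0 + 2 * C * A (Suc n)) / (1 - \<rho>)" for n
    using B[of n] const by (simp add: field_simps)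
  have bdA: "A (Suc n) \<le> 2 * (\<epsilon> * b 0 / (1 - \<rho>) + K / (4 * \<epsilon>) * D 0)" for n
  proof -
    have "A (Suc n) \<le> \<epsilon> * (A (Suc n) + (b 0 + 2 * C * A (Suc n)) / (1 - \<rho>)) + K / (4 * \<epsilon>) * D 0"
      using A[of "Suc n"] B'[of n] \<epsilon> by (smt (verit) mult_left_mono)
    also have "\<dots> = A (Suc n) * (\<epsilon> * ((1 - \<rho> + 2 * C) / (1 - \<rho>))) + \<epsilon> * b 0 / (1 - \<rho>)
        + K / (4 * \<epsilon>) * D 0"
      using const by (simp add: add_divide_distrib diff_divide_distrib[symmetric] distrib_left)
    also have "\<epsilon> * ((1 - \<rho> + 2 * C) / (1 - \<rho>)) = 1 / 2"
      using const by (simp add: \<epsilon>_def)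
    finally show ?thesis by simp
  qed
  let ?S = "2 * (\<epsilon> * b 0 / (1 - \<rho>) + K / (4 * \<epsilon>) * D 0)"
  show "summable a"
  proof (rule summableI_nonneg_bounded[of a ?S])
    show "sum a {..<n} \<le> ?S" for n
      using bdA[of n] nn(1)[of n] by (simp add: A_def)
  qed (rule nn)
  show "summable b"
  proof (rule summableI_nonneg_bounded[of b "(b 0 + 2 * C * ?S) / (1 - \<rho>)"])
    fix n
    have "sum b {..<n} \<le> B (Suc n)" using nn(2)[of n] by (simp add: B_def)
    also have "\<dots> \<le> (b 0 + 2 * C * A (Suc n)) / (1 - \<rho>)" by (rule B')
    also have "\<dots> \<le> (b 0 + 2 * C * ?S) / (1 - \<rho>)"
      using bdA[of n] const by (intro divide_right_mono add_left_mono mult_left_mono) auto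
    finally show "sum b {..<n} \<le> (b 0 + 2 * C * ?S) / (1 - \<rho>)" .
  qed (rule nn)
qed

text \<open>An integrated form of the Kurdyka-Lojasiewicz inequality: the derivative of the
  desingularizing function is already replaced by a difference, so that functions from several
  neighbourhoods can be added. The level \<open>s\<close> is a parameter because all limit points
  will share one value, and \<open>e\<close> may be any upper bound for the distance to the
  subdifferential.\<close>

definition desingularizes ::
  "'a::euclidean_space set \<Rightarrow> ('a \<Rightarrow> real) \<Rightarrow> real \<Rightarrow> real \<Rightarrow> 'a set \<Rightarrow> (real \<Rightarrow> real) \<Rightarrow> bool" where
  "desingularizes N \<sigma> s \<eta> V \<phi> \<longleftrightarrow>
    (\<forall>t. 0 \<le> t \<and> t < \<eta> \<longrightarrow> 0 \<le> \<phi> t) \<and>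
    (\<forall>r t. 0 \<le> r \<and> r \<le> t \<and> t < \<eta> \<longrightarrow> \<phi> r \<le> \<phi> t) \<and>
    (\<forall>w e r. w \<in> N \<and> w \<in> V \<and> s < \<sigma> w \<and> \<sigma> w < s + \<eta> \<and> 0 \<le> r \<and> r \<le> \<sigma> w - s \<and>
      (INF \<xi>\<in>riem_subdiff N \<sigma> w. ereal (norm \<xi>)) \<le> ereal e \<longrightarrow>
      \<sigma> w - s - r \<le> e * (\<phi> (\<sigma> w - s) - \<phi> r))"

lemma riem_KL_desingularize:
  assumes "riem_KL N \<sigma> u"
  shows "\<exists>\<eta> V \<phi>. 0 < \<eta> \<and> open V \<and> u \<in> V \<and> desingularizes N \<sigma> (\<sigma> u) \<eta> V \<phi>"
proof -
  obtain \<eta>' :: ereal and W and \<phi> \<phi>' :: "real \<Rightarrow> real" where \<eta>': "0 < \<eta>'"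
    and W: "openin (top_of_set N) W" "u \<in> W"
    and conc: "concave_on {t. 0 \<le> t \<and> ereal t < \<eta>'} \<phi>"
    and pos: "\<forall>t. 0 \<le> t \<and> ereal t < \<eta>' \<longrightarrow> 0 \<le> \<phi> t"
    and der: "\<forall>t. 0 < t \<and> ereal t < \<eta>' \<longrightarrow> (\<phi> has_real_derivative \<phi>' t) (at t)"
    and \<phi>': "\<forall>t. 0 < t \<and> ereal t < \<eta>' \<longrightarrow> 0 < \<phi>' t"
    and KL: "\<forall>w\<in>W. \<sigma> u < \<sigma> w \<and> ereal (\<sigma> w) < ereal (\<sigma> u) + \<eta>' \<longrightarrow>
           1 \<le> ereal (\<phi>' (\<sigma> w - \<sigma> u)) * (INF \<xi>\<in>riem_subdiff N \<sigma> w. ereal (norm \<xi>))"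
    using assms unfolding riem_KL_def by blast
  obtain V where V: "open V" "W = N \<inter> V" using W(1) unfolding openin_open by blast
  \<comment> \<open>\<open>\<eta>'\<close> may be infinite; a smaller real bound suffices, because
    only values close to the one at \<open>u\<close> matter.\<close>
  obtain \<eta> where \<eta>: "0 < ereal \<eta>" "ereal \<eta> < \<eta>'" using ereal_dense2[OF \<eta>'] by blast
  have lt: "ereal t < \<eta>'" if "t < \<eta>" for t
    using that \<eta>(2) by (meson ereal_less_eq(3) less_imp_le order_le_less_trans)
  let ?I = "{0..<\<eta>}"
  have conv: "convex_on ?I (\<lambda>t. - \<phi> t)"
    by (rule convex_on_subset[OF conc[unfolded concave_on_def]]) (use lt in auto)
  have tangent: "\<phi>' t * (t - r) \<le> \<phi> t - \<phi> r" if "0 \<le> r" "r \<le> t" "0 < t" "t < \<eta>" for r t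
  proof -
    \<comment> \<open>Concavity puts the graph below its tangent at the right end point
      \<open>t\<close>. Only \<open>t\<close> has to be interior, so \<open>r\<close> may be 0,
      where \<open>\<phi>\<close> need not be differentiable.\<close>
    have "- \<phi>' t * (r - t) \<le> - \<phi> r - - \<phi> t"
    proof (rule convex_on_imp_above_tangent[OF conv])
      show "((\<lambda>t. - \<phi> t) has_real_derivative - \<phi>' t) (at t within ?I)"
        by (rule DERIV_minus[OF has_field_derivative_at_within]) (use der lt[OF that(4)] that(3) in blast)
      show "connected ?I" by simp
      show "t \<in> interior ?I" "r \<in> ?I" using that by simp_all
    qed
    then show ?thesis by (simp add: algebra_simps)
  qed
  have mono: "\<phi> r \<le> \<phi> t" if "0 \<le> r" "r \<le> t" "t < \<eta>" for r t
  proof (cases "t = 0")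
    case False
    then have "0 < \<phi>' t" using \<phi>' that lt by auto
    then have "0 \<le> \<phi>' t * (t - r)" using that by simp
    then show ?thesis using tangent[of r t] that False by linarith
  qed (use that in auto)
  have "desingularizes N \<sigma> (\<sigma> u) \<eta> V \<phi>"
    unfolding desingularizes_def
  proof (intro conjI allI impI; (elim conjE)?)
    show "0 \<le> \<phi> t" if "0 \<le> t" "t < \<eta>" for t using pos that lt by auto
    show "\<phi> r \<le> \<phi> t" if "0 \<le> r" "r \<le> t" "t < \<eta>" for r t using mono that .
    fix w e r
    assume w: "w \<in> N" "w \<in> V" "\<sigma> u < \<sigma> w" "\<sigma> w < \<sigma> u + \<eta>" and r: "0 \<le> r" "r \<le> \<sigma> w - \<sigma> u"
      and e: "(INF \<xi>\<in>riem_subdiff N \<sigma> w. ereal (norm \<xi>)) \<le> ereal e"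
    let ?t = "\<sigma> w - \<sigma> u"
    have t: "0 < ?t" "?t < \<eta>" using w by auto
    have "ereal (\<sigma> w) < ereal (\<sigma> u) + \<eta>'"
      using lt[OF t(2)] by (cases \<eta>') auto
    then have "1 \<le> ereal (\<phi>' ?t) * (INF \<xi>\<in>riem_subdiff N \<sigma> w. ereal (norm \<xi>))"
      using KL w V by blast
    also have "\<dots> \<le> ereal (\<phi>' ?t) * ereal e"
      using \<phi>' t lt by (intro ereal_mult_left_mono e) (simp add: less_imp_le)
    finally have 1: "1 \<le> \<phi>' ?t * e" by (simp add: one_ereal_def)
    have p: "0 < \<phi>' ?t" using \<phi>' t lt by blast
    have e0: "0 \<le> e"
      by (rule ccontr) (use 1 p mult_pos_neg[of "\<phi>' ?t" e] in linarith)
    have "?t - r \<le> (\<phi>' ?t * e) * (?t - r)"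
      using mult_right_mono[OF 1, of "?t - r"] r by simp
    also have "\<dots> = e * (\<phi>' ?t * (?t - r))" by simp
    also have "\<dots> \<le> e * (\<phi> ?t - \<phi> r)"
      using tangent[of r ?t] r t e0 by (intro mult_left_mono) auto
    finally show "\<sigma> w - \<sigma> u - r \<le> e * (\<phi> (\<sigma> w - \<sigma> u) - \<phi> r)" .
  qed
  moreover have "0 < \<eta>" "u \<in> V" using \<eta> V W by auto
  ultimately show ?thesis using V(1) by blast
qed

section \<open>Limit points of a bounded sequence\<close>

lemma limit_points_iff:
  fixes z :: "nat \<Rightarrow> 'a::metric_space"
  shows "u \<in> limit_points z \<longleftrightarrow> (\<forall>e>0. \<forall>n. \<exists>k>n. dist (z k) u < e)"
proof
  assume "u \<in> limit_points z"
  then obtain r where r: "strict_mono r" "(z \<circ> r) \<longlonglongrightarrow> u"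
    unfolding limit_points_def by blast
  show "\<forall>e>0. \<forall>n. \<exists>k>n. dist (z k) u < e"
  proof (intro allI impI)
    fix e :: real and n assume "0 < e"
    with r(2) have "\<forall>\<^sub>F j in sequentially. dist ((z \<circ> r) j) u < e"
      by (rule tendstoD)
    then obtain j where "\<forall>i\<ge>j. dist (z (r i)) u < e"
      unfolding eventually_sequentially by auto
    then have "dist (z (r (max j (Suc n)))) u < e" by simp
    moreover have "n < r (max j (Suc n))"
      using seq_suble[OF r(1), of "max j (Suc n)"] by linarith
    ultimately show "\<exists>k>n. dist (z k) u < e" by blast
  qed
next
  assume *: "\<forall>e>0. \<forall>n. \<exists>k>n. dist (z k) u < e"
  \<comment> \<open>Since indices with terms near \<open>u\<close> occur arbitrarily late, they can
    be chosen strictly increasing while the distance bound shrinks to 0.\<close>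
  have "\<exists>r. \<forall>n. dist (z (r n)) u < 1 / Suc n \<and> r n < r (Suc n)"
  proof (rule dependent_nat_choice)
    show "\<exists>k. dist (z k) u < 1 / Suc 0" using * by (metis zero_less_divide_1_iff of_nat_0_less_iff zero_less_Suc)
    show "\<exists>y. dist (z y) u < 1 / Suc (Suc n) \<and> k < y" for k n
      using *[rule_format, of "1 / Suc (Suc n)" k] by auto
  qed
  then obtain r where r: "\<And>n. dist (z (r n)) u < 1 / Suc n" "\<And>n. r n < r (Suc n)" by blast
  have "(\<lambda>n. dist (z (r n)) u) \<longlonglongrightarrow> 0"
    by (rule tendsto_sandwich[OF _ _ tendsto_const LIMSEQ_Suc[OF lim_1_over_n]])
       (use r(1) in \<open>auto intro!: always_eventually less_imp_le simp del: of_nat_Suc\<close>)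
  then have "(z \<circ> r) \<longlonglongrightarrow> u"
    by (simp add: tendsto_dist_iff[of _ u] o_def)
  then show "u \<in> limit_points z"
    using r(2) unfolding limit_points_def by (auto simp: strict_mono_Suc_iff)
qed

lemma compact_limit_points:
  fixes z :: "nat \<Rightarrow> 'a::heine_borel"
  assumes "bounded (range z)"
  shows "compact (limit_points z)"
proof -
  have "u \<in> limit_points z" if u: "u \<in> closure (limit_points z)" for u
    unfolding limit_points_iff
  proof (intro allI impI)
    fix e :: real and n assume e: "0 < e"
    then obtain v where v: "v \<in> limit_points z" "dist v u < e / 2"
      using u half_gt_zero[OF e] unfolding closure_approachable by blast
    obtain k where "k > n" "dist (z k) v < e / 2"
      using v(1) half_gt_zero[OF e] unfolding limit_points_iff by blast
    then show "\<exists>k>n. dist (z k) u < e"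
      using v(2) dist_triangle[of "z k" u v] by (intro exI[of _ k]) linarith
  qed
  then have "closed (limit_points z)"
    using closure_subset_eq by blast
  moreover have "limit_points z \<subseteq> closure (range z)"
  proof
    fix u assume "u \<in> limit_points z"
    then obtain r where "(z \<circ> r) \<longlonglongrightarrow> u" unfolding limit_points_def by blast
    then show "u \<in> closure (range z)"
      unfolding closure_sequential by (intro exI[of _ "z \<circ> r"]) simp
  qed
  then have "bounded (limit_points z)"
    using assms bounded_closure bounded_subset by blast
  ultimately show ?thesis by (simp add: compact_eq_bounded_closed)
qed

text \<open>Otherwise infinitely many terms lie outside \<open>V\<close>, and by boundedness they
  accumulate somewhere; that point lies in \<open>V\<close>, and since \<open>V\<close> is open so
  do some of these terms.\<close>

lemma eventually_near_limit_points:
  fixes z :: "nat \<Rightarrow> 'a::heine_borel"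
  assumes "bounded (range z)" "open V" "limit_points z \<subseteq> V"
  shows "\<forall>\<^sub>F k in sequentially. z k \<in> V"
proof (rule ccontr)
  assume "\<not> ?thesis"
  then have "infinite {k. z k \<notin> V}"
    by (simp add: cofinite_eq_sequentially[symmetric] eventually_cofinite)
  then obtain r :: "nat \<Rightarrow> nat" where r: "strict_mono r" "\<And>n. r n \<in> {k. z k \<notin> V}"
    using infinite_enumerate by blast
  have "bounded (range (z \<circ> r))" using assms(1) by (rule bounded_subset) auto
  then obtain u q where q: "strict_mono q" "((z \<circ> r) \<circ> q) \<longlonglongrightarrow> u"
    using bounded_imp_convergent_subsequence by blast
  have "u \<in> limit_points z"
    unfolding limit_points_def using q(2) strict_mono_o[OF r(1) q(1)] by (auto simp: o_assoc)
  then have "\<forall>\<^sub>F n in sequentially. ((z \<circ> r) \<circ> q) n \<in> V"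
    using assms(2,3) q(2) topological_tendstoD by blast
  then obtain n where "((z \<circ> r) \<circ> q) n \<in> V" by (auto simp: eventually_sequentially)
  then show False using r(2) by simp
qed

text \<open>The desingularizing functions of finitely many neighbourhoods covering the limit points are
  added up.\<close>

lemma KL_along_sequence:
  fixes z :: "nat \<Rightarrow> 'a::euclidean_space"
  assumes bdd: "bounded (range z)" and N: "\<forall>\<^sub>F k in sequentially. z k \<in> N"
    and cont: "\<And>u. isCont \<sigma> u"
    and dec: "\<forall>\<^sub>F k in sequentially. \<sigma> (z (Suc k)) \<le> \<sigma> (z k)"
    and KL: "\<And>u. u \<in> limit_points z \<Longrightarrow> riem_KL N \<sigma> u"
  obtains D :: "nat \<Rightarrow> real" and k0 where "\<And>k. k0 \<le> k \<Longrightarrow> 0 \<le> D k"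
    and "\<And>k. k0 \<le> k \<Longrightarrow> D (Suc k) \<le> D k"
    and "\<And>k e. k0 \<le> k \<Longrightarrow> (INF \<xi>\<in>riem_subdiff N \<sigma> (z k). ereal (norm \<xi>)) \<le> ereal e \<Longrightarrow>
      \<sigma> (z k) - \<sigma> (z (Suc k)) \<le> e * (D k - D (Suc k))"
proof -
  obtain k1 where k1: "\<And>k. k1 \<le> k \<Longrightarrow> \<sigma> (z (Suc k)) \<le> \<sigma> (z k)"
    using dec unfolding eventually_sequentially by blast
  \<comment> \<open>Continuity on a compact set bounds the values of \<open>\<sigma>\<close>, so the
    eventually decreasing values have a limit \<open>s\<close>.\<close>
  have "compact (closure (range z))" using bdd by (simp add: compact_closure)
  then have "compact (\<sigma> ` closure (range z))"
    using cont by (intro compact_continuous_image continuous_at_imp_continuous_on) auto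
  then have "bounded (\<sigma> ` closure (range z))" by (rule compact_imp_bounded)
  then have "bounded (range (\<lambda>k. \<sigma> (z (k + k1))))"
    by (rule bounded_subset) (auto intro!: imageI closure_subset[THEN subsetD])
  then have "Bseq (\<lambda>k. \<sigma> (z (k + k1)))"
    by (simp add: Bseq_eq_bounded)
  moreover have decseq: "decseq (\<lambda>k. \<sigma> (z (k + k1)))"
    by (rule decseq_SucI) (use k1 in simp)
  ultimately obtain s where s': "(\<lambda>k. \<sigma> (z (k + k1))) \<longlonglongrightarrow> s"
    using Bseq_monoseq_convergent decseq_imp_monoseq convergent_def by blast
  have s: "(\<lambda>k. \<sigma> (z k)) \<longlonglongrightarrow> s" using s' by (rule LIMSEQ_offset)
  have s_le: "s \<le> \<sigma> (z k)" if "k1 \<le> k" for k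
    using decseq_ge[OF decseq s', of "k - k1"] that by simp
  \<comment> \<open>One common value at all limit points lets all desingularizing functions be
    evaluated at the same argument \<open>\<sigma> (z k) - s\<close>.\<close>
  have val: "\<sigma> u = s" if "u \<in> limit_points z" for u
  proof -
    obtain r where r: "strict_mono r" "(z \<circ> r) \<longlonglongrightarrow> u"
      using \<open>u \<in> limit_points z\<close> unfolding limit_points_def by blast
    have "(\<lambda>k. \<sigma> ((z \<circ> r) k)) \<longlonglongrightarrow> \<sigma> u"
      using cont r(2) by (rule isCont_tendsto_compose)
    moreover have "(\<lambda>k. \<sigma> ((z \<circ> r) k)) \<longlonglongrightarrow> s"
      using LIMSEQ_subseq_LIMSEQ[OF s r(1)] by (simp add: o_def)
    ultimately show ?thesis by (rule LIMSEQ_unique)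
  qed
  have "\<forall>u\<in>limit_points z. \<exists>\<eta> V \<phi>. 0 < \<eta> \<and> open V \<and> u \<in> V \<and> desingularizes N \<sigma> s \<eta> V \<phi>"
    using riem_KL_desingularize[OF KL] val by metis
  then obtain \<eta> V \<phi> where good: "\<And>u. u \<in> limit_points z \<Longrightarrow>
      0 < \<eta> u \<and> open (V u) \<and> u \<in> V u \<and> desingularizes N \<sigma> s (\<eta> u) (V u) (\<phi> u)"
    by metis
  have "compact (limit_points z)" using bdd by (rule compact_limit_points)
  then obtain F where F: "F \<subseteq> limit_points z" "finite F" "limit_points z \<subseteq> (\<Union>u\<in>F. V u)"
    by (rule compactE_image[of _ "limit_points z" V]) (use good in auto)
  have gF: "0 < \<eta> u" "open (V u)" "desingularizes N \<sigma> s (\<eta> u) (V u) (\<phi> u)" if "u \<in> F" for u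
    using good F(1) that by blast+
  have "open (\<Union>u\<in>F. V u)" using gF(2) by (rule open_UN[OF ballI])
  then have "\<forall>\<^sub>F k in sequentially. z k \<in> (\<Union>u\<in>F. V u)"
    by (rule eventually_near_limit_points[OF bdd _ F(3)])
  moreover have "\<forall>\<^sub>F k in sequentially. \<forall>u\<in>F. \<sigma> (z k) < s + \<eta> u"
    using F(2) by (rule eventually_ball_finite) (use gF(1) in \<open>auto intro: order_tendstoD(2)[OF s]\<close>)
  ultimately have "\<forall>\<^sub>F k in sequentially. k1 \<le> k \<and> z k \<in> N \<and> z k \<in> (\<Union>u\<in>F. V u) \<and> (\<forall>u\<in>F. \<sigma> (z k) < s + \<eta> u)"
    using N eventually_ge_at_top[of k1] by eventually_elim blast
  then obtain k0 where k0: "\<And>k. k0 \<le> k \<Longrightarrow>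
      k1 \<le> k \<and> z k \<in> N \<and> z k \<in> (\<Union>u\<in>F. V u) \<and> (\<forall>u\<in>F. \<sigma> (z k) < s + \<eta> u)"
    unfolding eventually_sequentially by blast
  define D where "D k = (\<Sum>u\<in>F. \<phi> u (\<sigma> (z k) - s))" for k
  have r: "0 \<le> \<sigma> (z (Suc k)) - s" "\<sigma> (z (Suc k)) - s \<le> \<sigma> (z k) - s" if "k0 \<le> k" for k
    using that k0[OF that] k1[of k] s_le[of "Suc k"] by auto
  have mono: "\<phi> u (\<sigma> (z (Suc k)) - s) \<le> \<phi> u (\<sigma> (z k) - s)" if "k0 \<le> k" "u \<in> F" for k u
  proof -
    have "\<sigma> (z k) - s < \<eta> u" using k0[OF that(1)] that(2) by force
    then show ?thesis using gF(3)[OF that(2)] r[OF that(1)] unfolding desingularizes_def by blast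
  qed
  show ?thesis
  proof
    fix k assume k: "k0 \<le> k"
    show "0 \<le> D k"
      unfolding D_def
    proof (rule sum_nonneg)
      fix u assume "u \<in> F"
      moreover from this have "\<sigma> (z k) - s < \<eta> u" using k0[OF k] by force
      moreover have "0 \<le> \<sigma> (z k) - s" using k0[OF k] s_le by simp
      ultimately show "0 \<le> \<phi> u (\<sigma> (z k) - s)"
        using gF(3) unfolding desingularizes_def by blast
    qed
    show "D (Suc k) \<le> D k"
      unfolding D_def by (rule sum_mono[OF mono[OF k]])
    fix e assume e: "(INF \<xi>\<in>riem_subdiff N \<sigma> (z k). ereal (norm \<xi>)) \<le> ereal e"
    have "0 \<le> (INF \<xi>\<in>riem_subdiff N \<sigma> (z k). ereal (norm \<xi>))" by (rule INF_greatest) simp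
    then have e0: "0 \<le> e" using e by (metis ereal_less_eq(5) order_trans)
    show "\<sigma> (z k) - \<sigma> (z (Suc k)) \<le> e * (D k - D (Suc k))"
    \<comment> \<open>The desingularizing inequality requires a value strictly above
      \<open>s\<close>. Once \<open>s\<close> is reached the values are constant and both sides
      vanish.\<close>
    proof (cases "\<sigma> (z k) = s")
      case True
      then have "\<sigma> (z (Suc k)) = \<sigma> (z k)" using r[OF k] by linarith
      then show ?thesis by (simp add: D_def)
    next
      case False
      then have gt: "s < \<sigma> (z k)" using r[OF k] by linarith
      obtain u where u: "u \<in> F" "z k \<in> V u" using k0[OF k] by blast
      have "\<sigma> (z k) - s - (\<sigma> (z (Suc k)) - s) \<le>
          e * (\<phi> u (\<sigma> (z k) - s) - \<phi> u (\<sigma> (z (Suc k)) - s))"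
        using gF(3)[OF u(1)] u k0[OF k] r[OF k] gt e unfolding desingularizes_def by blast
      \<comment> \<open>Only a neighbourhood that contains \<open>z k\<close> provides an
        inequality; the remaining summands are nonnegative by monotonicity, so a single
        \<open>D\<close> serves every index.\<close>
      also have "\<dots> \<le> e * (\<Sum>u\<in>F. \<phi> u (\<sigma> (z k) - s) - \<phi> u (\<sigma> (z (Suc k)) - s))"
        by (rule mult_left_mono[OF member_le_sum[OF u(1)] e0])
           (use mono[OF k] F(2) in auto)
      finally show ?thesis by (simp add: D_def sum_subtractf)
    qed
  qed
qed

section \<open>Gradients of the objective and of the Lyapunov function\<close>

lemma grad_eq_GDERIV:
  fixes f :: "'a::real_inner \<Rightarrow> real"
  assumes "GDERIV f x :> D"
  shows "grad f x = D"
  unfolding grad_def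
proof (rule the_equality)
  show "GDERIV f x :> D" by (rule assms)
  fix D' assume "GDERIV f x :> D'"
  then have "(\<lambda>h. h \<bullet> D') = (\<lambda>h. h \<bullet> D)"
    using assms has_derivative_unique unfolding gderiv_def by blast
  then show "D' = D" using vector_eq_ldot by metis
qed

text \<open>The Riesz representative of a linear functional \<open>D\<close> is
  \<open>adjoint D 1\<close>, so the definite description in \<open>grad\<close> is meaningful
  wherever the function is differentiable.\<close>

lemma has_derivative_grad:
  fixes f :: "'a::euclidean_space \<Rightarrow> real"
  assumes "f differentiable (at x)"
  shows "(f has_derivative (\<lambda>h. grad f x \<bullet> h)) (at x)"
proof -
  obtain D where D: "(f has_derivative D) (at x)" using assms unfolding differentiable_def by blast
  then have "linear D" by (rule has_derivative_linear)
  then have "D = (\<lambda>h. h \<bullet> adjoint D 1)"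
    using adjoint_works[of D _ 1] by (auto simp: fun_eq_iff)
  then have "GDERIV f x :> adjoint D 1" using D unfolding gderiv_def by simp
  then have "GDERIV f x :> grad f x" using grad_eq_GDERIV by metis
  then show ?thesis by (simp add: gderiv_def inner_commute)
qed

lemma grad_eqI:
  assumes "(f has_derivative (\<lambda>h. G \<bullet> h)) (at x)"
  shows "grad f x = G"
  by (rule grad_eq_GDERIV) (use assms in \<open>simp add: gderiv_def inner_commute\<close>)

lemma has_derivative_block:
  fixes f :: "'a::euclidean_space \<Rightarrow> real"
  assumes "f differentiable (at (j a))" "(j has_derivative j') (at a)" "\<And>h. grad f (j a) \<bullet> j' h = G \<bullet> h"
  shows "((\<lambda>y. f (j y)) has_derivative (\<lambda>h. G \<bullet> h)) (at a)"
  using has_derivative_compose[OF assms(2) has_derivative_grad[OF assms(1)]] assms(3) by simp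

lemma has_derivative_blocks:
  fixes f :: "'a::euclidean_space \<times> 'b::euclidean_space \<times> 'c::euclidean_space \<times> 'd::euclidean_space \<Rightarrow> real"
  assumes "\<And>x. f differentiable (at x)"
  shows "((\<lambda>y. f (y, b, c, d)) has_derivative (\<lambda>h. fst (grad f (a, b, c, d)) \<bullet> h)) (at a)"
    and "((\<lambda>y. f (a, y, c, d)) has_derivative (\<lambda>h. fst (snd (grad f (a, b, c, d))) \<bullet> h)) (at b)"
    and "((\<lambda>y. f (a, b, y, d)) has_derivative (\<lambda>h. fst (snd (snd (grad f (a, b, c, d)))) \<bullet> h)) (at c)"
    and "((\<lambda>y. f (a, b, c, y)) has_derivative (\<lambda>h. snd (snd (snd (grad f (a, b, c, d)))) \<bullet> h)) (at d)"
proof -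
  have inner: "G \<bullet> (p, q, r, s) =
      fst G \<bullet> p + fst (snd G) \<bullet> q + fst (snd (snd G)) \<bullet> r + snd (snd (snd G)) \<bullet> s"
    for G :: "'a \<times> 'b \<times> 'c \<times> 'd" and p q r s
    by (cases G) (simp add: inner_Pair)
  show "((\<lambda>y. f (y, b, c, d)) has_derivative (\<lambda>h. fst (grad f (a, b, c, d)) \<bullet> h)) (at a)"
    by (rule has_derivative_block[where j = "\<lambda>y. (y, b, c, d)" and j' = "\<lambda>h. (h, 0, 0, 0)"])
       (auto intro!: derivative_eq_intros assms simp: inner zero_prod_def)
  show "((\<lambda>y. f (a, y, c, d)) has_derivative (\<lambda>h. fst (snd (grad f (a, b, c, d))) \<bullet> h)) (at b)"
    by (rule has_derivative_block[where j = "\<lambda>y. (a, y, c, d)" and j' = "\<lambda>h. (0, h, 0, 0)"])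
       (auto intro!: derivative_eq_intros assms simp: inner zero_prod_def)
  show "((\<lambda>y. f (a, b, y, d)) has_derivative (\<lambda>h. fst (snd (snd (grad f (a, b, c, d)))) \<bullet> h)) (at c)"
    by (rule has_derivative_block[where j = "\<lambda>y. (a, b, y, d)" and j' = "\<lambda>h. (0, 0, h, 0)"])
       (auto intro!: derivative_eq_intros assms simp: inner zero_prod_def)
  show "((\<lambda>y. f (a, b, c, y)) has_derivative (\<lambda>h. snd (snd (snd (grad f (a, b, c, d)))) \<bullet> h)) (at d)"
    by (rule has_derivative_block[where j = "\<lambda>y. (a, b, c, y)" and j' = "\<lambda>h. (0, 0, 0, h)"])
       (auto intro!: derivative_eq_intros assms simp: inner zero_prod_def)
qed

text \<open>Partial gradients are defined through separate functions of one block; as components of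
  a single gradient they inherit its Lipschitz bound on balls.\<close>

lemma pgrad_eq:
  fixes f :: "'a::euclidean_space \<times> 'b::euclidean_space \<times> 'c::euclidean_space \<times> 'd::euclidean_space \<Rightarrow> real"
  assumes "\<And>x. f differentiable (at x)"
  shows "pgrad1 f x = fst (grad f x)" "pgrad2 f x = fst (snd (grad f x))"
    "pgrad3 f x = fst (snd (snd (grad f x)))" "pgrad4 f x = snd (snd (snd (grad f x)))"
  by (cases x; simp add: grad_eqI has_derivative_blocks[OF assms])+

lemma has_derivative_blocks2:
  fixes g :: "'a::euclidean_space \<times> 'b::euclidean_space \<Rightarrow> real"
  assumes "\<And>x. g differentiable (at x)"
  shows "((\<lambda>y. g (y, b)) has_derivative (\<lambda>h. fst (grad g (a, b)) \<bullet> h)) (at a)"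
    and "((\<lambda>y. g (a, y)) has_derivative (\<lambda>h. snd (grad g (a, b)) \<bullet> h)) (at b)"
proof -
  have inner: "G \<bullet> (p, q) = fst G \<bullet> p + snd G \<bullet> q" for G :: "'a \<times> 'b" and p q
    by (cases G) (simp add: inner_Pair)
  show "((\<lambda>y. g (y, b)) has_derivative (\<lambda>h. fst (grad g (a, b)) \<bullet> h)) (at a)"
    by (rule has_derivative_block[where j = "\<lambda>y. (y, b)" and j' = "\<lambda>h. (h, 0)"])
       (auto intro!: derivative_eq_intros assms simp: inner)
  show "((\<lambda>y. g (a, y)) has_derivative (\<lambda>h. snd (grad g (a, b)) \<bullet> h)) (at b)"
    by (rule has_derivative_block[where j = "\<lambda>y. (a, y)" and j' = "\<lambda>h. (0, h)"])
       (auto intro!: derivative_eq_intros assms simp: inner)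
qed

lemma gpgrad_eq:
  fixes g :: "'a::euclidean_space \<times> 'b::euclidean_space \<Rightarrow> real"
  assumes "\<And>x. g differentiable (at x)"
  shows "gpgrad1 g x = fst (grad g x)" "gpgrad2 g x = snd (grad g x)"
  by (cases x; simp add: grad_eqI has_derivative_blocks2[OF assms])+

section \<open>Proximal operators, the constraint and the subproblems\<close>

lemma pos_block_diag_linear:
  fixes H :: "'a::euclidean_space^'n \<Rightarrow> 'a^'n"
  assumes "pos_block_diag H"
  shows "linear H" "H u \<bullet> v = u \<bullet> H v" "adjoint H = H"
proof -
  obtain h where H: "H = (\<lambda>x. \<chi> v. h v *\<^sub>R (x $ v))"
    using assms unfolding pos_block_diag_def by blast
  show "linear H"
    by (rule linearI) (simp_all add: H vec_eq_iff scaleR_add_right)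
  show *: "H u \<bullet> v = u \<bullet> H v" for u v
    by (simp add: H inner_vec_def)
  show "adjoint H = H" by (rule adjoint_unique) (use * in auto)
qed

text \<open>The eigenvalues are precisely the block factors \<open>h i\<close>, a finite nonempty
  set, so \<open>kappa_min\<close> and \<open>kappa_max\<close> bound the sum over the blocks term
  by term.\<close>

lemma pos_block_diag_kappa:
  fixes H :: "'a::euclidean_space^'n::finite \<Rightarrow> 'a^'n"
  assumes "pos_block_diag H"
  shows "0 < kappa_min H" "kappa_min H * (norm v)\<^sup>2 \<le> qform H v"
    "(norm (H v))\<^sup>2 \<le> (kappa_max H)\<^sup>2 * (norm v)\<^sup>2"
proof -
  obtain h where h: "\<And>i. 0 < h i" and H: "H = (\<lambda>x. \<chi> v. h v *\<^sub>R (x $ v))"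
    using assms unfolding pos_block_diag_def by blast
  have "eigvals H = range h"
  proof (intro set_eqI iffI)
    fix c assume "c \<in> eigvals H"
    then obtain v where v: "v \<noteq> 0" "H v = c *\<^sub>R v" unfolding eigvals_def by blast
    then obtain i where "v $ i \<noteq> 0" by (auto simp: vec_eq_iff)
    moreover have "h i *\<^sub>R (v $ i) = c *\<^sub>R (v $ i)"
      using v(2) by (simp add: H vec_eq_iff)
    ultimately show "c \<in> range h" by auto
  next
    fix c assume "c \<in> range h"
    then obtain i where c: "c = h i" by blast
    obtain b :: 'a where b: "b \<in> Basis" using nonempty_Basis by blast
    have "axis i b \<noteq> 0" using b by (simp add: axis_eq_0_iff nonzero_Basis)
    moreover have "H (axis i b) = c *\<^sub>R axis i b" by (simp add: H c vec_eq_iff axis_def)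
    ultimately show "c \<in> eigvals H" unfolding eigvals_def by blast
  qed
  then have min: "kappa_min H = Min (range h)" and max: "kappa_max H = Max (range h)"
    by (simp_all add: kappa_min_def kappa_max_def)
  have "Min (range h) \<in> range h" by (rule Min_in) auto
  then show "0 < kappa_min H" using h min by auto
  have le: "kappa_min H \<le> h i" "h i \<le> kappa_max H" for i
    unfolding min max by (auto intro: Min_le Max_ge)
  have norm2: "(norm w)\<^sup>2 = (\<Sum>i\<in>UNIV. (norm (w $ i))\<^sup>2)" for w :: "'a^'n"
    by (simp add: power2_norm_eq_inner inner_vec_def)
  have "kappa_min H * (norm v)\<^sup>2 = (\<Sum>i\<in>UNIV. kappa_min H * (norm (v $ i))\<^sup>2)"
    by (simp add: norm2 sum_distrib_left)
  also have "\<dots> \<le> (\<Sum>i\<in>UNIV. h i * (norm (v $ i))\<^sup>2)"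
    by (intro sum_mono mult_right_mono le) simp
  also have "\<dots> = qform H v"
    by (simp add: qform_def H inner_vec_def power2_norm_eq_inner)
  finally show "kappa_min H * (norm v)\<^sup>2 \<le> qform H v" .
  have "(norm (H v))\<^sup>2 = (\<Sum>i\<in>UNIV. (h i)\<^sup>2 * (norm (v $ i))\<^sup>2)"
    by (simp add: norm2 H power_mult_distrib)
  also have "\<dots> \<le> (\<Sum>i\<in>UNIV. (kappa_max H)\<^sup>2 * (norm (v $ i))\<^sup>2)"
    by (intro sum_mono mult_right_mono power_mono le) (auto simp: h less_imp_le)
  also have "\<dots> = (kappa_max H)\<^sup>2 * (norm v)\<^sup>2"
    by (simp add: norm2 sum_distrib_left)
  finally show "(norm (H v))\<^sup>2 \<le> (kappa_max H)\<^sup>2 * (norm v)\<^sup>2" .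
qed

lemma lincon_eq: "lincon (x1, x2, x3, x4) = (x1 - x2, x3 - x4)"
  by (simp add: A1_def A2_def A3_def A4_def)

lemma aug_lagr_eq:
  "aug_lagr f g \<beta> (x1, x2, x3, x4) l = f (x1, x2, x3, x4) + g (x1, x2)
     - fst l \<bullet> (x1 - x2) - snd l \<bullet> (x3 - x4) + \<beta> / 2 * ((norm (x1 - x2))\<^sup>2 + (norm (x3 - x4))\<^sup>2)"
  by (cases l) (simp add: lincon_eq inner_Pair norm_Pair del: lincon.simps)

lemma adjoint_A:
  "adjoint A1 l = fst l" "adjoint A2 l = - fst l" "adjoint A3 l = snd l" "adjoint A4 l = - snd l"
proof -
  have "adjoint A1 = fst" "adjoint A2 = (\<lambda>l. - fst l)" "adjoint A3 = snd" "adjoint A4 = (\<lambda>l. - snd l)"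
    by (rule adjoint_unique; auto simp: A1_def A2_def A3_def A4_def inner_Pair)+
  then show "adjoint A1 l = fst l" "adjoint A2 l = - fst l" "adjoint A3 l = snd l" "adjoint A4 l = - snd l"
    by metis+
qed

lemma has_derivative_qform:
  fixes H :: "'a::euclidean_space \<Rightarrow> 'a"
  assumes "linear H" "\<And>u v. H u \<bullet> v = u \<bullet> H v" "(j has_derivative j') (at a)"
  shows "((\<lambda>y. qform H (j y)) has_derivative (\<lambda>h. (2 *\<^sub>R H (j a)) \<bullet> j' h)) (at a)"
proof -
  have "bounded_linear H" using assms(1) by (simp add: linear_conv_bounded_linear)
  then have "((\<lambda>y. H (j y)) has_derivative (\<lambda>h. H (j' h))) (at a)"
    using assms(3) by (rule bounded_linear.has_derivative)
  then have "((\<lambda>y. j y \<bullet> H (j y)) has_derivative (\<lambda>h. j a \<bullet> H (j' h) + j' h \<bullet> H (j a))) (at a)"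
    using assms(3) by (intro has_derivative_inner)
  then show ?thesis
    unfolding qform_def
    by (simp add: assms(2)[symmetric] inner_commute[of "H (j' _)" "j a"] inner_add_left scaleR_2)
qed

text \<open>The common shape of all four subproblems: \<open>p\<close> is the partner of the block
  in its constraint, \<open>L\<close> the multiplier with the sign in which the block enters,
  \<open>q\<close> the old iterate, and \<open>c\<close> collects what does not depend on the
  block.\<close>

lemma has_derivative_subproblem:
  fixes H :: "'a::euclidean_space \<Rightarrow> 'a"
  assumes "linear H" "\<And>u v. H u \<bullet> v = u \<bullet> H v" "(F has_derivative (\<lambda>h. F' \<bullet> h)) (at a)"
  shows "((\<lambda>y. F y + (L \<bullet> (y - p) + \<beta> / 2 * (norm (y - p))\<^sup>2) + c + 1/2 * qform H (y - q)) has_derivative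
    (\<lambda>h. (F' + L + \<beta> *\<^sub>R (a - p) + H (a - q)) \<bullet> h)) (at a)"
proof -
  have 1: "((\<lambda>y. L \<bullet> (y - p)) has_derivative (\<lambda>h. L \<bullet> h)) (at a)"
    by (auto intro!: derivative_eq_intros)
  have 2: "((\<lambda>y. (norm (y - p))\<^sup>2) has_derivative (\<lambda>h. (2 *\<^sub>R (a - p)) \<bullet> h)) (at a)"
    unfolding power2_norm_eq_inner
    by (auto intro!: derivative_eq_intros simp: inner_commute)
  have 3: "((\<lambda>y. qform H (y - q)) has_derivative (\<lambda>h. (2 *\<^sub>R H (a - q)) \<bullet> h)) (at a)"
    by (rule has_derivative_qform[OF assms(1,2)]) (auto intro!: derivative_eq_intros)
  have "((\<lambda>y. F y + (L \<bullet> (y - p) + \<beta> / 2 * (norm (y - p))\<^sup>2) + c + 1/2 * qform H (y - q)) has_derivative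
    (\<lambda>h. F' \<bullet> h + (L \<bullet> h + \<beta> / 2 * ((2 *\<^sub>R (a - p)) \<bullet> h)) + 0 + 1/2 * ((2 *\<^sub>R H (a - q)) \<bullet> h))) (at a)"
    by (intro has_derivative_add has_derivative_mult_right has_derivative_const assms(3) 1 2 3)
  then show ?thesis
    by (simp add: inner_add_left add.assoc)
qed

text \<open>Testing the optimality condition with \<open>q - a\<close> produces the whole form
  \<open>qform H (a - q)\<close>, where a comparison of objective values would give only half of it.
  Convexity of \<open>F\<close> and the square left over from the penalty do the rest.\<close>

lemma prox_descent:
  fixes a :: "'a::real_inner"
  assumes "F a + F' \<bullet> (q - a) \<le> F q" "F' + L + \<beta> *\<^sub>R (a - p) + H (a - q) = 0" "0 \<le> \<beta>"
  shows "F a + (L \<bullet> (a - p) + \<beta> / 2 * (norm (a - p))\<^sup>2) + qform H (a - q)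
    \<le> F q + (L \<bullet> (q - p) + \<beta> / 2 * (norm (q - p))\<^sup>2)"
proof -
  have "(F' + L + \<beta> *\<^sub>R (a - p) + H (a - q)) \<bullet> (q - a) = 0" using assms(2) by simp
  then have 1: "F' \<bullet> (q - a) + L \<bullet> (q - a) + \<beta> * ((a - p) \<bullet> (q - a)) + H (a - q) \<bullet> (q - a) = 0"
    by (simp add: inner_add_left)
  have 2: "H (a - q) \<bullet> (q - a) = - qform H (a - q)"
    unfolding qform_def by (metis inner_commute inner_minus_right minus_diff_eq)
  have "(norm (q - p))\<^sup>2 = (norm (a - p))\<^sup>2 + 2 * ((a - p) \<bullet> (q - a)) + (norm (q - a))\<^sup>2"
    unfolding power2_norm_eq_inner by (simp add: inner_diff_left inner_diff_right inner_commute)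
  then have 3: "\<beta> / 2 * (norm (q - p))\<^sup>2 =
      \<beta> / 2 * (norm (a - p))\<^sup>2 + \<beta> * ((a - p) \<bullet> (q - a)) + \<beta> / 2 * (norm (q - a))\<^sup>2"
    by (simp add: field_simps)
  have 4: "L \<bullet> (q - p) = L \<bullet> (a - p) + L \<bullet> (q - a)" by (simp add: inner_diff_right)
  have "0 \<le> \<beta> / 2 * (norm (q - a))\<^sup>2" using assms(3) by simp
  then show ?thesis using assms(1) 1 2 3 4 by linarith
qed

text \<open>By self-adjointness each quadratic term differentiates to twice its operator, which
  appears with opposite signs in the blocks of the new and of the old point.\<close>

lemma has_derivative_lyap:
  fixes f :: "'n::finite vars \<Rightarrow> real" and g :: "'n blk4 \<times> 'n blk4 \<Rightarrow> real" and l m :: "'n mult"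
  assumes f: "\<And>x. f differentiable (at x)" and g: "\<And>x. g differentiable (at x)"
    and N1: "linear (M1 \<beta> \<tau> Lf Lg H1)" "\<And>u v. M1 \<beta> \<tau> Lf Lg H1 u \<bullet> v = u \<bullet> M1 \<beta> \<tau> Lf Lg H1 v"
    and N2: "linear (M2 \<beta> \<tau> Lf Lg H2)" "\<And>u v. M2 \<beta> \<tau> Lf Lg H2 u \<bullet> v = u \<bullet> M2 \<beta> \<tau> Lf Lg H2 v"
    and N3: "linear (M3 \<beta> \<tau> Lf H3)" "\<And>u v. M3 \<beta> \<tau> Lf H3 u \<bullet> v = u \<bullet> M3 \<beta> \<tau> Lf H3 v"
    and N4: "linear (M4 \<beta> \<tau> Lf H4)" "\<And>u v. M4 \<beta> \<tau> Lf H4 u \<bullet> v = u \<bullet> M4 \<beta> \<tau> Lf H4 v"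
  defines "\<gamma> \<equiv> alpha1 \<tau> / (\<tau> * \<beta>)"
  defines "F \<equiv> grad f" and "G \<equiv> grad g"
  shows "(lyap f g \<beta> \<tau> Lf Lg H1 H2 H3 H4 has_derivative (\<lambda>h.
    ((fst (F (x1, x2, x3, x4)) + fst (G (x1, x2)) - fst l + \<beta> *\<^sub>R (x1 - x2) + 2 *\<^sub>R M1 \<beta> \<tau> Lf Lg H1 (x1 - y1),
      fst (snd (F (x1, x2, x3, x4))) + snd (G (x1, x2)) + fst l - \<beta> *\<^sub>R (x1 - x2) + 2 *\<^sub>R M2 \<beta> \<tau> Lf Lg H2 (x2 - y2),
      fst (snd (snd (F (x1, x2, x3, x4)))) - snd l + \<beta> *\<^sub>R (x3 - x4) + 2 *\<^sub>R M3 \<beta> \<tau> Lf H3 (x3 - y3),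
      snd (snd (snd (F (x1, x2, x3, x4)))) + snd l - \<beta> *\<^sub>R (x3 - x4) + 2 *\<^sub>R M4 \<beta> \<tau> Lf H4 (x4 - y4)),
     (- 2 *\<^sub>R M1 \<beta> \<tau> Lf Lg H1 (x1 - y1), - 2 *\<^sub>R M2 \<beta> \<tau> Lf Lg H2 (x2 - y2),
      - 2 *\<^sub>R M3 \<beta> \<tau> Lf H3 (x3 - y3), - 2 *\<^sub>R M4 \<beta> \<tau> Lf H4 (x4 - y4)),
     - lincon (x1, x2, x3, x4) + (2 * \<gamma>) *\<^sub>R (l - m), - (2 * \<gamma>) *\<^sub>R (l - m)) \<bullet> h))
    (at ((x1, x2, x3, x4), (y1, y2, y3, y4), l, m))" (is "(_ has_derivative ?D) (at ?z)")
proof -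
  \<comment> \<open>The pattern matching in \<open>lyap\<close> is replaced by projections, so that
    the rules of differentiation apply to one variable \<open>z\<close>.\<close>
  have eq: "lyap f g \<beta> \<tau> Lf Lg H1 H2 H3 H4 = (\<lambda>z. f (fst z) + g (fst (fst z), fst (snd (fst z)))
      - fst (snd (snd z)) \<bullet> (fst (fst z) - fst (snd (fst z)), fst (snd (snd (fst z))) - snd (snd (snd (fst z))))
      + \<beta> / 2 * (norm (fst (fst z) - fst (snd (fst z))))\<^sup>2
      + \<beta> / 2 * (norm (fst (snd (snd (fst z))) - snd (snd (snd (fst z)))))\<^sup>2
      + \<gamma> * (norm (fst (snd (snd z)) - snd (snd (snd z))))\<^sup>2
      + qform (M1 \<beta> \<tau> Lf Lg H1) (fst (fst z) - fst (fst (snd z)))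
      + qform (M2 \<beta> \<tau> Lf Lg H2) (fst (snd (fst z)) - fst (snd (fst (snd z))))
      + qform (M3 \<beta> \<tau> Lf H3) (fst (snd (snd (fst z))) - fst (snd (snd (fst (snd z)))))
      + qform (M4 \<beta> \<tau> Lf H4) (snd (snd (snd (fst z))) - snd (snd (snd (fst (snd z))))))"
    (is "_ = (\<lambda>z. ?t1 z + ?t2 z - ?t3 z + \<beta> / 2 * ?t4 z + \<beta> / 2 * ?t5 z + \<gamma> * ?t6 z + ?q1 z + ?q2 z + ?q3 z + ?q4 z)")
    by (rule ext, clarify)
       (simp add: aug_lagr_eq \<gamma>_def inner_Pair algebra_simps fst_def[symmetric] del: aug_lagr.simps split: prod.splits)
  have nrm: "((\<lambda>z. (norm (j z))\<^sup>2) has_derivative (\<lambda>h. 2 * (j w \<bullet> j' h))) (at w)"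
    if "(j has_derivative j') (at w)" for j :: "'n lyap_pt \<Rightarrow> 'b::real_inner" and j' w
    unfolding power2_norm_eq_inner using has_derivative_inner[OF that that]
    by (simp add: inner_commute[of "j' _"])
  have "(?t1 has_derivative (\<lambda>h. F (x1, x2, x3, x4) \<bullet> fst h)) (at ?z)"
    unfolding F_def by (rule has_derivative_compose[OF _ has_derivative_grad[OF f], THEN has_derivative_eq_rhs])
      (auto intro!: derivative_eq_intros)
  moreover have "(?t2 has_derivative (\<lambda>h. G (x1, x2) \<bullet> (fst (fst h), fst (snd (fst h))))) (at ?z)"
    unfolding G_def
    by (rule has_derivative_compose[where g = g and f = "\<lambda>z. (fst (fst z), fst (snd (fst z)))"
          and g' = "\<lambda>h. grad g (x1, x2) \<bullet> h" and f' = "\<lambda>h. (fst (fst h), fst (snd (fst h)))"])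
       (use has_derivative_grad[OF g] in \<open>auto intro!: derivative_eq_intros\<close>)
  moreover have "(?t3 has_derivative (\<lambda>h. l \<bullet> (fst (fst h) - fst (snd (fst h)), fst (snd (snd (fst h))) - snd (snd (snd (fst h))))
      + fst (snd (snd h)) \<bullet> (x1 - x2, x3 - x4))) (at ?z)"
    by (rule has_derivative_eq_rhs, rule has_derivative_inner)
       (auto intro!: derivative_eq_intros)
  moreover have "(?t4 has_derivative (\<lambda>h. 2 * ((x1 - x2) \<bullet> (fst (fst h) - fst (snd (fst h)))))) (at ?z)"
    by (rule has_derivative_eq_rhs, rule nrm) (auto intro!: derivative_eq_intros)
  moreover have "(?t5 has_derivative (\<lambda>h. 2 * ((x3 - x4) \<bullet> (fst (snd (snd (fst h))) - snd (snd (snd (fst h))))))) (at ?z)"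
    by (rule has_derivative_eq_rhs, rule nrm) (auto intro!: derivative_eq_intros)
  moreover have "(?t6 has_derivative (\<lambda>h. 2 * ((l - m) \<bullet> (fst (snd (snd h)) - snd (snd (snd h)))))) (at ?z)"
    by (rule has_derivative_eq_rhs, rule nrm) (auto intro!: derivative_eq_intros)
  moreover have "(?q1 has_derivative (\<lambda>h. (2 *\<^sub>R M1 \<beta> \<tau> Lf Lg H1 (x1 - y1)) \<bullet> (fst (fst h) - fst (fst (snd h))))) (at ?z)"
    by (rule has_derivative_eq_rhs, rule has_derivative_qform[OF N1]) (auto intro!: derivative_eq_intros)
  moreover have "(?q2 has_derivative (\<lambda>h. (2 *\<^sub>R M2 \<beta> \<tau> Lf Lg H2 (x2 - y2)) \<bullet> (fst (snd (fst h)) - fst (snd (fst (snd h)))))) (at ?z)"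
    by (rule has_derivative_eq_rhs, rule has_derivative_qform[OF N2]) (auto intro!: derivative_eq_intros)
  moreover have "(?q3 has_derivative (\<lambda>h. (2 *\<^sub>R M3 \<beta> \<tau> Lf H3 (x3 - y3)) \<bullet> (fst (snd (snd (fst h))) - fst (snd (snd (fst (snd h))))))) (at ?z)"
    by (rule has_derivative_eq_rhs, rule has_derivative_qform[OF N3]) (auto intro!: derivative_eq_intros)
  moreover have "(?q4 has_derivative (\<lambda>h. (2 *\<^sub>R M4 \<beta> \<tau> Lf H4 (x4 - y4)) \<bullet> (snd (snd (snd (fst h))) - snd (snd (snd (fst (snd h))))))) (at ?z)"
    by (rule has_derivative_eq_rhs, rule has_derivative_qform[OF N4]) (auto intro!: derivative_eq_intros)
  ultimately have "(lyap f g \<beta> \<tau> Lf Lg H1 H2 H3 H4 has_derivative (\<lambda>h.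
      F (x1, x2, x3, x4) \<bullet> fst h + G (x1, x2) \<bullet> (fst (fst h), fst (snd (fst h)))
      - (l \<bullet> (fst (fst h) - fst (snd (fst h)), fst (snd (snd (fst h))) - snd (snd (snd (fst h))))
          + fst (snd (snd h)) \<bullet> (x1 - x2, x3 - x4))
      + \<beta> / 2 * (2 * ((x1 - x2) \<bullet> (fst (fst h) - fst (snd (fst h)))))
      + \<beta> / 2 * (2 * ((x3 - x4) \<bullet> (fst (snd (snd (fst h))) - snd (snd (snd (fst h))))))
      + \<gamma> * (2 * ((l - m) \<bullet> (fst (snd (snd h)) - snd (snd (snd h)))))
      + (2 *\<^sub>R M1 \<beta> \<tau> Lf Lg H1 (x1 - y1)) \<bullet> (fst (fst h) - fst (fst (snd h)))
      + (2 *\<^sub>R M2 \<beta> \<tau> Lf Lg H2 (x2 - y2)) \<bullet> (fst (snd (fst h)) - fst (snd (fst (snd h))))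
      + (2 *\<^sub>R M3 \<beta> \<tau> Lf H3 (x3 - y3)) \<bullet> (fst (snd (snd (fst h))) - fst (snd (snd (fst (snd h)))))
      + (2 *\<^sub>R M4 \<beta> \<tau> Lf H4 (x4 - y4)) \<bullet> (snd (snd (snd (fst h))) - snd (snd (snd (fst (snd h))))))) (at ?z)"
    (is "(_ has_derivative ?D') _")
    unfolding eq by (intro has_derivative_add has_derivative_diff has_derivative_mult_right)
  moreover have "?D' = ?D"
  proof
    fix h :: "'n lyap_pt"
    obtain h1 h2 h3 h4 k1 k2 k3 k4 la lb ma mb
      where h: "h = ((h1, h2, h3, h4), (k1, k2, k3, k4), (la, lb), (ma, mb))"
      by (metis surj_pair)
    obtain a b c d where l: "l = (a, b)" "m = (c, d)" by (metis surj_pair)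
    obtain F1 F2 F3 F4 where F: "F (x1, x2, x3, x4) = (F1, F2, F3, F4)" by (metis surj_pair)
    obtain G1 G2 where G: "G (x1, x2) = (G1, G2)" by (metis surj_pair)
    show "?D' h = ?D h"
      unfolding h F G l lincon_eq
      by (simp add: inner_Pair inner_add_left inner_diff_left inner_diff_right inner_commute
          algebra_simps)
  qed
  ultimately show ?thesis by simp
qed

lemma minimizer_grad_eq_0:
  fixes h :: "'a::euclidean_space \<Rightarrow> real"
  assumes "is_arg_min h (\<lambda>y. True) p" "(h has_derivative (\<lambda>v. n \<bullet> v)) (at p)"
  shows "n = 0"
proof -
  have "n \<bullet> n = 0"
    by (rule minimizer_normal[of h UNIV p n]) (use assms in \<open>simp_all add: tangent_space_UNIV\<close>)
  then show ?thesis by simp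
qed

lemma M_operators:
  fixes H :: "'a::euclidean_space^'n::finite \<Rightarrow> 'a^'n"
  assumes "pos_block_diag H"
  shows "linear (M1 \<beta> \<tau> Lf Lg H)" "M1 \<beta> \<tau> Lf Lg H u \<bullet> v = u \<bullet> M1 \<beta> \<tau> Lf Lg H v"
    and "linear (M2 \<beta> \<tau> Lf Lg H)" "M2 \<beta> \<tau> Lf Lg H u \<bullet> v = u \<bullet> M2 \<beta> \<tau> Lf Lg H v"
    and "linear (M3 \<beta> \<tau> Lf H)" "M3 \<beta> \<tau> Lf H u \<bullet> v = u \<bullet> M3 \<beta> \<tau> Lf H v"
    and "linear (M4 \<beta> \<tau> Lf H)" "M4 \<beta> \<tau> Lf H u \<bullet> v = u \<bullet> M4 \<beta> \<tau> Lf H v"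
proof -
  note H = pos_block_diag_linear[OF assms]
  note simps = M1_def M2_def M3_def M4_def linear_add[OF H(1)] linear_cmul[OF H(1)] H(3)
  show "linear (M1 \<beta> \<tau> Lf Lg H)" "linear (M2 \<beta> \<tau> Lf Lg H)" "linear (M3 \<beta> \<tau> Lf H)" "linear (M4 \<beta> \<tau> Lf H)"
    by (rule linearI; simp add: simps algebra_simps)+
  have H2: "H (H u) \<bullet> v = u \<bullet> H (H v)" for u v by (simp add: H(2))
  show "M1 \<beta> \<tau> Lf Lg H u \<bullet> v = u \<bullet> M1 \<beta> \<tau> Lf Lg H v" "M2 \<beta> \<tau> Lf Lg H u \<bullet> v = u \<bullet> M2 \<beta> \<tau> Lf Lg H v"
    "M3 \<beta> \<tau> Lf H u \<bullet> v = u \<bullet> M3 \<beta> \<tau> Lf H v" "M4 \<beta> \<tau> Lf H u \<bullet> v = u \<bullet> M4 \<beta> \<tau> Lf H v"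
    by (simp_all add: simps inner_diff_left inner_diff_right inner_add_left inner_add_right H(2) H2)
qed

lemma qform_M:
  fixes H :: "'a::euclidean_space^'n::finite \<Rightarrow> 'a^'n"
  assumes "pos_block_diag H"
  shows "qform (M1 \<beta> \<tau> Lf Lg H) v = 1/2 * qform H v - alpha2 \<tau> / \<beta> * ((7 * Lf\<^sup>2 + 4 * Lg\<^sup>2) * (norm v)\<^sup>2)"
    and "qform (M2 \<beta> \<tau> Lf Lg H) v = qform H v
      - alpha2 \<tau> / \<beta> * ((7 * Lf\<^sup>2 + 4 * Lg\<^sup>2) * (norm v)\<^sup>2 + 4 * (norm (H v))\<^sup>2)"
    and "qform (M3 \<beta> \<tau> Lf H) v = qform H v - alpha2 \<tau> / \<beta> * (3 * Lf\<^sup>2 * (norm v)\<^sup>2)"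
    and "qform (M4 \<beta> \<tau> Lf H) v = qform H v
      - alpha2 \<tau> / \<beta> * (3 * Lf\<^sup>2 * (norm v)\<^sup>2 + 3 * (norm (H v))\<^sup>2)"
proof -
  note H = pos_block_diag_linear[OF assms]
  have H2: "v \<bullet> H (H v) = (norm (H v))\<^sup>2" by (simp add: H(2)[symmetric] power2_norm_eq_inner)
  show "qform (M1 \<beta> \<tau> Lf Lg H) v = 1/2 * qform H v - alpha2 \<tau> / \<beta> * ((7 * Lf\<^sup>2 + 4 * Lg\<^sup>2) * (norm v)\<^sup>2)"
    "qform (M2 \<beta> \<tau> Lf Lg H) v = qform H v
      - alpha2 \<tau> / \<beta> * ((7 * Lf\<^sup>2 + 4 * Lg\<^sup>2) * (norm v)\<^sup>2 + 4 * (norm (H v))\<^sup>2)"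
    "qform (M3 \<beta> \<tau> Lf H) v = qform H v - alpha2 \<tau> / \<beta> * (3 * Lf\<^sup>2 * (norm v)\<^sup>2)"
    "qform (M4 \<beta> \<tau> Lf H) v = qform H v
      - alpha2 \<tau> / \<beta> * (3 * Lf\<^sup>2 * (norm v)\<^sup>2 + 3 * (norm (H v))\<^sup>2)"
    by (simp_all add: qform_def M1_def M2_def M3_def M4_def H(3) H2 power2_norm_eq_inner
        inner_diff_right inner_add_right distrib_right)
qed

text \<open>In both cases the difference of the two sides is the sum of the squared pairwise
  differences. The factors 4 and 3, one for each part of the multiplier, are the source of the
  coefficients 4, 3 and 7 = 4 + 3 in the Lyapunov function.\<close>

lemma norm_add4_sq:
  fixes a b c d :: "'a::real_inner"
  shows "(norm (a + b + c + d))\<^sup>2 \<le> 4 * ((norm a)\<^sup>2 + (norm b)\<^sup>2 + (norm c)\<^sup>2 + (norm d)\<^sup>2)"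
    and "(norm (a + b + c))\<^sup>2 \<le> 3 * ((norm a)\<^sup>2 + (norm b)\<^sup>2 + (norm c)\<^sup>2)"
proof -
  have "0 \<le> (norm (a - b))\<^sup>2 + (norm (a - c))\<^sup>2 + (norm (a - d))\<^sup>2 + (norm (b - c))\<^sup>2 + (norm (b - d))\<^sup>2 + (norm (c - d))\<^sup>2"
    by simp
  then show "(norm (a + b + c + d))\<^sup>2 \<le> 4 * ((norm a)\<^sup>2 + (norm b)\<^sup>2 + (norm c)\<^sup>2 + (norm d)\<^sup>2)"
    by (simp add: power2_norm_eq_inner inner_add_left inner_add_right inner_diff_left inner_diff_right inner_commute)
  have "0 \<le> (norm (a - b))\<^sup>2 + (norm (a - c))\<^sup>2 + (norm (b - c))\<^sup>2" by simp
  then show "(norm (a + b + c))\<^sup>2 \<le> 3 * ((norm a)\<^sup>2 + (norm b)\<^sup>2 + (norm c)\<^sup>2)"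
    by (simp add: power2_norm_eq_inner inner_add_left inner_add_right inner_diff_left inner_diff_right inner_commute)
qed

text \<open>Big-O with one constant for all indices. It spares an explicit constant in the bound for
  the Riemannian gradient.\<close>

definition dominated :: "(nat \<Rightarrow> real) \<Rightarrow> (nat \<Rightarrow> 'a::real_normed_vector) \<Rightarrow> bool" where
  "dominated s w \<longleftrightarrow> (\<exists>C\<ge>0. \<forall>k. norm (w k) \<le> C * s k)"

lemma dominatedI: "0 \<le> C \<Longrightarrow> (\<And>k. norm (w k) \<le> C * s k) \<Longrightarrow> dominated s w"
  unfolding dominated_def by blast

lemma dominated_add:
  assumes "dominated s v" "dominated s w"
  shows "dominated s (\<lambda>k. v k + w k)"
proof -
  obtain C D where "0 \<le> C" "\<And>k. norm (v k) \<le> C * s k" "0 \<le> D" "\<And>k. norm (w k) \<le> D * s k"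
    using assms unfolding dominated_def by blast
  then show ?thesis
    by (intro dominatedI[of "C + D"]) (auto simp: distrib_right intro: norm_triangle_le add_mono)
qed

lemma dominated_bound:
  assumes "dominated s v" "0 \<le> B" "\<And>k. norm (w k) \<le> B * norm (v k)"
  shows "dominated s w"
proof -
  obtain C where C: "0 \<le> C" "\<And>k. norm (v k) \<le> C * s k" using assms(1) unfolding dominated_def by blast
  show ?thesis
  proof (rule dominatedI[of "B * C"])
    fix k
    have "norm (w k) \<le> B * norm (v k)" by (rule assms(3))
    also have "\<dots> \<le> B * (C * s k)" using assms(2) C(2)[of k] by (intro mult_left_mono) auto
    finally show "norm (w k) \<le> B * C * s k" by simp
  qed (use assms(2) C in simp)
qed

lemma dominated_minus: "dominated s v \<Longrightarrow> dominated s (\<lambda>k. - v k)"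
  by (erule dominated_bound[of _ _ 1]) simp_all

lemma dominated_diff: "dominated s v \<Longrightarrow> dominated s w \<Longrightarrow> dominated s (\<lambda>k. v k - w k)"
  using dominated_add[OF _ dominated_minus] by fastforce

lemma dominated_linear:
  fixes T :: "'a::euclidean_space \<Rightarrow> 'b::euclidean_space"
  assumes "linear T" "dominated s v"
  shows "dominated s (\<lambda>k. T (v k))"
proof -
  obtain B where "0 < B" "\<And>x. norm (T x) \<le> B * norm x"
    using linear_bounded_pos[OF assms(1)] by blast
  then show ?thesis by (intro dominated_bound[OF assms(2), of B]) auto
qed

lemma dominated_scaleR: "dominated s v \<Longrightarrow> dominated s (\<lambda>k. c *\<^sub>R v k)" for v :: "nat \<Rightarrow> 'a::euclidean_space"
  by (rule dominated_linear) (rule linear_scaleR)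

lemma dominated_Pair:
  assumes "dominated s v" "dominated s w"
  shows "dominated s (\<lambda>k. (v k, w k))"
proof -
  obtain C D where CD: "0 \<le> C" "\<And>k. norm (v k) \<le> C * s k" "0 \<le> D" "\<And>k. norm (w k) \<le> D * s k"
    using assms unfolding dominated_def by blast
  show ?thesis
  proof (rule dominatedI[of "C + D"])
    fix k
    show "norm (v k, w k) \<le> (C + D) * s k"
      using norm_Pair_le[of "v k" "w k"] CD(2,4)[of k] by (simp add: distrib_right)
  qed (use CD in simp)
qed

lemma weighted_square:
  "(r * p + (1 - r) * q)\<^sup>2 = r * p\<^sup>2 + (1 - r) * q\<^sup>2 - r * (1 - r) * (p - q)\<^sup>2" for p q r :: real
  by (simp add: power2_eq_square algebra_simps)

lemma norm_component_le:
  "norm (fst z) \<le> norm z" "norm (fst (snd z)) \<le> norm z"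
  "norm (fst (snd (snd z))) \<le> norm z" "norm (snd (snd (snd z))) \<le> norm z"
proof -
  obtain a b c d where z: "z = (a, b, c, d)" by (metis surj_pair)
  have "norm (b, c, d) \<le> norm z" "norm (c, d) \<le> norm (b, c, d)" by (simp_all only: z norm_snd_le)
  then show "norm (fst z) \<le> norm z" "norm (fst (snd z)) \<le> norm z"
    "norm (fst (snd (snd z))) \<le> norm z" "norm (snd (snd (snd z))) \<le> norm z"
    using norm_fst_le[of a "(b, c, d)"] norm_fst_le[of b "(c, d)"] norm_fst_le[of c d] norm_snd_le[of d c]
    unfolding z by simp_all
qed

lemma tangent_space_lyap_space:
  "tangent_space (lyap_space M) ((x1, x2), (y1, y2), w) =
    (tangent_space M x1 \<times> UNIV) \<times> (tangent_space M y1 \<times> UNIV) \<times> UNIV"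
  by (simp add: lyap_space_def tangent_space_Times tangent_space_UNIV)

lemma convergent_of_summable_increments:
  fixes w :: "nat \<Rightarrow> 'a::euclidean_space"
  assumes "summable (\<lambda>k. norm (w (Suc k) - w k))"
  shows "convergent w"
proof -
  have "summable (\<lambda>k. w (Suc k) - w k)" using assms by (rule summable_norm_cancel)
  then have "convergent (\<lambda>n. \<Sum>k<n. w (Suc k) - w k)" by (simp add: summable_iff_convergent)
  then have "convergent (\<lambda>n. w n - w 0)" by (simp add: sum_lessThan_telescope)
  then show ?thesis by (simp only: convergent_diff_const_right_iff)
qed

section \<open>The iteration\<close>

text \<open>The sequence is given by its blocks, which keeps the subproblems free of projections.
  Nothing places the starting block \<open>X1 0\<close> in \<open>M\<close>: membership holds from
  index 1 on, which explains several shifts of the index below.\<close>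

locale pradmm_run =
  fixes M :: "'n::finite blk4 set"
    and f :: "'n vars \<Rightarrow> real" and g :: "'n blk4 \<times> 'n blk4 \<Rightarrow> real"
    and lf1 lf2 :: "'n blk4 \<times> 'n blk3 \<times> 'n blk3 \<Rightarrow> real"
    and lf3 lf4 :: "'n blk4 \<times> 'n blk4 \<times> 'n blk3 \<Rightarrow> real"
    and lg1 lg2 :: "'n blk4 \<Rightarrow> real"
    and H1 H2 :: "'n blk4 \<Rightarrow> 'n blk4" and H3 H4 :: "'n blk3 \<Rightarrow> 'n blk3"
    and \<beta> \<tau> R Lf Lg Lg2 :: real
    and X1 X2 :: "nat \<Rightarrow> 'n blk4" and X3 X4 :: "nat \<Rightarrow> 'n blk3"
    and La :: "nat \<Rightarrow> 'n blk4" and Lb :: "nat \<Rightarrow> 'n blk3"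
  assumes M: "embedded_submanifold M"
    and A: "assumption_A M f g lf1 lf2 lf3 lf4 lg1 lg2"
    and H1: "pos_block_diag H1" and H2: "pos_block_diag H2"
    and H3: "pos_block_diag H3" and H4: "pos_block_diag H4"
    and \<tau>: "0 < \<tau>" "\<tau> < 2" and \<beta>: "0 < \<beta>"
    and run: "pradmm M f g \<beta> \<tau> H1 H2 H3 H4 (\<lambda>k. (X1 k, X2 k, X3 k, X4 k)) (\<lambda>k. (La k, Lb k))"
    and bdd: "bounded (range (\<lambda>k. ((X1 k, X2 k, X3 k, X4 k), (La k, Lb k))))"
    and ball: "\<And>k. (X1 k, X2 k, X3 k, X4 k) \<in> blk_ball R"
    and const: "ball_constants R f g lg2 Lf Lg Lg2"
    and \<beta>_gt: "beta2 \<tau> Lf Lg H1 H2 H3 H4 < \<beta>"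
begin

section \<open>Optimality conditions of the blocks\<close>

lemma f_diff: "f differentiable (at z)" and g_diff: "g differentiable (at w)"
  using A unfolding assumption_A_def by (elim conjE; simp only:)+

abbreviation "F1 z \<equiv> fst (grad f z)"
abbreviation "F2 z \<equiv> fst (snd (grad f z))"
abbreviation "F3 z \<equiv> fst (snd (snd (grad f z)))"
abbreviation "F4 z \<equiv> snd (snd (snd (grad f z)))"
abbreviation "G1 w \<equiv> fst (grad g w)"
abbreviation "G2 w \<equiv> snd (grad g w)"

text \<open>The points visited during sweep \<open>k\<close>: the digit in \<open>u1\<close>,
  \<open>u2\<close>, \<open>u3\<close> counts the blocks already renewed. The exception is
  \<open>u4 k\<close>, the point before the sweep, so that the point after it is
  \<open>u4 (Suc k)\<close>.\<close>

abbreviation "u1 k \<equiv> (X1 (Suc k), X2 k, X3 k, X4 k)"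
abbreviation "u2 k \<equiv> (X1 (Suc k), X2 (Suc k), X3 k, X4 k)"
abbreviation "u3 k \<equiv> (X1 (Suc k), X2 (Suc k), X3 (Suc k), X4 k)"
abbreviation "u4 k \<equiv> (X1 k, X2 k, X3 k, X4 k)"

abbreviation "d1 k \<equiv> X1 (Suc k) - X1 k"
abbreviation "d2 k \<equiv> X2 (Suc k) - X2 k"
abbreviation "d3 k \<equiv> X3 (Suc k) - X3 k"
abbreviation "d4 k \<equiv> X4 (Suc k) - X4 k"

text \<open>The Euclidean gradient of the first subproblem at its minimizer. It need not vanish; it
  is only normal to \<open>M\<close>.\<close>

definition "n1 k = F1 (u1 k) + G1 (X1 (Suc k), X2 k) - La k + \<beta> *\<^sub>R (X1 (Suc k) - X2 k) + H1 (d1 k)"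

lemma convexity:
  "f (a, b, c, d) + F2 (a, b, c, d) \<bullet> (b' - b) \<le> f (a, b', c, d)"
  "f (a, b, c, d) + F3 (a, b, c, d) \<bullet> (c' - c) \<le> f (a, b, c', d)"
  "f (a, b, c, d) + F4 (a, b, c, d) \<bullet> (d' - d) \<le> f (a, b, c, d')"
  "g (a, b) + G2 (a, b) \<bullet> (b' - b) \<le> g (a, b')"
proof -
  note A' = A[unfolded assumption_A_def pgrad_eq[of f, OF f_diff] gpgrad_eq[of g, OF g_diff]]
  show "f (a, b, c, d) + F2 (a, b, c, d) \<bullet> (b' - b) \<le> f (a, b', c, d)"
    "f (a, b, c, d) + F3 (a, b, c, d) \<bullet> (c' - c) \<le> f (a, b, c', d)"
    "f (a, b, c, d) + F4 (a, b, c, d) \<bullet> (d' - d) \<le> f (a, b, c, d')"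
    "g (a, b) + G2 (a, b) \<bullet> (b' - b) \<le> g (a, b')"
    using A' by (elim conjE; simp only:)+
qed

lemma minimizers:
  "is_arg_min (\<lambda>y. aug_lagr f g \<beta> (y, X2 k, X3 k, X4 k) (La k, Lb k) + 1/2 * qform H1 (y - X1 k))
    (\<lambda>y. y \<in> M) (X1 (Suc k))"
  "is_arg_min (\<lambda>y. aug_lagr f g \<beta> (X1 (Suc k), y, X3 k, X4 k) (La k, Lb k) + 1/2 * qform H2 (y - X2 k))
    (\<lambda>y. True) (X2 (Suc k))"
  "is_arg_min (\<lambda>y. aug_lagr f g \<beta> (X1 (Suc k), X2 (Suc k), y, X4 k) (La k, Lb k) + 1/2 * qform H3 (y - X3 k))
    (\<lambda>y. True) (X3 (Suc k))"
  "is_arg_min (\<lambda>y. aug_lagr f g \<beta> (X1 (Suc k), X2 (Suc k), X3 (Suc k), y) (La k, Lb k) + 1/2 * qform H4 (y - X4 k))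
    (\<lambda>y. True) (X4 (Suc k))"
  using run unfolding pradmm_def by blast+

lemma multiplier_step:
  "La (Suc k) = La k - (\<tau> * \<beta>) *\<^sub>R (X1 (Suc k) - X2 (Suc k))"
  "Lb (Suc k) = Lb k - (\<tau> * \<beta>) *\<^sub>R (X3 (Suc k) - X4 (Suc k))"
proof -
  have "(La (Suc k), Lb (Suc k)) = (La k, Lb k) - (\<tau> * \<beta>) *\<^sub>R lincon (u4 (Suc k))"
    using run unfolding pradmm_def by blast
  then show "La (Suc k) = La k - (\<tau> * \<beta>) *\<^sub>R (X1 (Suc k) - X2 (Suc k))"
    "Lb (Suc k) = Lb k - (\<tau> * \<beta>) *\<^sub>R (X3 (Suc k) - X4 (Suc k))"
    by (simp_all add: lincon_eq del: lincon.simps)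
qed

lemma X1_in_M: "X1 (Suc k) \<in> M"
  using minimizers(1) by (simp add: is_arg_min_def)

lemma optimality1:
  assumes "v \<in> tangent_space M (X1 (Suc k))"
  shows "n1 k \<bullet> v = 0"
proof (rule minimizer_normal[OF minimizers(1) _ assms])
  have "((\<lambda>y. f (y, X2 k, X3 k, X4 k) + g (y, X2 k)) has_derivative
      (\<lambda>h. (F1 (u1 k) + G1 (X1 (Suc k), X2 k)) \<bullet> h)) (at (X1 (Suc k)))"
    unfolding inner_add_left
    by (intro has_derivative_add has_derivative_blocks has_derivative_blocks2 f_diff g_diff)
  then have "((\<lambda>y. f (y, X2 k, X3 k, X4 k) + g (y, X2 k)
      + (- La k \<bullet> (y - X2 k) + \<beta> / 2 * (norm (y - X2 k))\<^sup>2)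
      + (- Lb k \<bullet> (X3 k - X4 k) + \<beta> / 2 * (norm (X3 k - X4 k))\<^sup>2) + 1/2 * qform H1 (y - X1 k))
    has_derivative (\<lambda>h. (F1 (u1 k) + G1 (X1 (Suc k), X2 k) + - La k
      + \<beta> *\<^sub>R (X1 (Suc k) - X2 k) + H1 (d1 k)) \<bullet> h)) (at (X1 (Suc k)))"
    by (intro has_derivative_subproblem pos_block_diag_linear[OF H1])
  then show "((\<lambda>y. aug_lagr f g \<beta> (y, X2 k, X3 k, X4 k) (La k, Lb k) + 1/2 * qform H1 (y - X1 k))
      has_derivative (\<lambda>v. n1 k \<bullet> v)) (at (X1 (Suc k)))"
    by (simp add: aug_lagr_eq n1_def distrib_left algebra_simps del: aug_lagr.simps)
qed

text \<open>Block 2 enters the constraint with a minus sign; the penalty is therefore written with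
  the difference reversed, and the multiplier appears with a plus sign.\<close>

lemma optimality2:
  "F2 (u2 k) + G2 (X1 (Suc k), X2 (Suc k)) + La k + \<beta> *\<^sub>R (X2 (Suc k) - X1 (Suc k)) + H2 (d2 k) = 0"
proof (rule minimizer_grad_eq_0[OF minimizers(2)])
  have "((\<lambda>y. f (X1 (Suc k), y, X3 k, X4 k) + g (X1 (Suc k), y)) has_derivative
      (\<lambda>h. (F2 (u2 k) + G2 (X1 (Suc k), X2 (Suc k))) \<bullet> h)) (at (X2 (Suc k)))"
    unfolding inner_add_left
    by (intro has_derivative_add has_derivative_blocks has_derivative_blocks2 f_diff g_diff)
  then have "((\<lambda>y. f (X1 (Suc k), y, X3 k, X4 k) + g (X1 (Suc k), y)
      + (La k \<bullet> (y - X1 (Suc k)) + \<beta> / 2 * (norm (y - X1 (Suc k)))\<^sup>2)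
      + (- Lb k \<bullet> (X3 k - X4 k) + \<beta> / 2 * (norm (X3 k - X4 k))\<^sup>2) + 1/2 * qform H2 (y - X2 k))
    has_derivative (\<lambda>h. (F2 (u2 k) + G2 (X1 (Suc k), X2 (Suc k)) + La k
      + \<beta> *\<^sub>R (X2 (Suc k) - X1 (Suc k)) + H2 (d2 k)) \<bullet> h)) (at (X2 (Suc k)))"
    by (intro has_derivative_subproblem pos_block_diag_linear[OF H2])
  then show "((\<lambda>y. aug_lagr f g \<beta> (X1 (Suc k), y, X3 k, X4 k) (La k, Lb k) + 1/2 * qform H2 (y - X2 k))
    has_derivative (\<lambda>h. (F2 (u2 k) + G2 (X1 (Suc k), X2 (Suc k)) + La k
      + \<beta> *\<^sub>R (X2 (Suc k) - X1 (Suc k)) + H2 (d2 k)) \<bullet> h)) (at (X2 (Suc k)))"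
    by (simp add: aug_lagr_eq norm_minus_commute[of "X1 (Suc k)"] inner_diff_right distrib_left algebra_simps del: aug_lagr.simps)
qed

lemma optimality3:
  "F3 (u3 k) + - Lb k + \<beta> *\<^sub>R (X3 (Suc k) - X4 k) + H3 (d3 k) = 0"
proof (rule minimizer_grad_eq_0[OF minimizers(3)])
  have "((\<lambda>y. f (X1 (Suc k), X2 (Suc k), y, X4 k)) has_derivative
      (\<lambda>h. F3 (u3 k) \<bullet> h)) (at (X3 (Suc k)))"
    by (intro has_derivative_blocks f_diff)
  then have "((\<lambda>y. f (X1 (Suc k), X2 (Suc k), y, X4 k)
      + (- Lb k \<bullet> (y - X4 k) + \<beta> / 2 * (norm (y - X4 k))\<^sup>2)
      + (g (X1 (Suc k), X2 (Suc k)) - La k \<bullet> (X1 (Suc k) - X2 (Suc k))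
          + \<beta> / 2 * (norm (X1 (Suc k) - X2 (Suc k)))\<^sup>2) + 1/2 * qform H3 (y - X3 k))
    has_derivative (\<lambda>h. (F3 (u3 k) + - Lb k
      + \<beta> *\<^sub>R (X3 (Suc k) - X4 k) + H3 (d3 k)) \<bullet> h)) (at (X3 (Suc k)))"
    by (intro has_derivative_subproblem pos_block_diag_linear[OF H3])
  then show "((\<lambda>y. aug_lagr f g \<beta> (X1 (Suc k), X2 (Suc k), y, X4 k) (La k, Lb k) + 1/2 * qform H3 (y - X3 k))
    has_derivative (\<lambda>h. (F3 (u3 k) + - Lb k
      + \<beta> *\<^sub>R (X3 (Suc k) - X4 k) + H3 (d3 k)) \<bullet> h)) (at (X3 (Suc k)))"
    by (simp add: aug_lagr_eq distrib_left algebra_simps del: aug_lagr.simps)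
qed

lemma optimality4:
  "F4 (u4 (Suc k)) + Lb k + \<beta> *\<^sub>R (X4 (Suc k) - X3 (Suc k)) + H4 (d4 k) = 0"
proof (rule minimizer_grad_eq_0[OF minimizers(4)])
  have "((\<lambda>y. f (X1 (Suc k), X2 (Suc k), X3 (Suc k), y)) has_derivative
      (\<lambda>h. F4 (u4 (Suc k)) \<bullet> h)) (at (X4 (Suc k)))"
    by (intro has_derivative_blocks f_diff)
  then have "((\<lambda>y. f (X1 (Suc k), X2 (Suc k), X3 (Suc k), y)
      + (Lb k \<bullet> (y - X3 (Suc k)) + \<beta> / 2 * (norm (y - X3 (Suc k)))\<^sup>2)
      + (g (X1 (Suc k), X2 (Suc k)) - La k \<bullet> (X1 (Suc k) - X2 (Suc k))
          + \<beta> / 2 * (norm (X1 (Suc k) - X2 (Suc k)))\<^sup>2) + 1/2 * qform H4 (y - X4 k))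
    has_derivative (\<lambda>h. (F4 (u4 (Suc k)) + Lb k
      + \<beta> *\<^sub>R (X4 (Suc k) - X3 (Suc k)) + H4 (d4 k)) \<bullet> h)) (at (X4 (Suc k)))"
    by (intro has_derivative_subproblem pos_block_diag_linear[OF H4])
  then show "((\<lambda>y. aug_lagr f g \<beta> (X1 (Suc k), X2 (Suc k), X3 (Suc k), y) (La k, Lb k) + 1/2 * qform H4 (y - X4 k))
    has_derivative (\<lambda>h. (F4 (u4 (Suc k)) + Lb k
      + \<beta> *\<^sub>R (X4 (Suc k) - X3 (Suc k)) + H4 (d4 k)) \<bullet> h)) (at (X4 (Suc k)))"
    by (simp add: aug_lagr_eq norm_minus_commute[of "X3 (Suc k)"] inner_diff_right distrib_left algebra_simps del: aug_lagr.simps)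
qed

text \<open>\<open>X1 k \<in> M\<close> makes the old block a competitor in the first subproblem,
  and this comparison yields half of the form of \<open>H1\<close>. The other blocks range over
  whole spaces, where \<open>prox_descent\<close> yields the full forms.\<close>

lemma block_descent:
  assumes "X1 k \<in> M"
  shows "aug_lagr f g \<beta> (u4 (Suc k)) (La k, Lb k) + 1/2 * qform H1 (d1 k) + qform H2 (d2 k)
      + qform H3 (d3 k) + qform H4 (d4 k) \<le> aug_lagr f g \<beta> (u4 k) (La k, Lb k)"
proof -
  have \<beta>0: "0 \<le> \<beta>" using \<beta> by simp
  have "aug_lagr f g \<beta> (u1 k) (La k, Lb k) + 1/2 * qform H1 (d1 k)
      \<le> aug_lagr f g \<beta> (u4 k) (La k, Lb k) + 1/2 * qform H1 (X1 k - X1 k)"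
    using minimizers(1) assms unfolding is_arg_min_linorder by blast
  then have 1: "aug_lagr f g \<beta> (u1 k) (La k, Lb k) + 1/2 * qform H1 (d1 k) \<le> aug_lagr f g \<beta> (u4 k) (La k, Lb k)"
    by (simp add: qform_def del: aug_lagr.simps)
  have "f (u2 k) + g (X1 (Suc k), X2 (Suc k)) + (F2 (u2 k) + G2 (X1 (Suc k), X2 (Suc k))) \<bullet> (X2 k - X2 (Suc k))
      \<le> f (u1 k) + g (X1 (Suc k), X2 k)"
    unfolding inner_add_left using convexity(1,4) by (smt (verit))
  from prox_descent[where F = "\<lambda>y. f (X1 (Suc k), y, X3 k, X4 k) + g (X1 (Suc k), y)" and a = "X2 (Suc k)" and q = "X2 k"
      and L = "La k" and p = "X1 (Suc k)" and H = H2, OF this optimality2 \<beta>0]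
  have 2: "aug_lagr f g \<beta> (u2 k) (La k, Lb k) + qform H2 (d2 k) \<le> aug_lagr f g \<beta> (u1 k) (La k, Lb k)"
    unfolding aug_lagr_eq norm_minus_commute[of "X2 _" "X1 _"] by (simp add: inner_diff_right algebra_simps)
  from prox_descent[where F = "\<lambda>y. f (X1 (Suc k), X2 (Suc k), y, X4 k)" and a = "X3 (Suc k)" and q = "X3 k"
      and L = "- Lb k" and p = "X4 k" and H = H3, OF convexity(2) optimality3 \<beta>0]
  have 3: "aug_lagr f g \<beta> (u3 k) (La k, Lb k) + qform H3 (d3 k) \<le> aug_lagr f g \<beta> (u2 k) (La k, Lb k)"
    unfolding aug_lagr_eq by (simp add: inner_diff_right algebra_simps)
  from prox_descent[where F = "\<lambda>y. f (X1 (Suc k), X2 (Suc k), X3 (Suc k), y)" and a = "X4 (Suc k)" and q = "X4 k"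
      and L = "Lb k" and p = "X3 (Suc k)" and H = H4, OF convexity(3) optimality4 \<beta>0]
  have 4: "aug_lagr f g \<beta> (u4 (Suc k)) (La k, Lb k) + qform H4 (d4 k) \<le> aug_lagr f g \<beta> (u3 k) (La k, Lb k)"
    unfolding aug_lagr_eq norm_minus_commute[of "X4 _" "X3 _"] by (simp add: inner_diff_right algebra_simps)
  show ?thesis using 1 2 3 4 by linarith
qed

section \<open>Increments of the multiplier\<close>

abbreviation "\<rho> \<equiv> \<bar>1 - \<tau>\<bar>"

lemma \<rho>: "0 \<le> \<rho>" "\<rho> < 1"
  using \<tau> by auto

definition "a k = norm (d1 k, d2 k, d3 k, d4 k)"
definition "b k = norm (La (Suc k) - La k, Lb (Suc k) - Lb k)"

text \<open>The multipliers that a step with \<open>\<tau> = 1\<close> would produce; the iterates \<open>(La, Lb)\<close> are their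
  relaxation with parameter \<open>\<tau>\<close>.\<close>

definition "ta k = La k - \<beta> *\<^sub>R (X1 (Suc k) - X2 (Suc k))"
definition "tb k = Lb k - \<beta> *\<^sub>R (X3 (Suc k) - X4 (Suc k))"
definition "T k = norm (ta (Suc k) - ta k, tb (Suc k) - tb k)"

lemma a_nonneg: "0 \<le> a k" and b_nonneg: "0 \<le> b k"
  by (simp_all add: a_def b_def)

lemma a_sq: "(a k)\<^sup>2 = (norm (d1 k))\<^sup>2 + (norm (d2 k))\<^sup>2 + (norm (d3 k))\<^sup>2 + (norm (d4 k))\<^sup>2"
  by (simp add: a_def norm_Pair)

text \<open>A full multiplier step absorbs the penalty term of the optimality condition, leaving
  gradients at the iterates and the proximal term; differences of \<open>ta\<close> are thereby
  controlled by Lipschitz continuity.\<close>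

lemma ta_eq: "ta k = - (F2 (u2 k) + G2 (X1 (Suc k), X2 (Suc k)) + H2 (d2 k))"
proof -
  have "F2 (u2 k) + G2 (X1 (Suc k), X2 (Suc k)) + H2 (d2 k) + ta k = 0"
    using optimality2[of k] by (simp add: ta_def algebra_simps)
  then show ?thesis by (simp only: eq_neg_iff_add_eq_0 add.commute)
qed

lemma tb_eq: "tb k = - (F4 (u4 (Suc k)) + H4 (d4 k))"
proof -
  have "F4 (u4 (Suc k)) + H4 (d4 k) + tb k = 0"
    using optimality4[of k] by (simp add: tb_def algebra_simps)
  then show ?thesis by (simp only: eq_neg_iff_add_eq_0 add.commute)
qed

lemma grad_f_lipschitz:
  assumes "u \<in> blk_ball R" "v \<in> blk_ball R"
  shows "norm (grad f u - grad f v) \<le> Lf * norm (u - v)"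
proof -
  have "Lf-lipschitz_on (blk_ball R) (grad f)" using const unfolding ball_constants_def by blast
  from lipschitz_onD[OF this assms] show ?thesis by (simp add: dist_norm)
qed

lemma grad_g_lipschitz:
  assumes "u \<in> cball 0 R \<times> cball 0 R" "v \<in> cball 0 R \<times> cball 0 R"
  shows "norm (grad g u - grad g v) \<le> Lg * norm (u - v)"
proof -
  have "Lg-lipschitz_on (cball 0 R \<times> cball 0 R) (grad g)" using const unfolding ball_constants_def by blast
  from lipschitz_onD[OF this assms] show ?thesis by (simp add: dist_norm)
qed

lemma Lf_pos: "0 < Lf" and Lg_pos: "0 < Lg"
  using const unfolding ball_constants_def by blast+

lemma in_ball: "X1 k \<in> cball 0 R" "X2 k \<in> cball 0 R" "X3 k \<in> cball 0 R" "X4 k \<in> cball 0 R"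
  using ball[of k] unfolding blk_ball_def by blast+

lemma blocks_in_ball:
  "(X1 i, X2 j, X3 m, X4 n) \<in> blk_ball R" "(X1 i, X2 j) \<in> cball 0 R \<times> cball 0 R"
  unfolding blk_ball_def using in_ball by blast+

lemma grad_f_component_le:
  "norm (F1 u - F1 v) \<le> norm (grad f u - grad f v)"
  "norm (F2 u - F2 v) \<le> norm (grad f u - grad f v)"
  "norm (F3 u - F3 v) \<le> norm (grad f u - grad f v)"
  "norm (F4 u - F4 v) \<le> norm (grad f u - grad f v)"
proof -
  show "norm (F1 u - F1 v) \<le> norm (grad f u - grad f v)"
    "norm (F2 u - F2 v) \<le> norm (grad f u - grad f v)"
    "norm (F3 u - F3 v) \<le> norm (grad f u - grad f v)"
    "norm (F4 u - F4 v) \<le> norm (grad f u - grad f v)"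
    using norm_component_le[of "grad f u - grad f v"] by (simp_all only: fst_diff snd_diff)
qed

lemma grad_g_component_le:
  "norm (G1 u - G1 v) \<le> norm (grad g u - grad g v)"
  "norm (G2 u - G2 v) \<le> norm (grad g u - grad g v)"
  using norm_fst_le[of "fst (grad g u - grad g v)" "snd (grad g u - grad g v)"]
    norm_snd_le[of "snd (grad g u - grad g v)" "fst (grad g u - grad g v)"]
  unfolding prod.collapse by (simp_all only: fst_diff snd_diff)

text \<open>When block 2 is updated, blocks 3 and 4 still lag one sweep behind. So their increments
  carry the index \<open>k\<close>, and those of blocks 1 and 2 in the gradient terms carry
  \<open>Suc k\<close>.\<close>

lemma ta_diff: "(norm (ta (Suc k) - ta k))\<^sup>2 \<le> 4 *
    (Lf\<^sup>2 * ((norm (d1 (Suc k)))\<^sup>2 + (norm (d2 (Suc k)))\<^sup>2 + (norm (d3 k))\<^sup>2 + (norm (d4 k))\<^sup>2)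
     + Lg\<^sup>2 * ((norm (d1 (Suc k)))\<^sup>2 + (norm (d2 (Suc k)))\<^sup>2)
     + (norm (H2 (d2 (Suc k))))\<^sup>2 + (norm (H2 (d2 k)))\<^sup>2)"
proof -
  let ?f = "F2 (u2 k) - F2 (u2 (Suc k))"
  let ?g = "G2 (X1 (Suc k), X2 (Suc k)) - G2 (X1 (Suc (Suc k)), X2 (Suc (Suc k)))"
  have f: "norm ?f \<le> Lf * norm (d1 (Suc k), d2 (Suc k), d3 k, d4 k)"
    using order_trans[OF grad_f_component_le(2) grad_f_lipschitz[OF blocks_in_ball(1) blocks_in_ball(1)]]
    by (subst norm_minus_commute) force
  have g: "norm ?g \<le> Lg * norm (d1 (Suc k), d2 (Suc k))"
    using order_trans[OF grad_g_component_le(2) grad_g_lipschitz[OF blocks_in_ball(2) blocks_in_ball(2)]]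
    by (subst norm_minus_commute) force
  have "ta (Suc k) - ta k = ?f + ?g + (- H2 (d2 (Suc k))) + H2 (d2 k)"
    by (simp add: ta_eq)
  then have "(norm (ta (Suc k) - ta k))\<^sup>2 \<le>
      4 * ((norm ?f)\<^sup>2 + (norm ?g)\<^sup>2 + (norm (- H2 (d2 (Suc k))))\<^sup>2 + (norm (H2 (d2 k)))\<^sup>2)"
    using norm_add4_sq(1) by metis
  also have "\<dots> \<le> 4 * ((Lf * norm (d1 (Suc k), d2 (Suc k), d3 k, d4 k))\<^sup>2
      + (Lg * norm (d1 (Suc k), d2 (Suc k)))\<^sup>2 + (norm (- H2 (d2 (Suc k))))\<^sup>2 + (norm (H2 (d2 k)))\<^sup>2)"
    by (intro mult_left_mono add_mono power_mono f g) auto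
  finally show ?thesis
    by (simp add: power_mult_distrib norm_Pair add.assoc)
qed

text \<open>Block 4 comes last in the sweep, so its gradient is taken at a complete iterate and all
  four increments in the Lipschitz term have index \<open>Suc k\<close>.\<close>

lemma tb_diff: "(norm (tb (Suc k) - tb k))\<^sup>2 \<le> 3 *
    (Lf\<^sup>2 * ((norm (d1 (Suc k)))\<^sup>2 + (norm (d2 (Suc k)))\<^sup>2 + (norm (d3 (Suc k)))\<^sup>2 + (norm (d4 (Suc k)))\<^sup>2)
     + (norm (H4 (d4 (Suc k))))\<^sup>2 + (norm (H4 (d4 k)))\<^sup>2)"
proof -
  let ?f = "F4 (u4 (Suc k)) - F4 (u4 (Suc (Suc k)))"
  have f: "norm ?f \<le> Lf * norm (d1 (Suc k), d2 (Suc k), d3 (Suc k), d4 (Suc k))"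
    using order_trans[OF grad_f_component_le(4) grad_f_lipschitz[OF blocks_in_ball(1) blocks_in_ball(1)]]
    by (subst norm_minus_commute) force
  have "tb (Suc k) - tb k = ?f + (- H4 (d4 (Suc k))) + H4 (d4 k)"
    by (simp add: tb_eq)
  then have "(norm (tb (Suc k) - tb k))\<^sup>2 \<le>
      3 * ((norm ?f)\<^sup>2 + (norm (- H4 (d4 (Suc k))))\<^sup>2 + (norm (H4 (d4 k)))\<^sup>2)"
    using norm_add4_sq(2) by metis
  also have "\<dots> \<le> 3 * ((Lf * norm (d1 (Suc k), d2 (Suc k), d3 (Suc k), d4 (Suc k)))\<^sup>2
      + (norm (- H4 (d4 (Suc k))))\<^sup>2 + (norm (H4 (d4 k)))\<^sup>2)"
    by (intro mult_left_mono add_mono power_mono f) auto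
  finally show ?thesis
    by (simp add: power_mult_distrib norm_Pair add.assoc)
qed

text \<open>The summands are sorted by index. Up to the factor
  \<open>alpha2 \<tau> / \<beta>\<close>, those of index \<open>Suc k\<close> are, block by block,
  what \<open>M1\<close> to \<open>M4\<close> subtract; those of index \<open>k\<close> are what
  \<open>coercivity\<close> pays for.\<close>

lemma T_sq: "(T k)\<^sup>2 \<le>
    (7 * Lf\<^sup>2 + 4 * Lg\<^sup>2) * (norm (d1 (Suc k)))\<^sup>2
    + ((7 * Lf\<^sup>2 + 4 * Lg\<^sup>2) * (norm (d2 (Suc k)))\<^sup>2 + 4 * (norm (H2 (d2 (Suc k))))\<^sup>2)
    + 3 * Lf\<^sup>2 * (norm (d3 (Suc k)))\<^sup>2
    + (3 * Lf\<^sup>2 * (norm (d4 (Suc k)))\<^sup>2 + 3 * (norm (H4 (d4 (Suc k))))\<^sup>2)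
    + 4 * (norm (H2 (d2 k)))\<^sup>2 + 4 * Lf\<^sup>2 * (norm (d3 k))\<^sup>2
    + (4 * Lf\<^sup>2 * (norm (d4 k))\<^sup>2 + 3 * (norm (H4 (d4 k)))\<^sup>2)"
proof -
  have "(T k)\<^sup>2 = (norm (ta (Suc k) - ta k))\<^sup>2 + (norm (tb (Suc k) - tb k))\<^sup>2"
    by (simp add: T_def norm_Pair)
  then show ?thesis
    using ta_diff[of k] tb_diff[of k] by (simp add: algebra_simps)
qed

lemma T_le: "\<exists>C\<ge>0. \<forall>k. T k \<le> C * (a (Suc k) + a k)"
proof -
  \<comment> \<open>Large enough to dominate every coefficient of \<open>T_sq\<close> after the
    operators are estimated by \<open>kappa_max\<close>.\<close>
  define K where "K = 7 * Lf\<^sup>2 + 4 * Lg\<^sup>2 + 4 * (kappa_max H2)\<^sup>2 + 3 * (kappa_max H4)\<^sup>2"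
  have K: "0 \<le> K" by (simp add: K_def)
  have "T k \<le> sqrt K * (a (Suc k) + a k)" for k
  proof (rule power2_le_imp_le)
    have sq: "c * (norm v)\<^sup>2 \<le> K * (norm v)\<^sup>2" if "c \<le> K" for c and v :: "'w::real_normed_vector"
      using that by (intro mult_right_mono) auto
    have h2: "4 * (norm (H2 v))\<^sup>2 \<le> 4 * (kappa_max H2)\<^sup>2 * (norm v)\<^sup>2" for v
      using pos_block_diag_kappa(3)[OF H2, of v] by simp
    have h4: "3 * (norm (H4 v))\<^sup>2 \<le> 3 * (kappa_max H4)\<^sup>2 * (norm v)\<^sup>2" for v
      using pos_block_diag_kappa(3)[OF H4, of v] by simp
    have c: "7 * Lf\<^sup>2 + 4 * Lg\<^sup>2 \<le> K" "7 * Lf\<^sup>2 + 4 * Lg\<^sup>2 + 4 * (kappa_max H2)\<^sup>2 \<le> K"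
      "3 * Lf\<^sup>2 \<le> K" "3 * Lf\<^sup>2 + 3 * (kappa_max H4)\<^sup>2 \<le> K" "4 * (kappa_max H2)\<^sup>2 \<le> K" "4 * Lf\<^sup>2 \<le> K"
      "4 * Lf\<^sup>2 + 3 * (kappa_max H4)\<^sup>2 \<le> K" "0 \<le> K"
      by (simp_all add: K_def)
    have "(T k)\<^sup>2 \<le> K * (norm (d1 (Suc k)))\<^sup>2 + K * (norm (d2 (Suc k)))\<^sup>2 + K * (norm (d3 (Suc k)))\<^sup>2
       + K * (norm (d4 (Suc k)))\<^sup>2 + K * (norm (d1 k))\<^sup>2 + K * (norm (d2 k))\<^sup>2 + K * (norm (d3 k))\<^sup>2 + K * (norm (d4 k))\<^sup>2"
      using T_sq[of k] sq[OF c(1), of "d1 (Suc k)"] sq[OF c(2), of "d2 (Suc k)"] sq[OF c(3), of "d3 (Suc k)"]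
        sq[OF c(4), of "d4 (Suc k)"] sq[OF c(8), of "d1 k"] sq[OF c(5), of "d2 k"] sq[OF c(6), of "d3 k"]
        sq[OF c(7), of "d4 k"] h2[of "d2 (Suc k)"] h2[of "d2 k"] h4[of "d4 (Suc k)"] h4[of "d4 k"]
      by (simp add: distrib_right)
    also have "\<dots> = K * ((a (Suc k))\<^sup>2 + (a k)\<^sup>2)"
      by (simp add: a_sq distrib_left)
    also have "\<dots> \<le> K * (a (Suc k) + a k)\<^sup>2"
      using K a_nonneg[of k] a_nonneg[of "Suc k"] by (intro mult_left_mono) (simp_all add: power2_sum)
    also have "\<dots> = (sqrt K * (a (Suc k) + a k))\<^sup>2"
      using K by (simp add: power_mult_distrib)
    finally show "(T k)\<^sup>2 \<le> (sqrt K * (a (Suc k) + a k))\<^sup>2" .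
    show "0 \<le> sqrt K * (a (Suc k) + a k)"
      using K a_nonneg by simp
  qed
  then show ?thesis using K by (intro exI[of _ "sqrt K"]) simp
qed

lemma b_Suc_le: "b (Suc k) \<le> \<rho> * b k + \<tau> * T k"
proof -
  have "La (Suc k) = (1 - \<tau>) *\<^sub>R La k + \<tau> *\<^sub>R ta k" "Lb (Suc k) = (1 - \<tau>) *\<^sub>R Lb k + \<tau> *\<^sub>R tb k" for k
    by (simp_all add: multiplier_step ta_def tb_def algebra_simps)
  then have *: "(La (Suc (Suc k)) - La (Suc k), Lb (Suc (Suc k)) - Lb (Suc k)) =
      (1 - \<tau>) *\<^sub>R (La (Suc k) - La k, Lb (Suc k) - Lb k) + \<tau> *\<^sub>R (ta (Suc k) - ta k, tb (Suc k) - tb k)"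
    by (simp add: algebra_simps)
  show ?thesis
    unfolding b_def[of "Suc k"] *
    by (rule order_trans[OF norm_triangle_ineq]) (use \<tau> in \<open>simp add: b_def T_def del: scaleR_Pair\<close>)
qed

lemma b_Suc_le': "\<exists>C\<ge>0. \<forall>k. b (Suc k) \<le> \<rho> * b k + C * (a (Suc k) + a k)"
proof -
  obtain C where C: "0 \<le> C" "\<And>k. T k \<le> C * (a (Suc k) + a k)" using T_le by blast
  have "b (Suc k) \<le> \<rho> * b k + \<tau> * C * (a (Suc k) + a k)" for k
    using b_Suc_le[of k] mult_left_mono[OF C(2)[of k], of \<tau>] \<tau> unfolding mult.assoc by linarith
  then show ?thesis using C \<tau> by (intro exI[of _ "\<tau> * C"]) simp
qed

text \<open>Writing \<open>\<tau> * T k\<close> as \<open>(1 - \<rho>) * q\<close> makes the linear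
  bound a convex combination, so its square keeps the contraction factor \<open>\<rho>\<close> in
  front of the old square and has no cross term.\<close>

lemma b_Suc_sq: "(b (Suc k))\<^sup>2 \<le> \<rho> * (b k)\<^sup>2 + \<tau>\<^sup>2 / (1 - \<rho>) * (T k)\<^sup>2"
proof -
  define q where "q = \<tau> * T k / (1 - \<rho>)"
  have q: "\<tau> * T k = (1 - \<rho>) * q" using \<rho> by (simp add: q_def)
  have "(b (Suc k))\<^sup>2 \<le> (\<rho> * b k + (1 - \<rho>) * q)\<^sup>2"
    using b_Suc_le[of k] b_nonneg[of "Suc k"] unfolding q by (intro power_mono)
  also have "\<dots> = \<rho> * (b k)\<^sup>2 + (1 - \<rho>) * q\<^sup>2 - \<rho> * (1 - \<rho>) * (b k - q)\<^sup>2"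
    by (rule weighted_square)
  also have "\<dots> \<le> \<rho> * (b k)\<^sup>2 + (1 - \<rho>) * q\<^sup>2"
    using \<rho> by simp
  also have "(1 - \<rho>) * q\<^sup>2 = \<tau>\<^sup>2 / (1 - \<rho>) * (T k)\<^sup>2"
    using \<rho> by (simp add: q_def power2_eq_square)
  finally show ?thesis .
qed

text \<open>This is where the two constants come from: \<open>1 + alpha1 \<tau>\<close> equals
  \<open>1 / (1 - \<rho>)\<close>, so the left side is a multiple of the new square, and dividing
  \<open>b_Suc_sq\<close> by \<open>(1 - \<rho>) * (\<tau> * \<beta>)\<close> gives
  \<open>alpha1\<close> at the old square and \<open>alpha2\<close> at the square of
  \<open>T k\<close>.\<close>

lemma multiplier_ascent:
  "(b (Suc k))\<^sup>2 / (\<tau> * \<beta>) + alpha1 \<tau> / (\<tau> * \<beta>) * (b (Suc k))\<^sup>2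
    \<le> alpha1 \<tau> / (\<tau> * \<beta>) * (b k)\<^sup>2 + alpha2 \<tau> / \<beta> * (T k)\<^sup>2"
proof -
  have p: "0 < (1 - \<rho>) * (\<tau> * \<beta>)" using \<rho> \<tau> \<beta> by simp
  have "(b (Suc k))\<^sup>2 / (\<tau> * \<beta>) + alpha1 \<tau> / (\<tau> * \<beta>) * (b (Suc k))\<^sup>2 =
      (b (Suc k))\<^sup>2 / ((1 - \<rho>) * (\<tau> * \<beta>))"
    using \<rho> \<tau> \<beta> unfolding alpha1_def by (simp add: divide_simps) (simp add: algebra_simps)
  also have "\<dots> \<le> (\<rho> * (b k)\<^sup>2 + \<tau>\<^sup>2 / (1 - \<rho>) * (T k)\<^sup>2) / ((1 - \<rho>) * (\<tau> * \<beta>))"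
    using b_Suc_sq p by (intro divide_right_mono) auto
  also have "\<dots> = alpha1 \<tau> / (\<tau> * \<beta>) * (b k)\<^sup>2 + alpha2 \<tau> / \<beta> * (T k)\<^sup>2"
    using \<rho> \<tau> \<beta> unfolding alpha1_def alpha2_def
    by (simp add: add_divide_distrib power2_eq_square)
  finally show ?thesis .
qed

section \<open>Descent of the Lyapunov function\<close>

definition "P k = lyap f g \<beta> \<tau> Lf Lg H1 H2 H3 H4
  (u4 (Suc k), u4 k, (La (Suc k), Lb (Suc k)), (La k, Lb k))"

lemma P_eq: "P k = aug_lagr f g \<beta> (u4 (Suc k)) (La (Suc k), Lb (Suc k)) + alpha1 \<tau> / (\<tau> * \<beta>) * (b k)\<^sup>2
    + qform (M1 \<beta> \<tau> Lf Lg H1) (d1 k) + qform (M2 \<beta> \<tau> Lf Lg H2) (d2 k)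
    + qform (M3 \<beta> \<tau> Lf H3) (d3 k) + qform (M4 \<beta> \<tau> Lf H4) (d4 k)"
  by (simp add: P_def b_def del: aug_lagr.simps)

text \<open>Up to sign the residual is the multiplier increment divided by
  \<open>\<tau> * \<beta>\<close>, so its product with that increment becomes a square.\<close>

lemma aug_lagr_multiplier:
  "aug_lagr f g \<beta> (u4 (Suc k)) (La (Suc k), Lb (Suc k)) =
    aug_lagr f g \<beta> (u4 (Suc k)) (La k, Lb k) + (b k)\<^sup>2 / (\<tau> * \<beta>)"
proof -
  have p: "\<tau> * \<beta> \<noteq> 0" using \<tau> \<beta> by simp
  have "(La k - La (Suc k)) \<bullet> (X1 (Suc k) - X2 (Suc k)) = (norm (La (Suc k) - La k))\<^sup>2 / (\<tau> * \<beta>)"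
    "(Lb k - Lb (Suc k)) \<bullet> (X3 (Suc k) - X4 (Suc k)) = (norm (Lb (Suc k) - Lb k))\<^sup>2 / (\<tau> * \<beta>)"
    using p by (simp_all add: multiplier_step power_mult_distrib) (simp_all add: power2_eq_square power2_norm_eq_inner[symmetric])
  moreover have "(b k)\<^sup>2 = (norm (La (Suc k) - La k))\<^sup>2 + (norm (Lb (Suc k) - Lb k))\<^sup>2"
    by (simp add: b_def norm_Pair)
  ultimately show ?thesis
    unfolding aug_lagr_eq by (simp add: add_divide_distrib inner_diff_left)
qed

text \<open>The stored forms have to outweigh the terms of index \<open>k\<close> in
  \<open>T_sq\<close>. Together with what the operators already subtract, the demands add up to 4 +
  4 = 8 for \<open>H2\<close>, 3 + 4 = 7 for \<open>Lf\<close> in blocks 3 and 4, and 3 + 3 = 6 for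
  \<open>H4\<close>: the coefficients in \<open>beta2\<close>.\<close>

lemma coercivity:
  "\<exists>c>0. (\<forall>v. c * (norm v)\<^sup>2 \<le> qform (M1 \<beta> \<tau> Lf Lg H1) v)
    \<and> (\<forall>v. c * (norm v)\<^sup>2 \<le> qform (M2 \<beta> \<tau> Lf Lg H2) v - alpha2 \<tau> / \<beta> * (4 * (norm (H2 v))\<^sup>2))
    \<and> (\<forall>v. c * (norm v)\<^sup>2 \<le> qform (M3 \<beta> \<tau> Lf H3) v - alpha2 \<tau> / \<beta> * (4 * Lf\<^sup>2 * (norm v)\<^sup>2))
    \<and> (\<forall>v. c * (norm v)\<^sup>2 \<le> qform (M4 \<beta> \<tau> Lf H4) v
        - alpha2 \<tau> / \<beta> * (4 * Lf\<^sup>2 * (norm v)\<^sup>2 + 3 * (norm (H4 v))\<^sup>2))"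
proof -
  let ?\<alpha> = "alpha2 \<tau> / \<beta>"
  have \<alpha>: "0 \<le> ?\<alpha>" using \<tau> \<beta> by (simp add: alpha2_def)
  note k1 = pos_block_diag_kappa[OF H1] and k2 = pos_block_diag_kappa[OF H2]
    and k3 = pos_block_diag_kappa[OF H3] and k4 = pos_block_diag_kappa[OF H4]
  have gt: "2 * alpha2 \<tau> / kappa_min H1 * (7 * Lf\<^sup>2 + 4 * Lg\<^sup>2) < \<beta>"
    "alpha2 \<tau> / kappa_min H2 * (7 * Lf\<^sup>2 + 4 * Lg\<^sup>2 + 8 * (kappa_max H2)\<^sup>2) < \<beta>"
    "7 * alpha2 \<tau> * Lf\<^sup>2 / kappa_min H3 < \<beta>"
    "alpha2 \<tau> / kappa_min H4 * (7 * Lf\<^sup>2 + 6 * (kappa_max H4)\<^sup>2) < \<beta>"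
    using \<beta>_gt unfolding beta2_def by auto
  define c1 where "c1 = kappa_min H1 / 2 - ?\<alpha> * (7 * Lf\<^sup>2 + 4 * Lg\<^sup>2)"
  define c2 where "c2 = kappa_min H2 - ?\<alpha> * (7 * Lf\<^sup>2 + 4 * Lg\<^sup>2 + 8 * (kappa_max H2)\<^sup>2)"
  define c3 where "c3 = kappa_min H3 - ?\<alpha> * (7 * Lf\<^sup>2)"
  define c4 where "c4 = kappa_min H4 - ?\<alpha> * (7 * Lf\<^sup>2 + 6 * (kappa_max H4)\<^sup>2)"
  have pos: "0 < c1" "0 < c2" "0 < c3" "0 < c4"
    using gt k1(1) k2(1) k3(1) k4(1) \<beta> unfolding c1_def c2_def c3_def c4_def
    by (simp_all add: field_simps)
  have 1: "c1 * (norm v)\<^sup>2 \<le> qform (M1 \<beta> \<tau> Lf Lg H1) v" for v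
    using k1(2)[of v] by (simp add: qform_M[OF H1] c1_def left_diff_distrib)
  have 2: "c2 * (norm v)\<^sup>2 \<le> qform (M2 \<beta> \<tau> Lf Lg H2) v - ?\<alpha> * (4 * (norm (H2 v))\<^sup>2)" for v
  proof -
    have "?\<alpha> * (8 * (norm (H2 v))\<^sup>2) \<le> ?\<alpha> * (8 * ((kappa_max H2)\<^sup>2 * (norm v)\<^sup>2))"
      using k2(3)[of v] by (intro mult_left_mono \<alpha>) auto
    then show ?thesis
      using k2(2)[of v] by (simp add: qform_M[OF H2] c2_def algebra_simps)
  qed
  have 3: "c3 * (norm v)\<^sup>2 \<le> qform (M3 \<beta> \<tau> Lf H3) v - ?\<alpha> * (4 * Lf\<^sup>2 * (norm v)\<^sup>2)" for v
    using k3(2)[of v] by (simp add: qform_M[OF H3] c3_def algebra_simps)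
  have 4: "c4 * (norm v)\<^sup>2 \<le> qform (M4 \<beta> \<tau> Lf H4) v
      - ?\<alpha> * (4 * Lf\<^sup>2 * (norm v)\<^sup>2 + 3 * (norm (H4 v))\<^sup>2)" for v
  proof -
    have "?\<alpha> * (6 * (norm (H4 v))\<^sup>2) \<le> ?\<alpha> * (6 * ((kappa_max H4)\<^sup>2 * (norm v)\<^sup>2))"
      using k4(3)[of v] by (intro mult_left_mono \<alpha>) auto
    then show ?thesis
      using k4(2)[of v] by (simp add: qform_M[OF H4] c4_def algebra_simps)
  qed
  define c where "c = min (min c1 c2) (min c3 c4)"
  have le: "c * (norm v)\<^sup>2 \<le> c1 * (norm v)\<^sup>2" "c * (norm v)\<^sup>2 \<le> c2 * (norm v)\<^sup>2"
    "c * (norm w)\<^sup>2 \<le> c3 * (norm w)\<^sup>2" "c * (norm w)\<^sup>2 \<le> c4 * (norm w)\<^sup>2" for v :: "'n blk4" and w :: "'n blk3"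
    unfolding c_def by (intro mult_right_mono; simp)+
  show ?thesis
    using pos order_trans[OF le(1) 1] order_trans[OF le(2) 2] order_trans[OF le(3) 3] order_trans[OF le(4) 4]
    by (intro exI[of _ c]) (auto simp: c_def)
qed

text \<open>Block descent in sweep \<open>Suc k\<close> covers the positive part of the new forms,
  and their subtracted part absorbs the newer share of the multiplier ascent; the stored forms of
  sweep \<open>k\<close> absorb the older share. What survives is a multiple of the square of the
  older increment \<open>a k\<close>.\<close>

lemma lyap_descent: "\<exists>c>0. \<forall>k. P (Suc k) + c * (a k)\<^sup>2 \<le> P k"
proof -
  let ?\<alpha> = "alpha2 \<tau> / \<beta>"
  have \<alpha>: "0 \<le> ?\<alpha>" using \<tau> \<beta> by (simp add: alpha2_def)
  obtain c where c: "0 < c"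
    "\<And>v. c * (norm v)\<^sup>2 \<le> qform (M1 \<beta> \<tau> Lf Lg H1) v"
    "\<And>v. c * (norm v)\<^sup>2 \<le> qform (M2 \<beta> \<tau> Lf Lg H2) v - ?\<alpha> * (4 * (norm (H2 v))\<^sup>2)"
    "\<And>v. c * (norm v)\<^sup>2 \<le> qform (M3 \<beta> \<tau> Lf H3) v - ?\<alpha> * (4 * Lf\<^sup>2 * (norm v)\<^sup>2)"
    "\<And>v. c * (norm v)\<^sup>2 \<le> qform (M4 \<beta> \<tau> Lf H4) v - ?\<alpha> * (4 * Lf\<^sup>2 * (norm v)\<^sup>2 + 3 * (norm (H4 v))\<^sup>2)"
    using coercivity by blast
  have "P (Suc k) + c * (a k)\<^sup>2 \<le> P k" for k
  proof -
    have "?\<alpha> * (T k)\<^sup>2 \<le>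
        ?\<alpha> * ((7 * Lf\<^sup>2 + 4 * Lg\<^sup>2) * (norm (d1 (Suc k)))\<^sup>2)
        + ?\<alpha> * ((7 * Lf\<^sup>2 + 4 * Lg\<^sup>2) * (norm (d2 (Suc k)))\<^sup>2 + 4 * (norm (H2 (d2 (Suc k))))\<^sup>2)
        + ?\<alpha> * (3 * Lf\<^sup>2 * (norm (d3 (Suc k)))\<^sup>2)
        + ?\<alpha> * (3 * Lf\<^sup>2 * (norm (d4 (Suc k)))\<^sup>2 + 3 * (norm (H4 (d4 (Suc k))))\<^sup>2)
        + ?\<alpha> * (4 * (norm (H2 (d2 k)))\<^sup>2) + ?\<alpha> * (4 * Lf\<^sup>2 * (norm (d3 k))\<^sup>2)
        + ?\<alpha> * (4 * Lf\<^sup>2 * (norm (d4 k))\<^sup>2 + 3 * (norm (H4 (d4 k)))\<^sup>2)"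
      using mult_left_mono[OF T_sq[of k] \<alpha>] unfolding distrib_left[of ?\<alpha>] by linarith
    \<comment> \<open>Block descent is taken at \<open>Suc k\<close>, where the competitor
      \<open>X1 (Suc k)\<close> is known to lie in \<open>M\<close>, so no index has to be
      excluded.\<close>
    then show ?thesis
      using multiplier_ascent[of k] block_descent[of "Suc k", OF X1_in_M] aug_lagr_multiplier[of "Suc k"]
        c(2)[of "d1 k"] c(3)[of "d2 k"] c(4)[of "d3 k"] c(5)[of "d4 k"]
      unfolding P_eq a_sq qform_M(1)[OF H1, of _ _ _ _ "d1 (Suc k)"] qform_M(2)[OF H2, of _ _ _ _ "d2 (Suc k)"]
        qform_M(3)[OF H3, of _ _ _ "d3 (Suc k)"] qform_M(4)[OF H4, of _ _ _ "d4 (Suc k)"] distrib_left[of c]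
      by linarith
  qed
  then show ?thesis using c(1) by blast
qed

section \<open>Riemannian gradient bound and convergence\<close>

abbreviation "\<Psi> \<equiv> lyap f g \<beta> \<tau> Lf Lg H1 H2 H3 H4"
text \<open>The shift agrees with \<open>Omega_star\<close>: the newer iterate has index
  \<open>k + 1\<close>, and \<open>P k\<close> is the value of \<open>\<Psi>\<close> at this
  point.\<close>

abbreviation "Z k \<equiv> (u4 (Suc k), u4 k, (La (Suc k), Lb (Suc k)), (La k, Lb k))"

lemmas has_derivative_\<Psi> = has_derivative_lyap[OF f_diff g_diff M_operators(1,2)[OF H1]
  M_operators(3,4)[OF H2] M_operators(5,6)[OF H3] M_operators(7,8)[OF H4]]

lemma isCont_\<Psi>: "isCont \<Psi> z"
proof -
  obtain x1 x2 x3 x4 y1 y2 y3 y4 l m where "z = ((x1, x2, x3, x4), (y1, y2, y3, y4), l, m)"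
    by (metis surj_pair)
  then show ?thesis using has_derivative_continuous[OF has_derivative_\<Psi>] by simp
qed

text \<open>Modulo the normal vector \<open>n1\<close> and the optimality conditions of the subproblems, which are
  subtracted, the gradient of the Lyapunov function is a combination of increments.\<close>

lemma subgradient_bound:
  "\<exists>C\<ge>0. \<forall>k. X1 k \<in> M \<longrightarrow>
    (INF \<xi>\<in>riem_subdiff (lyap_space M) \<Psi> (Z k). ereal (norm \<xi>)) \<le> ereal (C * (a k + b k))"
proof -
  let ?\<gamma> = "alpha1 \<tau> / (\<tau> * \<beta>)"
  let ?s = "\<lambda>k. a k + b k"
  let ?m1 = "M1 \<beta> \<tau> Lf Lg H1" and ?m2 = "M2 \<beta> \<tau> Lf Lg H2" and ?m3 = "M3 \<beta> \<tau> Lf H3" and ?m4 = "M4 \<beta> \<tau> Lf H4"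
  define ea where "ea k = La (Suc k) - La k" for k
  define eb where "eb k = Lb (Suc k) - Lb k" for k
  \<comment> \<open>The gradient of \<open>\<Psi>\<close> in the first block minus
    \<open>n1 k\<close>. The term with \<open>d2 k\<close> arises because \<open>n1 k\<close>
    contains the old block \<open>X2 k\<close> and the gradient the new one; likewise
    \<open>ea k\<close> for the multiplier.\<close>
  define e1 where "e1 k = (F1 (u4 (Suc k)) - F1 (u1 k)) + (G1 (X1 (Suc k), X2 (Suc k)) - G1 (X1 (Suc k), X2 k))
      - ea k - \<beta> *\<^sub>R d2 k + 2 *\<^sub>R ?m1 (d1 k) - H1 (d1 k)" for k
  define e2 where "e2 k = (F2 (u4 (Suc k)) - F2 (u2 k)) + ea k + 2 *\<^sub>R ?m2 (d2 k) - H2 (d2 k)" for k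
  define e3 where "e3 k = (F3 (u4 (Suc k)) - F3 (u3 k)) - eb k - \<beta> *\<^sub>R d4 k + 2 *\<^sub>R ?m3 (d3 k) - H3 (d3 k)" for k
  define e4 where "e4 k = eb k + 2 *\<^sub>R ?m4 (d4 k) - H4 (d4 k)" for k
  define E where "E k = ((e1 k, e2 k, e3 k, e4 k),
     (- 2 *\<^sub>R ?m1 (d1 k), - 2 *\<^sub>R ?m2 (d2 k), - 2 *\<^sub>R ?m3 (d3 k), - 2 *\<^sub>R ?m4 (d4 k)),
     (1 / (\<tau> * \<beta>) + 2 * ?\<gamma>) *\<^sub>R (ea k, eb k), - (2 * ?\<gamma>) *\<^sub>R (ea k, eb k))" for k
  have "dominated ?s E"
  proof -
    have d: "dominated ?s (\<lambda>k. (d1 k, d2 k, d3 k, d4 k))"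
      by (rule dominatedI[of 1]) (simp_all add: a_def[symmetric] b_nonneg)
    have di: "dominated ?s d1" "dominated ?s d2" "dominated ?s d3" "dominated ?s d4"
      by (rule dominated_bound[OF d, of 1];
          use norm_component_le[of "(d1 _, d2 _, d3 _, d4 _)"] in simp)+
    have e: "dominated ?s (\<lambda>k. (ea k, eb k))"
      by (rule dominatedI[of 1]) (simp_all add: b_def[symmetric] a_nonneg ea_def eb_def)
    have ei: "dominated ?s ea" "dominated ?s eb"
      by (rule dominated_bound[OF e, of 1]; simp add: norm_fst_le norm_snd_le)+
    have F: "dominated ?s (\<lambda>k. grad f (u4 (Suc k)) - grad f (u1 k))"
      "dominated ?s (\<lambda>k. grad f (u4 (Suc k)) - grad f (u2 k))"
      "dominated ?s (\<lambda>k. grad f (u4 (Suc k)) - grad f (u3 k))"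
      by (rule dominated_bound[OF d, of Lf];
          (rule order_trans[OF grad_f_lipschitz[OF blocks_in_ball(1) blocks_in_ball(1)]])?;
          use Lf_pos in \<open>simp add: norm_Pair real_le_rsqrt\<close>)+
    have G: "dominated ?s (\<lambda>k. grad g (X1 (Suc k), X2 (Suc k)) - grad g (X1 (Suc k), X2 k))"
      by (rule dominated_bound[OF di(2), of Lg];
          (rule order_trans[OF grad_g_lipschitz[OF blocks_in_ball(2) blocks_in_ball(2)]])?;
          use Lg_pos in simp)
    have Fi: "dominated ?s (\<lambda>k. F1 (u4 (Suc k)) - F1 (u1 k))"
      "dominated ?s (\<lambda>k. F2 (u4 (Suc k)) - F2 (u2 k))"
      "dominated ?s (\<lambda>k. F3 (u4 (Suc k)) - F3 (u3 k))"
      by (rule dominated_bound[OF F(1), of 1], simp, simp add: grad_f_component_le)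
         (rule dominated_bound[OF F(2), of 1], simp, simp add: grad_f_component_le,
          rule dominated_bound[OF F(3), of 1], simp, simp add: grad_f_component_le)
    have Gi: "dominated ?s (\<lambda>k. G1 (X1 (Suc k), X2 (Suc k)) - G1 (X1 (Suc k), X2 k))"
      by (rule dominated_bound[OF G, of 1], simp, simp add: grad_g_component_le)
    note lin = dominated_linear[OF pos_block_diag_linear(1)[OF H1] di(1)]
      dominated_linear[OF pos_block_diag_linear(1)[OF H2] di(2)]
      dominated_linear[OF pos_block_diag_linear(1)[OF H3] di(3)]
      dominated_linear[OF pos_block_diag_linear(1)[OF H4] di(4)]
      dominated_linear[OF M_operators(1)[OF H1] di(1)] dominated_linear[OF M_operators(3)[OF H2] di(2)]
      dominated_linear[OF M_operators(5)[OF H3] di(3)] dominated_linear[OF M_operators(7)[OF H4] di(4)]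
    have "dominated ?s e1" "dominated ?s e2" "dominated ?s e3" "dominated ?s e4"
      unfolding e1_def e2_def e3_def e4_def
      by (intro dominated_add dominated_diff dominated_scaleR Fi Gi ei di lin)+
    then show ?thesis
      unfolding E_def by (intro dominated_Pair dominated_scaleR e lin)
  qed
  then obtain C where C: "0 \<le> C" "\<And>k. norm (E k) \<le> C * ?s k" unfolding dominated_def by blast
  have "(INF \<xi>\<in>riem_subdiff (lyap_space M) \<Psi> (Z k). ereal (norm \<xi>)) \<le> ereal (norm (E k))"
    if X1k: "X1 k \<in> M" for k
  proof (rule riem_subdiff_dist_le[OF has_derivative_\<Psi>])
    \<comment> \<open>The old point is part of \<open>Z k\<close>, which is why
      \<open>X1 k \<in> M\<close> is required.\<close>
    show "Z k \<in> lyap_space M" using X1k X1_in_M by (simp add: lyap_space_def)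
    show "subspace (tangent_space (lyap_space M) (Z k))"
      unfolding tangent_space_lyap_space
      by (intro subspace_Times subspace_UNIV subspace_tangent_space M X1k X1_in_M)
    have c1: "F1 (u4 (Suc k)) + G1 (X1 (Suc k), X2 (Suc k)) - La (Suc k) + \<beta> *\<^sub>R (X1 (Suc k) - X2 (Suc k))
        + 2 *\<^sub>R ?m1 (d1 k) = e1 k + n1 k"
      by (simp add: e1_def ea_def n1_def algebra_simps)
    \<comment> \<open>The parenthesis is the optimality condition of block 2 and hence zero;
      splitting it off cancels the penalty and leaves terms controlled by increments.\<close>
    have "F2 (u4 (Suc k)) + G2 (X1 (Suc k), X2 (Suc k)) + La (Suc k) - \<beta> *\<^sub>R (X1 (Suc k) - X2 (Suc k))
        + 2 *\<^sub>R ?m2 (d2 k) = e2 k + (F2 (u2 k) + G2 (X1 (Suc k), X2 (Suc k)) + La k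
          + \<beta> *\<^sub>R (X2 (Suc k) - X1 (Suc k)) + H2 (d2 k))"
      by (simp add: e2_def ea_def algebra_simps)
    then have c2: "F2 (u4 (Suc k)) + G2 (X1 (Suc k), X2 (Suc k)) + La (Suc k) - \<beta> *\<^sub>R (X1 (Suc k) - X2 (Suc k))
        + 2 *\<^sub>R ?m2 (d2 k) = e2 k"
      by (simp only: optimality2 add_0_right)
    have "F3 (u4 (Suc k)) - Lb (Suc k) + \<beta> *\<^sub>R (X3 (Suc k) - X4 (Suc k)) + 2 *\<^sub>R ?m3 (d3 k) = e3 k +
        (F3 (u3 k) + - Lb k + \<beta> *\<^sub>R (X3 (Suc k) - X4 k) + H3 (d3 k))"
      by (simp add: e3_def eb_def algebra_simps)
    then have c3: "F3 (u4 (Suc k)) - Lb (Suc k) + \<beta> *\<^sub>R (X3 (Suc k) - X4 (Suc k)) + 2 *\<^sub>R ?m3 (d3 k) = e3 k"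
      by (simp only: optimality3 add_0_right)
    have "F4 (u4 (Suc k)) + Lb (Suc k) - \<beta> *\<^sub>R (X3 (Suc k) - X4 (Suc k)) + 2 *\<^sub>R ?m4 (d4 k) = e4 k +
        (F4 (u4 (Suc k)) + Lb k + \<beta> *\<^sub>R (X4 (Suc k) - X3 (Suc k)) + H4 (d4 k))"
      by (simp add: e4_def eb_def algebra_simps)
    then have c4: "F4 (u4 (Suc k)) + Lb (Suc k) - \<beta> *\<^sub>R (X3 (Suc k) - X4 (Suc k)) + 2 *\<^sub>R ?m4 (d4 k) = e4 k"
      by (simp only: optimality4 add_0_right)
    \<comment> \<open>By the multiplier update the constraint residual is itself a scaled multiplier
      increment.\<close>
    have c5: "- lincon (u4 (Suc k)) + (2 * ?\<gamma>) *\<^sub>R (ea k, eb k) =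
        (1 / (\<tau> * \<beta>) + 2 * ?\<gamma>) *\<^sub>R (ea k, eb k)"
    proof -
      have "(1 / (\<tau> * \<beta>)) *\<^sub>R ea k = - (X1 (Suc k) - X2 (Suc k))" "(1 / (\<tau> * \<beta>)) *\<^sub>R eb k = - (X3 (Suc k) - X4 (Suc k))"
        using \<tau> \<beta> by (simp_all add: ea_def eb_def multiplier_step)
      then have "(1 / (\<tau> * \<beta>)) *\<^sub>R (ea k, eb k) = - lincon (u4 (Suc k))"
        by (simp add: lincon_eq del: lincon.simps)
      then show ?thesis by (simp add: scaleR_add_left del: lincon.simps scaleR_Pair)
    qed
    fix v assume "v \<in> tangent_space (lyap_space M) (Z k)"
    then have "n1 k \<bullet> fst (fst v) = 0"
      unfolding tangent_space_lyap_space by (intro optimality1) auto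
    then show "E k \<bullet> v = ((F1 (u4 (Suc k)) + G1 (X1 (Suc k), X2 (Suc k)) - fst (La (Suc k), Lb (Suc k))
          + \<beta> *\<^sub>R (X1 (Suc k) - X2 (Suc k)) + 2 *\<^sub>R ?m1 (d1 k),
        F2 (u4 (Suc k)) + G2 (X1 (Suc k), X2 (Suc k)) + fst (La (Suc k), Lb (Suc k))
          - \<beta> *\<^sub>R (X1 (Suc k) - X2 (Suc k)) + 2 *\<^sub>R ?m2 (d2 k),
        F3 (u4 (Suc k)) - snd (La (Suc k), Lb (Suc k)) + \<beta> *\<^sub>R (X3 (Suc k) - X4 (Suc k)) + 2 *\<^sub>R ?m3 (d3 k),
        F4 (u4 (Suc k)) + snd (La (Suc k), Lb (Suc k)) - \<beta> *\<^sub>R (X3 (Suc k) - X4 (Suc k)) + 2 *\<^sub>R ?m4 (d4 k)),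
        (- 2 *\<^sub>R ?m1 (d1 k), - 2 *\<^sub>R ?m2 (d2 k), - 2 *\<^sub>R ?m3 (d3 k), - 2 *\<^sub>R ?m4 (d4 k)),
        - lincon (u4 (Suc k)) + (2 * ?\<gamma>) *\<^sub>R ((La (Suc k), Lb (Suc k)) - (La k, Lb k)),
        - (2 * ?\<gamma>) *\<^sub>R ((La (Suc k), Lb (Suc k)) - (La k, Lb k))) \<bullet> v"
      unfolding fst_conv snd_conv c1 c2 c3 c4 c5 E_def diff_Pair ea_def[symmetric] eb_def[symmetric]
      by (cases v) (auto simp: inner_Pair inner_add_left simp del: scaleR_Pair lincon.simps)
  qed
  then have "X1 k \<in> M \<longrightarrow>
      (INF \<xi>\<in>riem_subdiff (lyap_space M) \<Psi> (Z k). ereal (norm \<xi>)) \<le> ereal (C * ?s k)" for k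
    using C(2)[of k] by (meson ereal_less_eq(3) order_trans)
  then show ?thesis using C(1) by blast
qed

lemma finite_length:
  assumes KL: "\<And>u. u \<in> limit_points Z \<Longrightarrow> riem_KL (lyap_space M) \<Psi> u"
  shows "summable a" "summable b"
proof -
  obtain c where c: "0 < c" "\<And>k. P (Suc k) + c * (a k)\<^sup>2 \<le> P k" using lyap_descent by blast
  obtain C where C: "0 \<le> C" "\<And>k. X1 k \<in> M \<Longrightarrow>
      (INF \<xi>\<in>riem_subdiff (lyap_space M) \<Psi> (Z k). ereal (norm \<xi>)) \<le> ereal (C * (a k + b k))"
    using subgradient_bound by blast
  obtain B where B: "0 \<le> B" "\<And>k. b (Suc k) \<le> \<rho> * b k + B * (a (Suc k) + a k)"
    using b_Suc_le' by blast
  have P: "P k = \<Psi> (Z k)" for k by (simp only: P_def)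
  have Z1: "bounded (range Z)"
  proof -
    let ?y = "\<lambda>k. (u4 k, (La k, Lb k))"
    \<comment> \<open>\<open>Z\<close> arises from pairs of iterates by a linear rearrangement, so
      its boundedness follows from that of the product of the range with itself.\<close>
    have "range Z \<subseteq> (\<lambda>((x', l'), (x, l)). (x', x, l', l)) ` (range ?y \<times> range ?y)"
    proof clarify
      fix k
      show "Z k \<in> (\<lambda>((x', l'), (x, l)). (x', x, l', l)) ` (range ?y \<times> range ?y)"
        by (rule image_eqI[where x = "(?y (Suc k), ?y k)"]) (simp only: case_prod_conv, blast)
    qed
    moreover have "bounded ((\<lambda>((x', l'), (x, l)). (x', x, l', l)) ` (range ?y \<times> range ?y))"
      by (rule bounded_linear_image[OF bounded_Times[OF bdd bdd]])
         (auto simp: linear_conv_bounded_linear[symmetric] intro!: linearI)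
    ultimately show ?thesis by (rule bounded_subset[rotated])
  qed
  have Z2: "\<forall>\<^sub>F k in sequentially. Z k \<in> lyap_space M"
    unfolding eventually_sequentially
    by (rule exI[of _ 1]) (auto simp: lyap_space_def X1_in_M dest!: Suc_le_D)
  have Z3: "\<forall>\<^sub>F k in sequentially. \<Psi> (Z (Suc k)) \<le> \<Psi> (Z k)"
  proof (rule always_eventually, rule)
    fix k
    have "0 \<le> c * (a k)\<^sup>2" using c(1) by simp
    then show "\<Psi> (Z (Suc k)) \<le> \<Psi> (Z k)" using c(2)[of k] unfolding P by linarith
  qed
  obtain D k0 where D: "\<And>k. k0 \<le> k \<Longrightarrow> 0 \<le> D k" "\<And>k. k0 \<le> k \<Longrightarrow> D (Suc k) \<le> D k"
    "\<And>k e. k0 \<le> k \<Longrightarrow> (INF \<xi>\<in>riem_subdiff (lyap_space M) \<Psi> (Z k). ereal (norm \<xi>)) \<le> ereal e \<Longrightarrow>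
      \<Psi> (Z k) - \<Psi> (Z (Suc k)) \<le> e * (D k - D (Suc k))"
    by (rule KL_along_sequence[of Z "lyap_space M" \<Psi>, OF Z1 Z2 isCont_\<Psi> Z3 KL]) blast+
  \<comment> \<open>One beyond \<open>k0\<close>, so that every remaining index is positive and its
    block \<open>X1\<close> lies in \<open>M\<close>.\<close>
  let ?k = "Suc k0"
  have a: "(a (k + ?k))\<^sup>2 \<le> C / c * (a (k + ?k) + b (k + ?k)) * (D (k + ?k) - D (Suc (k + ?k)))" for k
  proof -
    have "X1 (k + ?k) \<in> M" using X1_in_M[of "k + k0"] by simp
    then have "P (k + ?k) - P (Suc (k + ?k)) \<le> C * (a (k + ?k) + b (k + ?k)) * (D (k + ?k) - D (Suc (k + ?k)))"
      unfolding P by (intro D(3) C(2)) simp_all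
    then have "c * (a (k + ?k))\<^sup>2 \<le> C * (a (k + ?k) + b (k + ?k)) * (D (k + ?k) - D (Suc (k + ?k)))"
      using c(2)[of "k + ?k"] by linarith
    then show ?thesis using c(1) by (simp add: field_simps)
  qed
  have D': "0 \<le> D (k + ?k)" "D (Suc k + ?k) \<le> D (k + ?k)" for k
    using D(1)[of "k + ?k"] D(2)[of "k + ?k"] by simp_all
  have B': "b (Suc k + ?k) \<le> \<rho> * b (k + ?k) + B * (a (Suc k + ?k) + a (k + ?k))" for k
    using B(2)[of "k + ?k"] by simp
  have a': "(a (k + ?k))\<^sup>2 \<le> C / c * (a (k + ?k) + b (k + ?k)) * (D (k + ?k) - D (Suc k + ?k))" for k
    using a[of k] by simp
  have "0 \<le> C / c" using C(1) c(1) by simp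
  from summable_of_KL_recursion[where a = "\<lambda>k. a (k + ?k)" and b = "\<lambda>k. b (k + ?k)" and D = "\<lambda>k. D (k + ?k)",
      OF a_nonneg b_nonneg D' \<rho> B(1) this B' a']
  have "summable (\<lambda>k. a (k + ?k))" "summable (\<lambda>k. b (k + ?k))" .
  then show "summable a" "summable b" by (simp_all only: summable_iff_shift)
qed

text \<open>\<open>M\<close> is not assumed closed, so membership of the limit is a premise; the
  theorem draws it from \<open>riem_KL\<close>, which includes that the point belongs to the
  space.\<close>

lemma limit_stationary:
  assumes lim: "(\<lambda>k. (u4 k, (La k, Lb k))) \<longlonglongrightarrow> ((x1, x2, x3, x4), (la, lb))" and x1: "x1 \<in> M"
  shows "stationary_point M f g (x1, x2, x3, x4) (la, lb)"
proof -
  have u4: "u4 \<longlonglongrightarrow> (x1, x2, x3, x4)" using tendsto_fst[OF lim] by simp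
  have X: "X1 \<longlonglongrightarrow> x1" "X2 \<longlonglongrightarrow> x2" "X3 \<longlonglongrightarrow> x3" "X4 \<longlonglongrightarrow> x4"
    using tendsto_fst[OF u4] tendsto_fst[OF tendsto_snd[OF u4]]
      tendsto_fst[OF tendsto_snd[OF tendsto_snd[OF u4]]] tendsto_snd[OF tendsto_snd[OF tendsto_snd[OF u4]]]
    by simp_all
  have L: "La \<longlonglongrightarrow> la" "Lb \<longlonglongrightarrow> lb"
    using tendsto_fst[OF tendsto_snd[OF lim]] tendsto_snd[OF tendsto_snd[OF lim]] by simp_all
  note X' = X[THEN LIMSEQ_Suc] and L' = L[THEN LIMSEQ_Suc]
  \<comment> \<open>The scaled multiplier increment equals the residual, so convergence of the
    multipliers forces feasibility of the limit.\<close>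
  have "(\<lambda>k. (1 / (\<tau> * \<beta>)) *\<^sub>R (La k - La (Suc k))) \<longlonglongrightarrow> (1 / (\<tau> * \<beta>)) *\<^sub>R (la - la)"
    "(\<lambda>k. (1 / (\<tau> * \<beta>)) *\<^sub>R (Lb k - Lb (Suc k))) \<longlonglongrightarrow> (1 / (\<tau> * \<beta>)) *\<^sub>R (lb - lb)"
    by (intro tendsto_intros L L')+
  then have "(\<lambda>k. X1 (Suc k) - X2 (Suc k)) \<longlonglongrightarrow> 0" "(\<lambda>k. X3 (Suc k) - X4 (Suc k)) \<longlonglongrightarrow> 0"
    using \<tau> \<beta> by (simp_all add: multiplier_step)
  then have feas: "x1 = x2" "x3 = x4"
    using LIMSEQ_unique[OF _ tendsto_diff[OF X'(1,2)]] LIMSEQ_unique[OF _ tendsto_diff[OF X'(3,4)]] by fastforce+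
  have in_R: "(x1, x2, x3, x4) \<in> blk_ball R" "(x1, x2) \<in> cball 0 R \<times> cball 0 R"
    using closed_sequentially[OF closed_cball _ X(1), of 0 R] closed_sequentially[OF closed_cball _ X(2), of 0 R]
      closed_sequentially[OF closed_cball _ X(3), of 0 R] closed_sequentially[OF closed_cball _ X(4), of 0 R] in_ball
    unfolding blk_ball_def by blast+
  \<comment> \<open>The optimality conditions evaluate gradients at mixed points such as
    \<open>u1 k\<close>. These stay in the closed ball, where the gradient is Lipschitz, and have
    the same limit because old and new blocks converge together.\<close>
  have F: "(\<lambda>k. grad f (w k)) \<longlonglongrightarrow> grad f (x1, x2, x3, x4)"
    if "\<And>k. w k \<in> blk_ball R" "w \<longlonglongrightarrow> (x1, x2, x3, x4)" for w
  proof (rule continuous_on_tendsto_compose[OF _ that(2) in_R(1)])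
    have "Lf-lipschitz_on (blk_ball R) (grad f)" using const unfolding ball_constants_def by blast
    then show "continuous_on (blk_ball R) (grad f)" by (rule lipschitz_on_continuous_on)
  qed (use that(1) in simp)
  have G: "(\<lambda>k. grad g (w k)) \<longlonglongrightarrow> grad g (x1, x2)"
    if "\<And>k. w k \<in> cball 0 R \<times> cball 0 R" "w \<longlonglongrightarrow> (x1, x2)" for w
  proof (rule continuous_on_tendsto_compose[OF _ that(2) in_R(2)])
    have "Lg-lipschitz_on (cball 0 R \<times> cball 0 R) (grad g)" using const unfolding ball_constants_def by blast
    then show "continuous_on (cball 0 R \<times> cball 0 R) (grad g)" by (rule lipschitz_on_continuous_on)
  qed (use that(1) in simp)
  note F1 = F[of u1, OF blocks_in_ball(1) tendsto_Pair[OF X'(1) tendsto_Pair[OF X(2) tendsto_Pair[OF X(3,4)]]]]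
    and F2 = F[of u2, OF blocks_in_ball(1) tendsto_Pair[OF X'(1) tendsto_Pair[OF X'(2) tendsto_Pair[OF X(3,4)]]]]
    and F3 = F[of u3, OF blocks_in_ball(1) tendsto_Pair[OF X'(1) tendsto_Pair[OF X'(2) tendsto_Pair[OF X'(3) X(4)]]]]
    and F4 = F[of "\<lambda>k. u4 (Suc k)", OF blocks_in_ball(1)
        tendsto_Pair[OF X'(1) tendsto_Pair[OF X'(2) tendsto_Pair[OF X'(3) X'(4)]]]]
    and G1 = G[of "\<lambda>k. (X1 (Suc k), X2 k)", OF blocks_in_ball(2) tendsto_Pair[OF X'(1) X(2)]]
    and G2 = G[of "\<lambda>k. (X1 (Suc k), X2 (Suc k))", OF blocks_in_ball(2) tendsto_Pair[OF X'(1) X'(2)]]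
  note bl = pos_block_diag_linear(1)[THEN linear_conv_bounded_linear[THEN iffD1], THEN bounded_linear.tendsto]
  note HL = bl[OF H1 tendsto_diff[OF X'(1) X(1)]] bl[OF H2 tendsto_diff[OF X'(2) X(2)]]
    bl[OF H3 tendsto_diff[OF X'(3) X(3)]] bl[OF H4 tendsto_diff[OF X'(4) X(4)]]
  have H0: "H1 0 = 0" "H2 0 = 0" "H3 0 = 0" "H4 0 = 0"
    using pos_block_diag_linear(1) H1 H2 H3 H4 linear_0 by blast+
  let ?x = "(x1, x2, x3, x4)"
  have "n1 \<longlonglongrightarrow> fst (grad f ?x) + fst (grad g (x1, x2)) - la + \<beta> *\<^sub>R (x1 - x2) + H1 (x1 - x1)"
    unfolding n1_def by (intro tendsto_intros F1 G1 L X X' HL)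
  then have n1: "n1 \<longlonglongrightarrow> fst (grad f ?x) + fst (grad g (x1, x2)) - la"
    by (simp add: feas(1) H0)
  have "(fst (grad f ?x) + fst (grad g (x1, x2)) - la) \<bullet> v = 0" if "v \<in> tangent_space M x1" for v
    by (rule normal_limit[where y = "\<lambda>k. X1 (Suc k)", OF M x1 X1_in_M X'(1) n1 optimality1 that])
  then have 1: "orth_proj (tangent_space M x1) (fst (grad f ?x) + fst (grad g (x1, x2)) - la) = 0"
    by (intro orth_proj_eq_0 subspace_tangent_space M x1)
  have "(\<lambda>k. F2 (u2 k) + G2 (X1 (Suc k), X2 (Suc k)) + La k + \<beta> *\<^sub>R (X2 (Suc k) - X1 (Suc k)) + H2 (d2 k))
      \<longlonglongrightarrow> fst (snd (grad f ?x)) + snd (grad g (x1, x2)) + la + \<beta> *\<^sub>R (x2 - x1) + H2 (x2 - x2)"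
    by (intro tendsto_intros F2 G2 L X' HL)
  then have 2: "fst (snd (grad f ?x)) + snd (grad g (x1, x2)) + la = 0"
    unfolding optimality2 by (simp add: feas(1) H0 LIMSEQ_const_iff)
  have "(\<lambda>k. F3 (u3 k) + - Lb k + \<beta> *\<^sub>R (X3 (Suc k) - X4 k) + H3 (d3 k))
      \<longlonglongrightarrow> fst (snd (snd (grad f ?x))) + - lb + \<beta> *\<^sub>R (x3 - x4) + H3 (x3 - x3)"
    by (intro tendsto_intros F3 L X X' HL)
  then have 3: "fst (snd (snd (grad f ?x))) - lb = 0"
    unfolding optimality3 by (simp add: feas(2) H0 LIMSEQ_const_iff)
  have "(\<lambda>k. F4 (u4 (Suc k)) + Lb k + \<beta> *\<^sub>R (X4 (Suc k) - X3 (Suc k)) + H4 (d4 k))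
      \<longlonglongrightarrow> snd (snd (snd (grad f ?x))) + lb + \<beta> *\<^sub>R (x4 - x3) + H4 (x4 - x4)"
    by (intro tendsto_intros F4 L X' HL)
  then have 4: "snd (snd (snd (grad f ?x))) + lb = 0"
    unfolding optimality4 by (simp add: feas(2) H0 LIMSEQ_const_iff)
  show ?thesis
    unfolding stationary_point.simps pgrad_eq[of f, OF f_diff] gpgrad_eq[of g, OF g_diff] adjoint_A lincon_eq
    using x1 feas 1 2 3 4 by (simp add: zero_prod_def)
qed

end

theorem theorem2:
  fixes M :: "'n::finite blk4 set"
    and f :: "'n vars \<Rightarrow> real" and g :: "'n blk4 \<times> 'n blk4 \<Rightarrow> real"
    and lf1 lf2 :: "'n blk4 \<times> 'n blk3 \<times> 'n blk3 \<Rightarrow> real"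
    and lf3 lf4 :: "'n blk4 \<times> 'n blk4 \<times> 'n blk3 \<Rightarrow> real"
    and lg1 lg2 :: "'n blk4 \<Rightarrow> real"
    and H1 H2 :: "'n blk4 \<Rightarrow> 'n blk4" and H3 H4 :: "'n blk3 \<Rightarrow> 'n blk3"
    and \<beta> \<tau> R Lf Lg Lg2 :: real
    and x :: "nat \<Rightarrow> 'n vars" and l :: "nat \<Rightarrow> 'n mult"
  assumes "embedded_submanifold M"
    and "assumption_A M f g lf1 lf2 lf3 lf4 lg1 lg2"
    and "pos_block_diag H1" and "pos_block_diag H2" and "pos_block_diag H3" and "pos_block_diag H4"
    and "0 < \<tau>" and "\<tau> < 2" and "0 < \<beta>"
    and "pradmm M f g \<beta> \<tau> H1 H2 H3 H4 x l"
    and "bounded (range (\<lambda>k. (x k, l k)))"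
    and "\<forall>k. x k \<in> blk_ball R"
    and "ball_constants R f g lg2 Lf Lg Lg2"
    and "\<forall>u\<in>Omega_star x l. riem_KL (lyap_space M) (lyap f g \<beta> \<tau> Lf Lg H1 H2 H3 H4) u"
    and "max (beta1 \<tau> Lf Lg Lg2 H1 H2 H3 H4) (beta2 \<tau> Lf Lg H1 H2 H3 H4) < \<beta>"
  shows "summable (\<lambda>k. norm (x (k + 2) - x (k + 1)) + norm (l (k + 2) - l (k + 1)))
    \<and> (\<exists>xh lh. (\<lambda>k. (x k, l k)) \<longlonglongrightarrow> (xh, lh) \<and> stationary_point M f g xh lh)"
proof -
  define X1 where "X1 k = fst (x k)" for k
  define X2 where "X2 k = fst (snd (x k))" for k
  define X3 where "X3 k = fst (snd (snd (x k)))" for k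
  define X4 where "X4 k = snd (snd (snd (x k)))" for k
  define La where "La k = fst (l k)" for k
  define Lb where "Lb k = snd (l k)" for k
  have x: "x = (\<lambda>k. (X1 k, X2 k, X3 k, X4 k))" and l: "l = (\<lambda>k. (La k, Lb k))"
    by (simp_all add: fun_eq_iff X1_def X2_def X3_def X4_def La_def Lb_def)
  interpret pradmm_run M f g lf1 lf2 lf3 lf4 lg1 lg2 H1 H2 H3 H4 \<beta> \<tau> R Lf Lg Lg2 X1 X2 X3 X4 La Lb
    using assms unfolding x l by unfold_locales simp_all
  have \<Omega>: "Omega_star x l = limit_points Z"
    by (simp only: Omega_star_def x l)
  have "riem_KL (lyap_space M) \<Psi> u" if "u \<in> limit_points Z" for u
    using assms(14) that unfolding \<Omega> by blast
  note ab = finite_length[OF this]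
  have inc: "norm (x (Suc k) - x k) = a k" "norm (l (Suc k) - l k) = b k" for k
    by (simp_all add: x l a_def b_def)
  \<comment> \<open>The sum in the statement starts with the increment from iterate 1 to iterate 2,
    so the term of index 0 is dropped.\<close>
  have "summable (\<lambda>k. a (k + 1) + b (k + 1))"
    using ab by (intro summable_add summable_ignore_initial_segment)
  then have 1: "summable (\<lambda>k. norm (x (k + 2) - x (k + 1)) + norm (l (k + 2) - l (k + 1)))"
    by (simp add: inc[symmetric])
  have "convergent x" "convergent l"
    using ab by (auto intro!: convergent_of_summable_increments simp: inc)
  then obtain xh lh where lim: "x \<longlonglongrightarrow> xh" "l \<longlonglongrightarrow> lh"
    unfolding convergent_def by blast
  \<comment> \<open>The whole sequence converges, so its limit is a point of
    \<open>Omega_star\<close>, with the identity as subsequence; the Kurdyka-Lojasiewicz hypothesis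
    at that point places the first block of the limit in \<open>M\<close>.\<close>
  have "(\<lambda>k. (x (Suc k), x k, l (Suc k), l k)) \<longlonglongrightarrow> (xh, xh, lh, lh)"
    by (intro tendsto_Pair lim LIMSEQ_Suc)
  then have "(xh, xh, lh, lh) \<in> Omega_star x l"
    unfolding Omega_star_def limit_points_def by (auto intro!: exI[of _ id] simp: strict_mono_id)
  then have "(xh, xh, lh, lh) \<in> lyap_space M"
    using assms(14) unfolding riem_KL_def by blast
  moreover obtain x1 x2 x3 x4 la lb where h: "xh = (x1, x2, x3, x4)" "lh = (la, lb)"
    by (metis surj_pair)
  ultimately have "x1 \<in> M" by (simp add: lyap_space_def)
  moreover have lim': "(\<lambda>k. (x k, l k)) \<longlonglongrightarrow> (xh, lh)" by (intro tendsto_Pair lim)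
  ultimately have "stationary_point M f g xh lh"
    unfolding h x l by (intro limit_stationary)
  then show ?thesis using 1 lim' by blast
qed

end
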